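(* Let $p$ be an odd prime, $(K,|\cdot|)$ an algebraically closed ultrametric field of residue characteristic $p$, and $q\ge1$ an integer not divisible by $p$. (1) Let $\lambda\in K$ with $|\lambda|=1$ such that the order of $\widetilde\lambda$ in $\widetilde K^*$ is $q$. Let $n\ge1$ be an integer and $P(z)=\lambda z+\cdots$ a polynomial in $\mathcal{O}_K[z]$ having an optimal cycle of period $qp^n$. Then this is the only cycle of minimal period $qp^n$ of $P$, and the reduction of $P$ is minimally ramified. (2) Let $\gamma\in\widetilde K$ be a root of unity of order $q$ and $g(\zeta)=\gamma\zeta+\cdots\in\widetilde K[\zeta]$ a minimally ramified polynomial. Given an integer $d\ge\max\{\deg(g),p\}$, let $a_1,\dots,a_d\in\mathcal{O}_K$ be algebraically independent over the prime field of $K$ and such that the reduction of $P(z)=a_1z+\cdots+a_dz^d$ is $g$. Then for every integer $n\ge1$, $P$ has a unique cycle of minimal period $qp^n$, and this cycle is an optimal cycle of period $qp^n$ of $P$.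
   Context: $\mathcal{O}_K=\{|z|\le1\}$, $\mathfrak{m}_K=\{|z|<1\}$, $\widetilde K=\mathcal{O}_K/\mathfrak{m}_K$; reduction of an element or of a polynomial/power series with coefficients in $\mathcal{O}_K$ is coefficientwise projection to $\widetilde K$. Periodic points are considered in $\mathfrak{m}_K$; minimal period is the least $\ell\ge1$ with $f^\ell(z_0)=z_0$. For $f(z)=\lambda z+\cdots\in\mathcal{O}_K[[z]]$ with $|\lambda|=1$, $\widetilde\lambda$ of order $q$, and $n\ge1$ with $\lambda^{qp^n}\ne1$, $f$ has an optimal cycle of period $qp^n$ if it has a periodic point $z_0$ of minimal period $qp^n$ with $|z_0|=\left|\frac{\lambda^{qp^n}-1}{\lambda^{qp^{n-1}}-1}\right|^{1/(qp^n)}$. For a field $k$ of characteristic $p$, $\mathrm{ord}$ denotes the lowest degree of a nonzero term of a power series in $k[[\zeta]]$ ($\mathrm{ord}(0)=+\infty$); for $h(\zeta)=\zeta+\cdots$ set $i_n(h)=\mathrm{ord}\big((h^{p^n}(\zeta)-\zeta)/\zeta\big)$. For a root of unity $\gamma\in k$ of order $q$, a power series $g(\zeta)=\gamma\zeta+\cdots\in k[[\zeta]]$ is minimally ramified if $i_n(g^q)=q\frac{p^{n+1}-1}{p-1}$ for every integer $n\ge0$. *)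

theory Defs
  imports "HOL-Computational_Algebra.Polynomial" "HOL-Library.Extended_Nat" Complex_Main
begin

definition ultrametric_abs :: "('a::field \<Rightarrow> real) \<Rightarrow> bool" where
  "ultrametric_abs absv \<longleftrightarrow>
     (\<forall>x. 0 \<le> absv x) \<and> (\<forall>x. absv x = 0 \<longleftrightarrow> x = 0) \<and>
     (\<forall>x y. absv (x * y) = absv x * absv y) \<and>
     (\<forall>x y. absv (x + y) \<le> max (absv x) (absv y))"

definition alg_closed_field :: "'a::field itself \<Rightarrow> bool" where
  "alg_closed_field _ \<longleftrightarrow> (\<forall>f :: 'a poly. 0 < degree f \<longrightarrow> (\<exists>x. poly f x = 0))"

text \<open>red is the reduction map O_K -> O_K/m_K (residue field 'k, up to isomorphism):
  a surjective ring homomorphism from O_K onto 'k whose kernel is m_K.\<close>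
definition residue_map :: "('a::field \<Rightarrow> real) \<Rightarrow> ('a \<Rightarrow> 'k::field) \<Rightarrow> bool" where
  "residue_map absv red \<longleftrightarrow>
     red 0 = 0 \<and> red 1 = 1 \<and>
     (\<forall>x y. absv x \<le> 1 \<longrightarrow> absv y \<le> 1 \<longrightarrow> red (x + y) = red x + red y) \<and>
     (\<forall>x y. absv x \<le> 1 \<longrightarrow> absv y \<le> 1 \<longrightarrow> red (x * y) = red x * red y) \<and>
     (\<forall>c. \<exists>x. absv x \<le> 1 \<and> red x = c) \<and>
     (\<forall>x. absv x \<le> 1 \<longrightarrow> (red x = 0 \<longleftrightarrow> absv x < 1))"

definition root_of_unity_order :: "'k::field \<Rightarrow> nat \<Rightarrow> bool" where
  "root_of_unity_order \<gamma> q \<longleftrightarrow> 1 \<le> q \<and> \<gamma> ^ q = 1 \<and> (\<forall>m. 1 \<le> m \<and> m < q \<longrightarrow> \<gamma> ^ m \<noteq> 1)"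

definition periodic_min :: "('a::field \<Rightarrow> real) \<Rightarrow> ('a \<Rightarrow> 'a) \<Rightarrow> nat \<Rightarrow> 'a \<Rightarrow> bool" where
  "periodic_min absv f l z \<longleftrightarrow> absv z < 1 \<and> 1 \<le> l \<and> (f ^^ l) z = z \<and>
     (\<forall>m. 1 \<le> m \<and> m < l \<longrightarrow> (f ^^ m) z \<noteq> z)"

definition optimal_point ::
  "('a::field \<Rightarrow> real) \<Rightarrow> 'a \<Rightarrow> nat \<Rightarrow> nat \<Rightarrow> nat \<Rightarrow> ('a \<Rightarrow> 'a) \<Rightarrow> 'a \<Rightarrow> bool" where
  "optimal_point absv lam q p n f z \<longleftrightarrow>
     periodic_min absv f (q * p ^ n) z \<and>
     absv z = absv ((lam ^ (q * p ^ n) - 1) / (lam ^ (q * p ^ (n - 1)) - 1))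
                powr (1 / real (q * p ^ n))"

definition has_optimal_cycle ::
  "('a::field \<Rightarrow> real) \<Rightarrow> 'a \<Rightarrow> nat \<Rightarrow> nat \<Rightarrow> nat \<Rightarrow> ('a \<Rightarrow> 'a) \<Rightarrow> bool" where
  "has_optimal_cycle absv lam q p n f \<longleftrightarrow>
     lam ^ (q * p ^ n) \<noteq> 1 \<and> (\<exists>z. optimal_point absv lam q p n f z)"

definition ord_poly :: "'k::zero poly \<Rightarrow> enat" where
  "ord_poly f = (if f = 0 then \<infinity> else enat (LEAST i. coeff f i \<noteq> 0))"

definition poly_iter :: "'k::comm_semiring_1 poly \<Rightarrow> nat \<Rightarrow> 'k poly" where
  "poly_iter h m = ((\<lambda>u. pcompose h u) ^^ m) [:0, 1:]"

definition i_index :: "nat \<Rightarrow> 'k::field poly \<Rightarrow> nat \<Rightarrow> enat" where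
  "i_index p h n = ord_poly ((poly_iter h (p ^ n) - [:0, 1:]) div [:0, 1:])"

definition minimally_ramified :: "nat \<Rightarrow> nat \<Rightarrow> 'k::field poly \<Rightarrow> bool" where
  "minimally_ramified p q g \<longleftrightarrow>
     (\<forall>n. i_index p (poly_iter g q) n = enat (q * ((p ^ (n + 1) - 1) div (p - 1))))"

text \<open>a_1..a_d algebraically independent over the prime field of K: no nontrivial
  polynomial relation with coefficients from the prime field (equivalently, after
  clearing denominators, with integer coefficients whose images in K are not all 0).\<close>
definition alg_indep_prime :: "nat \<Rightarrow> (nat \<Rightarrow> 'a::field) \<Rightarrow> bool" where
  "alg_indep_prime d a \<longleftrightarrow>
     (\<forall>S (c :: (nat \<Rightarrow> nat) \<Rightarrow> int). finite S \<longrightarrow>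
        (\<forall>\<alpha>\<in>S. \<forall>i. i \<notin> {1..d} \<longrightarrow> \<alpha> i = 0) \<longrightarrow>
        (\<Sum>\<alpha>\<in>S. of_int (c \<alpha>) * (\<Prod>i\<in>{1..d}. a i ^ \<alpha> i)) = (0::'a) \<longrightarrow>
        (\<forall>\<alpha>\<in>S. of_int (c \<alpha>) = (0::'a)))"

end

theory Submission
  imports Defs "HOL-Computational_Algebra.Polynomial_FPS" "HOL-Computational_Algebra.Field_as_Ring"
    "HOL-Number_Theory.Cong" "Subresultants.Subresultant_Gcd"
begin

text \<open>Write P(m) for the m-th iterate of P and let D be the quotient of P(q p^n) - X by P(q p^(n-1)) - X.
  The points of minimal period q p^n are zeros of D. By Weierstrass factorisation the number of zeros of D in
  the open unit disc is the order i_n - i_(n-1) of its reduction, and |D(0)| is at most the product of the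
  absolute values of any set of these zeros, with equality only for the full set. So an optimal cycle consists of
  all the zeros of D, and i_n - i_(n-1) = q p^n.

  Since i_(j+1) is at least p i_j and each i_j is divisible by q, this equation forces i_0 = q and i_1 = q (p+1).
  These two values determine all the others: in a coordinate that is invariant under a high iterate of the
  reduction one may assume q = 1, and then the two lowest coefficients of 1/X - 1/h, for h an iterate of
  order p^m, determine those of the next iterate and stay nonzero.

  Conversely, minimal ramification gives D exactly q p^n zeros. If one of them had a smaller period, its
  multiplier \<mu> for P(q p^(n-1)) would satisfy 1 + \<mu> + ... + \<mu>^(p-1) = 0. In characteristic p this means \<mu> = 1, so that
  the zero would be a multiple zero of an earlier quotient, whose zeros are known to be simple. In
  characteristic 0 a resultant would vanish identically in the coefficients of P, but it does not vanish
  at the power map z^d.\<close>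

section \<open>Specialisation of algebraically independent coefficients\<close>

text \<open>When p divides the order of a series \<phi>, the expected leading coefficient of
  \<open>(\<phi> oo H) - \<phi>\<close> vanishes, so following a single coefficient is not enough to
  pass from H to its p-th iterate. Two coefficients of 1/X - 1/H are enough: the new order is again
  divisible by p, and the recursion closes. Oddness of p enters through division by 2 in binomial
  coefficients and through the inequalities 2 (p - 1) > p and (p - 1) (p + 2) > p^2.

  No iterate of the reduction has to be of finite order, so the invariant coordinate is constructed
  only modulo X^N, with N beyond all orders that are compared.

  Algebraic independence is used twice: \<open>a 1\<close> is not a root of unity, which keeps the
  constant term of D away from 0, and in characteristic 0 no multiplier is a nontrivial p-th root of
  unity. The power map is a good specialisation because its leading coefficient is 1: no degree
  drops, and the Sylvester matrices before and after have the same size.\<close>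

text \<open>For algebraically independent a, this relation is the graph of the evaluation homomorphism
  from the ring generated by a 1, ..., a d that sends each a i to b i.\<close>

definition monomial_eval :: "nat \<Rightarrow> (nat \<Rightarrow> 'a::comm_ring_1) \<Rightarrow> int \<times> (nat \<Rightarrow> nat) \<Rightarrow> 'a" where
  "monomial_eval d a = (\<lambda>(c, \<alpha>). of_int c * (\<Prod>i\<in>{1..d}. a i ^ \<alpha> i))"

definition specializes :: "nat \<Rightarrow> (nat \<Rightarrow> 'a::comm_ring_1) \<Rightarrow> (nat \<Rightarrow> 'b::comm_ring_1) \<Rightarrow> 'a \<Rightarrow> 'b \<Rightarrow> bool" where
  "specializes d a b x y \<longleftrightarrow> (\<exists>l. (\<forall>t\<in>set l. \<forall>i. i \<notin> {1..d} \<longrightarrow> snd t i = 0) \<and>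
     x = (\<Sum>t\<leftarrow>l. monomial_eval d a t) \<and> y = (\<Sum>t\<leftarrow>l. monomial_eval d b t))"

context
  fixes d :: nat and a :: "nat \<Rightarrow> 'a::idom" and b :: "nat \<Rightarrow> 'b::idom"
begin

lemma specializes_of_int: "specializes d a b (of_int c) (of_int c)"
  unfolding specializes_def by (rule exI[of _ "[(c, \<lambda>_. 0)]"]) (simp add: monomial_eval_def)

lemma specializes_0: "specializes d a b 0 0" and specializes_1: "specializes d a b 1 1"
  using specializes_of_int[of 0] specializes_of_int[of 1] by simp_all

lemma specializes_of_nat: "specializes d a b (of_nat n) (of_nat n)"
  using specializes_of_int[of "int n"] by simp

private lemma monomial_eval_var:
  "i \<in> {1..d} \<Longrightarrow> monomial_eval d u (1, \<lambda>j. if j = i then 1 else 0) = u i" for u :: "nat \<Rightarrow> 'c::comm_ring_1"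
proof -
  assume i: "i \<in> {1..d}"
  have "(\<Prod>j\<in>{1..d}. u j ^ (if j = i then 1 else 0)) = (\<Prod>j\<in>{1..d}. if j = i then u j else 1)"
    by (intro prod.cong) auto
  then show ?thesis using i by (simp add: monomial_eval_def)
qed

lemma specializes_var: "i \<in> {1..d} \<Longrightarrow> specializes d a b (a i) (b i)"
  unfolding specializes_def
proof (intro exI conjI)
  let ?l = "[(1 :: int, \<lambda>j. if j = i then 1 else 0 :: nat)]"
  assume i: "i \<in> {1..d}"
  then show "\<forall>t\<in>set ?l. \<forall>j. j \<notin> {1..d} \<longrightarrow> snd t j = 0" by auto
  show "a i = (\<Sum>t\<leftarrow>?l. monomial_eval d a t)" "b i = (\<Sum>t\<leftarrow>?l. monomial_eval d b t)"
    by (simp_all only: list.map sum_list.Cons sum_list.Nil monomial_eval_var[OF i] add_0_right)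
qed

lemma specializes_add: "specializes d a b x y \<Longrightarrow> specializes d a b x' y' \<Longrightarrow> specializes d a b (x + x') (y + y')"
  unfolding specializes_def
proof (elim exE conjE)
  fix l l'
  assume "\<forall>t\<in>set l. \<forall>i. i \<notin> {1..d} \<longrightarrow> snd t i = 0" "\<forall>t\<in>set l'. \<forall>i. i \<notin> {1..d} \<longrightarrow> snd t i = 0"
    "x = (\<Sum>t\<leftarrow>l. monomial_eval d a t)" "y = (\<Sum>t\<leftarrow>l. monomial_eval d b t)"
    "x' = (\<Sum>t\<leftarrow>l'. monomial_eval d a t)" "y' = (\<Sum>t\<leftarrow>l'. monomial_eval d b t)"
  then show "\<exists>l. (\<forall>t\<in>set l. \<forall>i. i \<notin> {1..d} \<longrightarrow> snd t i = 0) \<and>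
     x + x' = (\<Sum>t\<leftarrow>l. monomial_eval d a t) \<and> y + y' = (\<Sum>t\<leftarrow>l. monomial_eval d b t)"
    by (intro exI[of _ "l @ l'"]) auto
qed

private definition mono_mult :: "int \<times> (nat \<Rightarrow> nat) \<Rightarrow> int \<times> (nat \<Rightarrow> nat) \<Rightarrow> int \<times> (nat \<Rightarrow> nat)" where
  "mono_mult s t = (fst s * fst t, \<lambda>i. snd s i + snd t i)"

private lemma monomial_eval_mult:
  "monomial_eval d u (mono_mult s t) = monomial_eval d u s * monomial_eval d u t" for u :: "nat \<Rightarrow> 'c::comm_ring_1"
  by (simp add: monomial_eval_def mono_mult_def split_beta power_add prod.distrib mult_ac)

private lemma sum_list_mult:
  "(\<Sum>t\<leftarrow>concat (map (\<lambda>s. map (mono_mult s) l') l). monomial_eval d u t)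
    = (\<Sum>t\<leftarrow>l. monomial_eval d u t) * (\<Sum>t\<leftarrow>l'. monomial_eval d u t)" for u :: "nat \<Rightarrow> 'c::comm_ring_1"
proof (induction l)
  case (Cons s l)
  have "(\<Sum>t\<leftarrow>map (mono_mult s) l'. monomial_eval d u t) = monomial_eval d u s * (\<Sum>t\<leftarrow>l'. monomial_eval d u t)"
    by (induction l') (simp_all add: monomial_eval_mult distrib_left)
  then show ?case using Cons by (simp add: distrib_right)
qed simp

lemma specializes_mult: "specializes d a b x y \<Longrightarrow> specializes d a b x' y' \<Longrightarrow> specializes d a b (x * x') (y * y')"
  unfolding specializes_def
proof (elim exE conjE)
  fix l l'
  assume "\<forall>t\<in>set l. \<forall>i. i \<notin> {1..d} \<longrightarrow> snd t i = 0" "\<forall>t\<in>set l'. \<forall>i. i \<notin> {1..d} \<longrightarrow> snd t i = 0"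
    "x = (\<Sum>t\<leftarrow>l. monomial_eval d a t)" "y = (\<Sum>t\<leftarrow>l. monomial_eval d b t)"
    "x' = (\<Sum>t\<leftarrow>l'. monomial_eval d a t)" "y' = (\<Sum>t\<leftarrow>l'. monomial_eval d b t)"
  then show "\<exists>l. (\<forall>t\<in>set l. \<forall>i. i \<notin> {1..d} \<longrightarrow> snd t i = 0) \<and>
     x * x' = (\<Sum>t\<leftarrow>l. monomial_eval d a t) \<and> y * y' = (\<Sum>t\<leftarrow>l. monomial_eval d b t)"
    by (intro exI[of _ "concat (map (\<lambda>s. map (mono_mult s) l') l)"] conjI)
      (auto simp only: sum_list_mult, auto simp: mono_mult_def)
qed

lemma specializes_diff: "specializes d a b x y \<Longrightarrow> specializes d a b x' y' \<Longrightarrow> specializes d a b (x - x') (y - y')"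
  using specializes_add[of x y "of_int (- 1) * x'" "of_int (- 1) * y'"] specializes_mult[OF specializes_of_int[of "-1"], of x' y']
  by simp

lemma specializes_sum:
  "(\<And>i. i \<in> A \<Longrightarrow> specializes d a b (f i) (g i)) \<Longrightarrow> specializes d a b (\<Sum>i\<in>A. f i) (\<Sum>i\<in>A. g i)"
  by (induction A rule: infinite_finite_induct) (auto intro: specializes_0 specializes_add)

lemma specializes_prod:
  "(\<And>i. i \<in> A \<Longrightarrow> specializes d a b (f i) (g i)) \<Longrightarrow> specializes d a b (\<Prod>i\<in>A. f i) (\<Prod>i\<in>A. g i)"
  by (induction A rule: infinite_finite_induct) (auto intro: specializes_1 specializes_mult)

lemma specializes_power: "specializes d a b x y \<Longrightarrow> specializes d a b (x ^ n) (y ^ n)"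
  by (induction n) (auto intro: specializes_1 specializes_mult)

section \<open>Specialisation of polynomials, iterates and resultants\<close>

definition poly_specializes :: "'a poly \<Rightarrow> 'b poly \<Rightarrow> bool" where
  "poly_specializes F F' \<longleftrightarrow> (\<forall>i. specializes d a b (coeff F i) (coeff F' i))"

lemma poly_specializes_pCons: "specializes d a b x y \<Longrightarrow> poly_specializes F F' \<Longrightarrow> poly_specializes (pCons x F) (pCons y F')"
  by (auto simp: poly_specializes_def coeff_pCons split: nat.splits)

lemma poly_specializes_0: "poly_specializes 0 0"
  by (simp add: poly_specializes_def specializes_0)

lemma poly_specializes_1: "poly_specializes 1 1"
  unfolding one_pCons by (intro poly_specializes_pCons specializes_1 poly_specializes_0)

lemma poly_specializes_X: "poly_specializes [:0, 1:] [:0, 1:]"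
  by (intro poly_specializes_pCons specializes_0 specializes_1 poly_specializes_0)

lemma poly_specializes_add: "poly_specializes F F' \<Longrightarrow> poly_specializes G G' \<Longrightarrow> poly_specializes (F + G) (F' + G')"
  by (simp add: poly_specializes_def specializes_add)

lemma poly_specializes_diff: "poly_specializes F F' \<Longrightarrow> poly_specializes G G' \<Longrightarrow> poly_specializes (F - G) (F' - G')"
  by (simp add: poly_specializes_def specializes_diff)

lemma poly_specializes_mult: "poly_specializes F F' \<Longrightarrow> poly_specializes G G' \<Longrightarrow> poly_specializes (F * G) (F' * G')"
  by (simp add: poly_specializes_def coeff_mult specializes_sum specializes_mult)

lemma poly_specializes_smult: "specializes d a b x y \<Longrightarrow> poly_specializes G G' \<Longrightarrow> poly_specializes (Polynomial.smult x G) (Polynomial.smult y G')"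
  by (simp add: poly_specializes_def specializes_mult)

lemma poly_specializes_power: "poly_specializes F F' \<Longrightarrow> poly_specializes (F ^ n) (F' ^ n)"
  by (induction n) (auto intro: poly_specializes_1 poly_specializes_mult)

lemma poly_specializes_sum:
  "(\<And>i. i \<in> A \<Longrightarrow> poly_specializes (f i) (g i)) \<Longrightarrow> poly_specializes (\<Sum>i\<in>A. f i) (\<Sum>i\<in>A. g i)"
  by (induction A rule: infinite_finite_induct) (auto intro: poly_specializes_0 poly_specializes_add)

lemma poly_specializes_pderiv: "poly_specializes F F' \<Longrightarrow> poly_specializes (pderiv F) (pderiv F')"
  unfolding poly_specializes_def coeff_pderiv by (auto intro!: specializes_mult simp: specializes_of_nat simp del: of_nat_Suc)

lemma pcompose_sum_monom:
  "pcompose (\<Sum>i=1..d. monom (u i) i) Q = (\<Sum>i=1..d. Polynomial.smult (u i) (Q ^ i))" for u :: "nat \<Rightarrow> 'c::comm_ring_1"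
proof -
  have "pcompose (monom c i) Q = Polynomial.smult c (Q ^ i)" for c i
    by (induction i) (simp_all add: monom_0 monom_Suc pcompose_pCons)
  then show ?thesis by (simp add: pcompose_sum)
qed

lemma poly_iter_Suc: "poly_iter h (Suc m) = pcompose h (poly_iter h m)"
  by (simp add: poly_iter_def)

lemma poly_specializes_poly_iter:
  "poly_specializes (poly_iter (\<Sum>i=1..d. monom (a i) i) m) (poly_iter (\<Sum>i=1..d. monom (b i) i) m)"
proof (induction m)
  case (Suc m)
  show ?case
    unfolding poly_iter_Suc pcompose_sum_monom
    using Suc by (auto intro!: poly_specializes_sum poly_specializes_smult poly_specializes_power specializes_var)
qed (use poly_specializes_X in \<open>simp add: poly_iter_def\<close>)

text \<open>By the Leibniz formula the determinant is an integer polynomial in the entries, the same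
  polynomial for both matrices because their sizes agree.\<close>

lemma specializes_det:
  assumes "dim_row A = n" "dim_col A = n" "dim_row B = n" "dim_col B = n"
    and "\<And>i j. i < n \<Longrightarrow> j < n \<Longrightarrow> specializes d a b (A $$ (i, j)) (B $$ (i, j))"
  shows "specializes d a b (det A) (det B)"
  unfolding det_def assms(1-4)
  by (auto intro!: specializes_sum specializes_mult specializes_prod specializes_of_int assms(5)
    dest: permutes_in_image)

text \<open>Equal degrees make the two Sylvester matrices equal in size; a drop in degree would
  change the polynomial expression that the resultant stands for.\<close>

lemma specializes_resultant:
  assumes "poly_specializes F F'" "poly_specializes G G'" "degree F = degree F'" "degree G = degree G'"
  shows "specializes d a b (resultant F G) (resultant F' G')"
  unfolding resultant_def
proof (rule specializes_det[where n = "degree F + degree G"])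
  fix i j assume "i < degree F + degree G" "j < degree F + degree G"
  then show "specializes d a b (sylvester_mat F G $$ (i, j)) (sylvester_mat F' G' $$ (i, j))"
    using assms by (simp add: sylvester_index_mat poly_specializes_def specializes_0)
qed (simp_all add: assms)

text \<open>The lists behind \<open>specializes\<close> may repeat an exponent vector, which makes
  sums and products easy. Algebraic independence speaks of one coefficient per exponent vector, so
  repetitions are added up here.\<close>

private definition collect_coeff :: "(int \<times> (nat \<Rightarrow> nat)) list \<Rightarrow> (nat \<Rightarrow> nat) \<Rightarrow> int" where
  "collect_coeff l \<alpha> = (\<Sum>t\<leftarrow>l. if snd t = \<alpha> then fst t else 0)"

private lemma sum_collect_coeff:
  fixes u :: "nat \<Rightarrow> 'c::comm_ring_1"
  assumes "finite S" "snd ` set l \<subseteq> S"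
  shows "(\<Sum>\<alpha>\<in>S. of_int (collect_coeff l \<alpha>) * (\<Prod>i\<in>{1..d}. u i ^ \<alpha> i)) = (\<Sum>t\<leftarrow>l. monomial_eval d u t)"
  using assms(2)
proof (induction l)
  case (Cons t l)
  have "(\<Sum>\<alpha>\<in>S. of_int (collect_coeff (t # l) \<alpha>) * (\<Prod>i\<in>{1..d}. u i ^ \<alpha> i)) =
      (\<Sum>\<alpha>\<in>S. if snd t = \<alpha> then of_int (fst t) * (\<Prod>i\<in>{1..d}. u i ^ \<alpha> i) else 0) +
      (\<Sum>\<alpha>\<in>S. of_int (collect_coeff l \<alpha>) * (\<Prod>i\<in>{1..d}. u i ^ \<alpha> i))"
    unfolding sum.distrib[symmetric] by (intro sum.cong) (auto simp: collect_coeff_def distrib_right)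
  also have "(\<Sum>\<alpha>\<in>S. if snd t = \<alpha> then of_int (fst t) * (\<Prod>i\<in>{1..d}. u i ^ \<alpha> i) else 0) = monomial_eval d u t"
    using Cons.prems assms(1) by (subst sum.delta') (auto simp: monomial_eval_def split_beta)
  finally show ?case using Cons by simp
qed (simp add: collect_coeff_def)

text \<open>After collecting terms, independence makes every coefficient vanish in the source ring.
  The hypothesis on integers carries this to the target, so the same combination evaluated at b is
  0.\<close>

lemma specializes_eq_0:
  assumes indep: "\<And>S c. finite S \<Longrightarrow> \<forall>\<alpha>\<in>S. \<forall>i. i \<notin> {1..d} \<longrightarrow> \<alpha> i = 0 \<Longrightarrow>
         (\<Sum>\<alpha>\<in>S. of_int (c \<alpha>) * (\<Prod>i\<in>{1..d}. a i ^ \<alpha> i)) = 0 \<Longrightarrow> \<forall>\<alpha>\<in>S. of_int (c \<alpha>) = (0::'a)"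
    and char: "\<And>c. of_int c = (0::'a) \<Longrightarrow> of_int c = (0::'b)"
    and sp: "specializes d a b 0 y"
  shows "y = 0"
proof -
  obtain l where l: "\<forall>t\<in>set l. \<forall>i. i \<notin> {1..d} \<longrightarrow> snd t i = 0"
     "0 = (\<Sum>t\<leftarrow>l. monomial_eval d a t)" "y = (\<Sum>t\<leftarrow>l. monomial_eval d b t)"
    using sp unfolding specializes_def by blast
  define S where "S = snd ` set l"
  define c where "c = collect_coeff l"
  have group_a: "(\<Sum>\<alpha>\<in>S. of_int (c \<alpha>) * (\<Prod>i\<in>{1..d}. a i ^ \<alpha> i)) = (\<Sum>t\<leftarrow>l. monomial_eval d a t)"
    and group_b: "(\<Sum>\<alpha>\<in>S. of_int (c \<alpha>) * (\<Prod>i\<in>{1..d}. b i ^ \<alpha> i)) = (\<Sum>t\<leftarrow>l. monomial_eval d b t)"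
    unfolding c_def by (rule sum_collect_coeff; simp add: S_def)+
  have za: "\<forall>\<alpha>\<in>S. of_int (c \<alpha>) = (0::'a)"
  proof (rule indep)
    show "(\<Sum>\<alpha>\<in>S. of_int (c \<alpha>) * (\<Prod>i\<in>{1..d}. a i ^ \<alpha> i)) = 0" using group_a l(2) by metis
    show "finite S" by (simp add: S_def)
    show "\<forall>\<alpha>\<in>S. \<forall>i. i \<notin> {1..d} \<longrightarrow> \<alpha> i = 0"
    proof (intro ballI allI impI)
      fix \<alpha> i assume "\<alpha> \<in> S" "i \<notin> {1..d}"
      then obtain t where "t \<in> set l" "\<alpha> = snd t" unfolding S_def by (elim imageE)
      then show "\<alpha> i = 0" using l(1) \<open>i \<notin> {1..d}\<close> by metis
    qed
  qed
  have zb: "of_int (c \<alpha>) = (0::'b)" if "\<alpha> \<in> S" for \<alpha>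
    by (rule char, rule bspec[OF za that])
  have "y = (\<Sum>\<alpha>\<in>S. of_int (c \<alpha>) * (\<Prod>i\<in>{1..d}. b i ^ \<alpha> i))" unfolding l(3) group_b ..
  also have "\<dots> = 0"
  proof (rule sum.neutral, rule ballI)
    fix \<alpha> assume "\<alpha> \<in> S"
    show "of_int (c \<alpha>) * (\<Prod>i\<in>{1..d}. b i ^ \<alpha> i) = 0" by (simp only: zb[OF \<open>\<alpha> \<in> S\<close>] mult_zero_left)
  qed
  finally show "y = 0" .
qed

end

section \<open>Common zeros, resultants and the power map\<close>

text \<open>The vector of descending powers of r lies in the kernel of the Sylvester matrix: a row
  built from F yields a power of r times F(r), a row built from G a power of r times G(r). Its last
  entry is r^0 = 1, so it is not zero.\<close>

lemma resultant_common_root: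
  fixes F G :: "'a::field poly"
  assumes r: "poly F r = 0" "poly G r = 0" and deg: "0 < degree F"
  shows "resultant F G = 0"
proof -
  let ?m = "degree F" and ?n = "degree G"
  define v where "v = vec (?m + ?n) (\<lambda>j. r ^ (?m + ?n - 1 - j))"
  have "sylvester_mat F G *\<^sub>v v = 0\<^sub>v (?m + ?n)"
  proof (rule eq_vecI)
    fix i assume "i < dim_vec (0\<^sub>v (?m + ?n) :: 'a vec)"
    then have i: "i < ?m + ?n" by simp
    have "(sylvester_mat F G *\<^sub>v v) $ i = (\<Sum>j\<in>{0..<?m + ?n}. sylvester_mat F G $$ (i, j) * r ^ (?m + ?n - 1 - j))"
      using i by (simp add: v_def scalar_prod_def)
    also have "\<dots> = 0"
    proof (cases "i < ?n")
      case True
      have "(\<Sum>j\<in>{0..<?m + ?n}. sylvester_mat F G $$ (i, j) * r ^ (?m + ?n - 1 - j))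
          = (\<Sum>j\<in>{i..i + ?m}. coeff F (?m + i - j) * r ^ (?m + ?n - 1 - j))"
        using i True by (intro sum.mono_neutral_cong_right) (auto simp: sylvester_index_mat)
      also have "\<dots> = (\<Sum>k\<le>?m. r ^ (?n - 1 - i) * (coeff F k * r ^ k))"
      proof (intro sum.reindex_bij_witness[of _ "\<lambda>k. ?m + i - k" "\<lambda>j. ?m + i - j"])
        fix j assume "j \<in> {i..i + ?m}"
        then have "?m + ?n - 1 - j = (?n - 1 - i) + (?m + i - j)" using True by auto
        then show "r ^ (?n - 1 - i) * (coeff F (?m + i - j) * r ^ (?m + i - j)) =
            coeff F (?m + i - j) * r ^ (?m + ?n - 1 - j)"
          by (simp only: power_add mult_ac)
      qed auto
      also have "\<dots> = r ^ (?n - 1 - i) * poly F r" by (simp add: poly_altdef sum_distrib_left)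
      finally show ?thesis using r by simp
    next
      case False
      have "(\<Sum>j\<in>{0..<?m + ?n}. sylvester_mat F G $$ (i, j) * r ^ (?m + ?n - 1 - j))
          = (\<Sum>j\<in>{i - ?n..i}. coeff G (i - j) * r ^ (?m + ?n - 1 - j))"
        using i False by (intro sum.mono_neutral_cong_right) (auto simp: sylvester_index_mat)
      also have "\<dots> = (\<Sum>k\<le>?n. r ^ (?m + ?n - 1 - i) * (coeff G k * r ^ k))"
      proof (intro sum.reindex_bij_witness[of _ "\<lambda>k. i - k" "\<lambda>j. i - j"])
        fix j assume "j \<in> {i - ?n..i}"
        then have "?m + ?n - 1 - j = (?m + ?n - 1 - i) + (i - j)" using i by auto
        then show "r ^ (?m + ?n - 1 - i) * (coeff G (i - j) * r ^ (i - j)) = coeff G (i - j) * r ^ (?m + ?n - 1 - j)"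
          by (simp only: power_add mult_ac)
      qed (use i False in auto)
      also have "\<dots> = r ^ (?m + ?n - 1 - i) * poly G r" by (simp add: poly_altdef sum_distrib_left)
      finally show ?thesis using r by simp
    qed
    finally show "(sylvester_mat F G *\<^sub>v v) $ i = 0\<^sub>v (?m + ?n) $ i" using i by simp
  qed simp
  moreover have "v \<in> carrier_vec (?m + ?n)" by (simp add: v_def)
  moreover have "v \<noteq> 0\<^sub>v (?m + ?n)"
  proof
    assume "v = 0\<^sub>v (?m + ?n)"
    then have "v $ (?m + ?n - 1) = 0\<^sub>v (?m + ?n) $ (?m + ?n - 1)" by simp
    then show False using deg by (simp add: v_def)
  qed
  ultimately show ?thesis
    unfolding resultant_def using det_0_iff_vec_prod_zero_field[OF sylvester_carrier_mat] by blast
qed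


lemma alg_indep_specializes_eq_0:
  fixes a :: "nat \<Rightarrow> 'a::field" and b :: "nat \<Rightarrow> 'b::idom"
  assumes "alg_indep_prime d a" "\<And>c. of_int c = (0::'a) \<Longrightarrow> of_int c = (0::'b)" "specializes d a b 0 y"
  shows "y = 0"
proof (rule specializes_eq_0[OF _ assms(2,3)])
  fix S and c :: "(nat \<Rightarrow> nat) \<Rightarrow> int"
  assume f: "finite S" and z: "\<forall>\<alpha>\<in>S. \<forall>i. i \<notin> {1..d} \<longrightarrow> \<alpha> i = 0"
    and s: "(\<Sum>\<alpha>\<in>S. of_int (c \<alpha>) * (\<Prod>i\<in>{1..d}. a i ^ \<alpha> i)) = (0::'a)"
  from assms(1) have "finite S \<longrightarrow> (\<forall>\<alpha>\<in>S. \<forall>i. i \<notin> {1..d} \<longrightarrow> \<alpha> i = 0) \<longrightarrow>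
      (\<Sum>\<alpha>\<in>S. of_int (c \<alpha>) * (\<Prod>i\<in>{1..d}. a i ^ \<alpha> i)) = (0::'a) \<longrightarrow> (\<forall>\<alpha>\<in>S. of_int (c \<alpha>) = (0::'a))"
    unfolding alg_indep_prime_def by (elim allE)
  from mp[OF mp[OF mp[OF this f] z] s] show "\<forall>\<alpha>\<in>S. of_int (c \<alpha>) = (0::'a)" .
qed

lemma coeff_sum_monom: "coeff (\<Sum>i=1..d. monom (u i) i) k = (if 1 \<le> k \<and> k \<le> d then u k else 0)"
  by (simp add: coeff_sum)

lemma degree_sum_monom: "u d \<noteq> 0 \<Longrightarrow> 1 \<le> d \<Longrightarrow> degree (\<Sum>i=1..d. monom (u i) i) = d"
  by (intro antisym degree_le le_degree allI impI; simp only: coeff_sum_monom; simp)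

lemma degree_poly_iter: "degree (poly_iter h m) = degree h ^ m" for h :: "'a::idom poly"
  by (induction m) (simp_all add: poly_iter_def degree_pcompose)

lemma degree_geometric_sum:
  fixes Q :: "'a::idom poly"
  assumes "1 \<le> degree Q"
  shows "degree (\<Sum>j<Suc k. Q ^ j) = k * degree Q"
proof (induction k)
  case (Suc k)
  have "Q \<noteq> 0" using assms by auto
  then have "degree (Q ^ Suc k) = Suc k * degree Q" by (rule Polynomial.degree_power_eq)
  then have "degree (\<Sum>j<Suc k. Q ^ j) < degree (Q ^ Suc k)" using Suc assms by simp
  then have "degree ((\<Sum>j<Suc k. Q ^ j) + Q ^ Suc k) = degree (Q ^ Suc k)" by (rule degree_add_eq_right)
  then show ?case using \<open>degree (Q ^ Suc k) = _\<close> by (simp only: sum.lessThan_Suc)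
qed simp

lemma degree_pderiv_of_nat:
  fixes A :: "'a::idom poly"
  assumes "of_nat (degree A) \<noteq> (0::'a)"
  shows "degree (pderiv A) = degree A - 1"
proof (rule antisym)
  show "degree (pderiv A) \<le> degree A - 1" by (rule degree_pderiv_le)
  have d: "degree A = Suc (degree A - 1)" using assms by (cases "degree A") auto
  have "coeff (pderiv A) (degree A - 1) = of_nat (degree A) * lead_coeff A"
    unfolding coeff_pderiv d[symmetric] ..
  moreover have "lead_coeff A \<noteq> 0" using assms by auto
  ultimately show "degree A - 1 \<le> degree (pderiv A)" using assms by (intro le_degree) simp
qed

lemma poly_iter_monom: "poly_iter (monom 1 d) m = (monom 1 (d ^ m) :: 'a::comm_ring_1 poly)"
proof (induction m)
  case 0
  show ?case by (simp add: poly_iter_def monom_altdef)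
next
  case (Suc m)
  have "pcompose (monom 1 i) Q = Q ^ i" for i and Q :: "'a poly"
    by (induction i) (simp_all add: monom_0 monom_Suc pcompose_pCons)
  then show ?case by (simp add: poly_iter_Suc Suc monom_power mult.commute)
qed

lemma degree_diff_X: "2 \<le> degree u \<Longrightarrow> degree (u - [:0, 1:]) = degree u" for u :: "'a::comm_ring_1 poly"
  by (simp only: diff_conv_add_uminus, rule degree_add_eq_left, simp)

text \<open>With t = X^e the first polynomial is X (t - 1), and modulo t - 1 the second is the
  constant 1 + c + ... + c^(p-1), which is positive over the rationals. A common divisor therefore
  divides X; as the second polynomial has the value 1 at 0, it divides 1.\<close>

lemma gcd_power_map:
  fixes c e p :: nat
  assumes c: "0 < c" and e: "0 < e" and p: "0 < p"
  shows "degree (gcd (monom 1 (Suc e) - [:0, 1:]) (\<Sum>j<p. monom (of_nat c) e ^ j) :: rat poly) = 0"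
proof -
  define t :: "rat poly" where "t = monom 1 e"
  let ?c = "[:of_nat c:] :: rat poly"
  let ?F = "monom 1 (Suc e) - [:0, 1:] :: rat poly" and ?G = "\<Sum>j<p. monom (of_nat c) e ^ j :: rat poly"
  define D where "D = gcd ?F ?G"
  have F: "?F = [:0, 1:] * (t - 1)" by (simp add: t_def monom_Suc algebra_simps)
  have ct: "monom (of_nat c) e = ?c * t" by (simp add: t_def smult_monom)
  have "t - 1 dvd (?c * t) ^ j - ?c ^ j" for j
  proof -
    have "?c * t - ?c = ?c * (t - 1)" by (simp only: right_diff_distrib mult_1_right)
    then have "t - 1 dvd ?c * t - ?c" by (metis dvd_triv_right)
    moreover have "?c * t - ?c dvd (?c * t) ^ j - ?c ^ j" unfolding power_diff_sumr2 by (rule dvd_triv_left)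
    ultimately show ?thesis by (rule dvd_trans)
  qed
  then have "t - 1 dvd (\<Sum>j<p. (?c * t) ^ j - ?c ^ j)" by (rule dvd_sum)
  then have "t - 1 dvd ?G - (\<Sum>j<p. ?c ^ j)" unfolding ct by (simp only: sum_subtractf)
  then have "?F dvd [:0, 1:] * (?G - (\<Sum>j<p. ?c ^ j))" unfolding F by (intro mult_dvd_mono) simp
  then have 1: "D dvd [:0, 1:] * (?G - (\<Sum>j<p. ?c ^ j))" by (simp add: D_def dvd_trans[OF gcd_dvd1])
  have DG: "D dvd ?G" by (simp add: D_def)
  have "D dvd [:0, 1:] * ?G - [:0, 1:] * (?G - (\<Sum>j<p. ?c ^ j))"
    by (rule dvd_diff[OF dvd_mult[OF DG] 1])
  also have "\<dots> = [:0, 1:] * (\<Sum>j<p. ?c ^ j)" by (simp only: right_diff_distrib diff_diff_eq2 add_diff_cancel_left')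
  also have "(\<Sum>j<p. ?c ^ j) = [:\<Sum>j<p. of_nat c ^ j:]"
    by (induction p) (simp_all add: poly_const_pow)
  finally have DX: "D dvd [:0, 1:] * [:\<Sum>j<p. of_nat c ^ j:]" .
  have "0 < (\<Sum>j<p. of_nat c ^ j :: rat)" using c p by (intro sum_pos) auto
  moreover have "[:0, 1:] * [:\<Sum>j<p. of_nat c ^ j:] = Polynomial.smult (\<Sum>j<p. of_nat c ^ j) [:0, 1 :: rat:]" by simp
  ultimately have "D dvd [:0, 1:]" using DX dvd_smult_cancel by (metis less_irrefl)
  moreover have "[:0, 1:] dvd ?G - 1"
  proof -
    have "poly ?G 0 = 1"
      using p e by (cases p) (simp_all add: poly_sum poly_monom zero_power sum.lessThan_Suc_shift del: sum.lessThan_Suc)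
    then show ?thesis using poly_eq_0_iff_dvd[of "?G - 1" 0] by simp
  qed
  ultimately have "D dvd ?G - (?G - 1)" using DG by (meson dvd_diff dvd_trans)
  then have "D dvd 1" by simp
  then show ?thesis unfolding D_def[symmetric] by (simp add: is_unit_iff_degree)
qed

text \<open>Specialising to the power map z^d over the rationals, where a cycle has multiplier 0 or d^m.\<close>

theorem alg_indep_multiplier:
  fixes a :: "nat \<Rightarrow> 'a::field"
  assumes indep: "alg_indep_prime d a" and char_0: "\<And>n. 0 < n \<Longrightarrow> of_nat n \<noteq> (0::'a)"
    and d: "2 \<le> d" and m: "1 \<le> m" and p: "2 \<le> p"
    and z: "poly (poly_iter (\<Sum>i=1..d. monom (a i) i) m) z = z"
  shows "(\<Sum>j<p. poly (pderiv (poly_iter (\<Sum>i=1..d. monom (a i) i) m)) z ^ j) \<noteq> 0"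
proof
  assume sum: "(\<Sum>j<p. poly (pderiv (poly_iter (\<Sum>i=1..d. monom (a i) i) m)) z ^ j) = 0"
  define b :: "nat \<Rightarrow> rat" where "b i = (if i = d then 1 else 0)" for i
  have char: "of_int c = (0::rat)" if "of_int c = (0::'a)" for c
  proof (cases "c = 0")
    case False
    have "of_nat (nat \<bar>c\<bar>) = (0::'a)" using that by (cases "0 \<le> c") auto
    then show ?thesis using char_0[of "nat \<bar>c\<bar>"] False by simp
  qed simp
  have eq0: "y = 0" if "specializes d a b 0 y" for y
    using alg_indep_specializes_eq_0[OF indep _ that] char by blast
  \<comment> \<open>If \<open>a d\<close> were 0, then 0 would specialise to \<open>b d\<close> = 1.
    Hence the degree is d before and after specialisation.\<close>
  have ad: "a d \<noteq> 0" using eq0[of "b d"] specializes_var[of d d a b] d by (auto simp: b_def)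
  define h where "h = poly_iter (\<Sum>i=1..d. monom (a i) i) m"
  define h' :: "rat poly" where "h' = poly_iter (\<Sum>i=1..d. monom (b i) i) m"
  have hh': "poly_specializes d a b h h'" unfolding h_def h'_def by (rule poly_specializes_poly_iter)
  have degs: "degree h = d ^ m" "degree h' = d ^ m"
  proof -
    have "b d \<noteq> 0" "1 \<le> d" using d by (simp_all add: b_def)
    then show "degree h = d ^ m" "degree h' = d ^ m"
      unfolding h_def h'_def degree_poly_iter using ad degree_sum_monom[of a d] degree_sum_monom[of b d] by metis+
  qed
  have dm: "2 \<le> d ^ m" using d m by (metis le_trans power_increasing power_one_right le_numeral_extra(4) one_le_numeral)
  define G where "G = (\<Sum>j<p. pderiv h ^ j)"
  define G' where "G' = (\<Sum>j<p. pderiv h' ^ j)"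
  obtain k where k: "p = Suc k" using p by (cases p) auto
  \<comment> \<open>Characteristic 0 keeps the leading coefficients of the derivatives from
    vanishing, so that \<open>G\<close> and \<open>G'\<close> have the same degree.\<close>
  have dp: "degree (pderiv h) = d ^ m - 1" "degree (pderiv h') = d ^ m - 1"
  proof -
    have "of_nat (degree h) \<noteq> (0::'a)" unfolding degs by (rule char_0) (use dm in linarith)
    then show "degree (pderiv h) = d ^ m - 1" unfolding degs(1)[symmetric] by (rule degree_pderiv_of_nat)
    have "of_nat (degree h') \<noteq> (0::rat)" unfolding degs of_nat_eq_0_iff using dm by linarith
    then show "degree (pderiv h') = d ^ m - 1" unfolding degs(2)[symmetric] by (rule degree_pderiv_of_nat)
  qed
  have degG: "degree G = degree G'"
    unfolding G_def G'_def k using dp dm by (subst (1 2) degree_geometric_sum) auto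
  have degF: "degree (h - [:0, 1:]) = d ^ m" "degree (h' - [:0, 1:]) = d ^ m"
    using degree_diff_X[of h] degree_diff_X[of h'] degs dm by simp_all
  have "poly_specializes d a b (h - [:0, 1:]) (h' - [:0, 1:])"
    by (intro poly_specializes_diff hh' poly_specializes_X)
  moreover have "poly_specializes d a b G G'"
    unfolding G_def G'_def by (intro poly_specializes_sum poly_specializes_power poly_specializes_pderiv hh')
  ultimately have "specializes d a b (resultant (h - [:0, 1:]) G) (resultant (h' - [:0, 1:]) G')"
    using degG degF by (intro specializes_resultant) simp_all
  moreover have "resultant (h - [:0, 1:]) G = 0"
  proof (rule resultant_common_root)
    show "poly (h - [:0, 1:]) z = 0" using z by (simp add: h_def)
    show "poly G z = 0" using sum by (simp add: G_def h_def poly_sum)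
    show "0 < degree (h - [:0, 1:])" unfolding degF using dm by linarith
  qed
  ultimately have "resultant (h' - [:0, 1:]) G' = 0" using eq0 by simp
  then have ne: "degree (gcd (h' - [:0, 1:]) G') \<noteq> 0" by (simp add: resultant_0_gcd)
  have mono: "(\<Sum>i=1..d. monom (b i) i) = monom 1 d"
    using d by (intro poly_eqI) (simp only: coeff_sum_monom, simp add: b_def)
  have e: "Suc (d ^ m - 1) = d ^ m" using dm by linarith
  have h': "h' = monom 1 (Suc (d ^ m - 1))" unfolding h'_def mono poly_iter_monom e ..
  have pd: "pderiv h' = monom (of_nat (d ^ m)) (d ^ m - 1)"
    unfolding h' using dm by (simp add: pderiv_monom)
  have "degree (gcd (h' - [:0, 1:]) G') = 0"
    unfolding G'_def pd unfolding h' by (rule gcd_power_map) (use dm p in linarith)+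
  with ne show False by simp
qed

text \<open>Simp rules inherited from the resultant development that take linear polynomials and compositions apart.\<close>

declare pcompose_pCons [simp del] coeff_lift_hom.hom_one [simp del] coeff_lift_hom.hom_uminus [simp del]

section \<open>Ramification numbers of power series in characteristic p\<close>

text \<open>Orders are mostly expressed as divisibility by powers of \<open>fps_X\<close>:
  \<open>subdegree\<close> of the zero series is 0 and would force a case distinction.\<close>

lemma fps_X_power_dvd_iff: "fps_X ^ m dvd (\<phi> :: 'a::comm_ring_1 fps) \<longleftrightarrow> (\<forall>j<m. fps_nth \<phi> j = 0)"
proof
  assume "fps_X ^ m dvd \<phi>"
  then show "\<forall>j<m. fps_nth \<phi> j = 0"
    by (auto elim!: dvdE simp: fps_X_power_mult_nth)
next
  assume "\<forall>j<m. fps_nth \<phi> j = 0"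
  then have "\<phi> = fps_X ^ m * fps_shift m \<phi>"
    by (auto simp: fps_eq_iff fps_X_power_mult_nth)
  then show "fps_X ^ m dvd \<phi>" by (metis dvd_triv_left)
qed

lemma fps_X_power_Suc_dvd_iff: "fps_X ^ Suc m dvd (\<phi> :: 'a::comm_ring_1 fps) \<longleftrightarrow> fps_X ^ m dvd \<phi> \<and> fps_nth \<phi> m = 0"
  unfolding fps_X_power_dvd_iff by (auto simp: less_Suc_eq)

lemma fps_compose_cong_mod:
  fixes A B F :: "'a::comm_ring_1 fps"
  assumes "fps_X ^ N dvd A - B"
  shows "fps_X ^ N dvd (F oo A) - (F oo B)"
proof -
  have *: "fps_X ^ N dvd A ^ k - B ^ k" for k
    by (rule dvd_trans[OF assms]) (subst power_diff_sumr2, rule dvd_triv_left)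
  show ?thesis
    using * by (auto simp: fps_X_power_dvd_iff fps_compose_nth intro!: sum.cong)
qed

lemma fps_X_power_dvd_compose:
  fixes F A :: "'a::idom fps"
  assumes "fps_X ^ N dvd F" "fps_nth A 0 = 0"
  shows "fps_X ^ N dvd F oo A"
proof -
  obtain G where G: "F = fps_X ^ N * G" using assms(1) by (elim dvdE)
  have "fps_X dvd A" using assms(2) fps_X_power_dvd_iff[of 1 A] by simp
  then have "fps_X ^ N dvd A ^ N" by (rule dvd_power_same)
  then show ?thesis
    by (simp add: G fps_compose_mult_distrib assms fps_X_power_compose)
qed

section \<open>Iteration of power series under composition\<close>

text \<open>What is iterated is the operator sending u to u oo H, which is additive in u, so that
  binomial expansions apply to its powers. \<open>fps_iter_Suc2\<close> gives the recursion with H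
  on the outside.\<close>

definition fps_iter :: "'a::comm_ring_1 fps \<Rightarrow> nat \<Rightarrow> 'a fps" where
  "fps_iter H n = ((\<lambda>u. u oo H) ^^ n) fps_X"

lemma fps_iter_0 [simp]: "fps_iter H 0 = fps_X"
  and fps_iter_Suc: "fps_iter H (Suc n) = fps_iter H n oo H"
  by (simp_all add: fps_iter_def)

lemma fps_iter_nth_0 [simp]: "fps_nth (fps_iter H n) 0 = 0"
  by (induction n) (simp_all add: fps_iter_Suc)

lemma fps_iter_1 [simp]: "fps_nth H 0 = 0 \<Longrightarrow> fps_iter H (Suc 0) = H"
  by (simp add: fps_iter_Suc)

context
  fixes H :: "'a::idom fps"
  assumes H0: "fps_nth H 0 = 0"
begin

lemma compose_funpow: "((\<lambda>u. u oo H) ^^ n) \<phi> = \<phi> oo fps_iter H n"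
  by (induction n) (simp_all add: fps_iter_Suc fps_compose_assoc H0)

lemma fps_iter_add: "fps_iter H (m + n) = fps_iter H m oo fps_iter H n"
proof -
  have "fps_iter H (n + m) = ((\<lambda>u. u oo H) ^^ n) (fps_iter H m)"
    by (simp add: fps_iter_def funpow_add)
  then show ?thesis by (simp add: compose_funpow add.commute)
qed

lemma fps_iter_commute: "fps_iter H m oo fps_iter H n = fps_iter H n oo fps_iter H m"
  by (metis add.commute fps_iter_add)

lemma fps_iter_Suc2: "fps_iter H (Suc n) = H oo fps_iter H n"
  using fps_iter_add[of 1 n] by (simp add: H0)

lemma fps_iter_mult: "fps_iter (fps_iter H m) n = fps_iter H (m * n)"
  by (induction n) (simp_all add: fps_iter_Suc fps_iter_add[symmetric] add.commute)

lemma fps_iter_nth_1: "fps_nth (fps_iter H n) 1 = fps_nth H 1 ^ n"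
  by (induction n) (simp_all add: fps_iter_Suc fps_compose_nth H0)

end

section \<open>Powers of a difference operator in characteristic p\<close>

text \<open>By Pascal's rule, neighbouring entries of row p - 1 add up to an inner entry of row p,
  which is 0 here; so the entries alternate in sign, starting from 1.\<close>

lemma of_nat_binomial_prime_minus_1:
  assumes "prime p" "of_nat p = (0::'a::comm_ring_1)" "j < p"
  shows "of_nat ((p - 1) choose j) = ((-1) ^ j :: 'a)"
  using assms(3)
proof (induction j)
  case (Suc j)
  have p: "p = Suc (p - 1)" using Suc.prems by simp
  have "p dvd (p choose Suc j)" using Suc.prems assms(1) by (intro dvd_choose_prime) auto
  then have "of_nat (p choose Suc j) = (0::'a)"
    using assms(2) by (auto elim!: dvdE)
  moreover have "p choose Suc j = ((p - 1) choose j) + ((p - 1) choose Suc j)"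
    by (subst p) (simp only: binomial_Suc_Suc)
  ultimately have "of_nat ((p - 1) choose j) + of_nat ((p - 1) choose Suc j) = (0::'a)"
    by (metis of_nat_add)
  then show ?case using Suc by (simp add: add_eq_0_iff)
qed simp

text \<open>The binomial theorem for a power of C - 1 in the ring of additive operators.\<close>

lemma funpow_diff_binomial:
  fixes C :: "'b::comm_ring_1 \<Rightarrow> 'b"
  assumes add: "\<And>x y. C (x + y) = C x + C y"
  shows "((\<lambda>x. C x - x) ^^ m) \<phi> = (\<Sum>j\<le>m. (-1) ^ (m + j) * of_nat (m choose j) * (C ^^ j) \<phi>)"
proof -
  have C0: "C 0 = 0" using add[of 0 0] by simp
  have Csum: "C (sum f A) = (\<Sum>a\<in>A. C (f a))" for f :: "nat \<Rightarrow> 'b" and A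
    by (induction A rule: infinite_finite_induct) (simp_all add: add C0)
  have Cminus: "C (- x) = - C x" for x
    using add[of x "-x"] C0 by (simp add: eq_neg_iff_add_eq_0 add.commute)
  have Cnat: "C (of_nat n * x) = of_nat n * C x" for n x
    by (induction n) (simp_all add: C0 add algebra_simps)
  have Csgn: "C ((-1) ^ k * of_nat n * x) = (-1) ^ k * of_nat n * C x" for k n x
    by (cases "even k") (simp_all add: Cnat Cminus)
  show ?thesis
  proof (induction m)
    case (Suc m)
    let ?t = "\<lambda>j. (C ^^ j) \<phi>"
    have "((\<lambda>x. C x - x) ^^ Suc m) \<phi> =
       (\<Sum>j\<le>m. (-1) ^ (m + j) * of_nat (m choose j) * ?t (Suc j)) - (\<Sum>j\<le>m. (-1) ^ (m + j) * of_nat (m choose j) * ?t j)"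
      by (simp only: funpow.simps o_apply Suc.IH) (simp add: Csum Csgn)
    also have "(\<Sum>j\<le>m. (-1) ^ (m + j) * of_nat (m choose j) * ?t j) =
       (\<Sum>j\<le>Suc m. (-1) ^ (m + j) * of_nat (m choose j) * ?t j)"
      by (simp add: binomial_eq_0)
    also have "\<dots> = (-1) ^ m * ?t 0 + (\<Sum>j\<le>m. (-1) ^ (m + Suc j) * of_nat (m choose Suc j) * ?t (Suc j))"
      by (simp only: sum.atMost_Suc_shift) simp
    also have "(\<Sum>j\<le>m. (-1) ^ (m + j) * of_nat (m choose j) * ?t (Suc j)) - \<dots> =
        - ((-1) ^ m * ?t 0) + (\<Sum>j\<le>m. (-1) ^ (m + j) * of_nat (Suc m choose Suc j) * ?t (Suc j))"
      by (simp add: sum_subtractf[symmetric] sum.distrib[symmetric] algebra_simps sum_negf[symmetric] binomial_eq_0)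
    also have "\<dots> = (\<Sum>j\<le>Suc m. (-1) ^ (Suc m + j) * of_nat (Suc m choose j) * ?t j)"
      by (simp only: sum.atMost_Suc_shift) simp
    finally show ?case .
  qed simp
qed

text \<open>In characteristic p, (T - 1)^(p-1) = (T^p - 1) / (T - 1) = 1 + T + ... + T^(p-1) for an
  indeterminate T; the operator C takes the place of T.\<close>

lemma funpow_diff_prime_minus_1:
  fixes C :: "'b::comm_ring_1 \<Rightarrow> 'b"
  assumes add: "\<And>x y. C (x + y) = C x + C y" and p: "prime p" "of_nat p = (0::'b)"
  shows "((\<lambda>x. C x - x) ^^ (p - 1)) \<phi> = (\<Sum>j<p. (C ^^ j) \<phi>)"
proof -
  have gt: "p > 0" using p(1) prime_gt_0_nat by blast
  have eq: "{..p - 1} = {..<p}" using gt by auto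
  have ev: "(-1 :: 'b) ^ (p - 1) = 1"
    using of_nat_binomial_prime_minus_1[OF p, of "p - 1"] gt by simp
  have one: "(-1 :: 'b) ^ (p - 1 + j) * of_nat ((p - 1) choose j) = 1" if "j < p" for j
    using of_nat_binomial_prime_minus_1[OF p that] ev by (simp add: power_add flip: power_mult_distrib)
  show ?thesis
    unfolding funpow_diff_binomial[where C = C, OF add] eq
    by (intro sum.cong refl) (simp only: one lessThan_iff mult_1)
qed

section \<open>The two lowest coefficients of a composition difference\<close>

context
  fixes H E y :: "'k::idom fps" and i :: nat
  assumes H: "H = fps_X * E" and E: "E = 1 + y * E" and y: "fps_X ^ i dvd y" and i: "1 \<le> i"
begin

text \<open>The equation for E says E = 1 / (1 - y), so this is the binomial series of (1 - y)^(-m).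
  A remainder in y^3 is harmless: its order is at least 3 i, beyond the two degrees i and i + 1 of
  interest.\<close>

lemma power_expansion:
  "\<exists>R. E ^ m = 1 + of_nat m * y + of_nat (Suc m choose 2) * y\<^sup>2 + y ^ 3 * R"
proof (induction m)
  case 0
  show ?case by (intro exI[of _ 0]) (simp add: numeral_2_eq_2)
next
  case (Suc m)
  then obtain R where R: "E ^ m = 1 + of_nat m * y + of_nat (Suc m choose 2) * y\<^sup>2 + y ^ 3 * R" by blast
  define c :: "'k fps" where "c = of_nat (Suc m choose 2)"
  have c': "of_nat (Suc (Suc m) choose 2) = 1 + of_nat m + c"
    by (simp add: c_def numeral_2_eq_2)
  have E3: "E = 1 + y + y\<^sup>2 + y ^ 3 * E"
  proof -
    have "1 + y + y\<^sup>2 + y ^ 3 * E = 1 + y * (1 + y * (1 + y * E))"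
      by (simp add: algebra_simps power2_eq_square power3_eq_cube)
    then show ?thesis using E by simp
  qed
  have "E ^ Suc m = (1 + of_nat m * y + c * y\<^sup>2) * E + y ^ 3 * R * E"
    by (simp add: R c_def algebra_simps)
  also have "\<dots> = (1 + of_nat m * y + c * y\<^sup>2) * (1 + y + y\<^sup>2 + y ^ 3 * E) + y ^ 3 * R * E"
    using E3 by simp
  also have "\<dots> = 1 + of_nat (Suc m) * y + (1 + of_nat m + c) * y\<^sup>2
      + y ^ 3 * (R * E + of_nat m + c + c * y + E * (1 + of_nat m * y + c * y\<^sup>2))"
    by (simp add: algebra_simps power2_eq_square power3_eq_cube)
  finally show ?case unfolding c' by blast
qed

text \<open>For \<phi> = X^m \<psi> the difference is X^m times (E^m - 1) (\<psi> oo H) + ((\<psi>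
  oo H) - \<psi>). The first summand supplies the factor m; the second adds y_i times the linear
  coefficient of \<psi>, which turns m into m + 1 one degree higher. The y^2 term of E^m starts in
  degree 2 i, which equals i + 1 when i = 1; the vanishing binomial coefficient removes it.\<close>

lemma compose_diff_leading:
  assumes "fps_X ^ m dvd \<phi>"
  shows "fps_X ^ (m + i) dvd (\<phi> oo H) - \<phi>"
    and "fps_nth ((\<phi> oo H) - \<phi>) (m + i) = of_nat m * fps_nth y i * fps_nth \<phi> m"
    and "of_nat (Suc m choose 2) = (0::'k) \<Longrightarrow>
       fps_nth ((\<phi> oo H) - \<phi>) (m + i + 1) =
         of_nat m * fps_nth y (i + 1) * fps_nth \<phi> m + of_nat (Suc m) * fps_nth y i * fps_nth \<phi> (m + 1)"
proof -
  obtain \<psi> where \<psi>: "\<phi> = fps_X ^ m * \<psi>" using assms by (elim dvdE)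
  obtain y' where y': "y = fps_X ^ i * y'" using y by (elim dvdE)
  obtain R where R: "E ^ m = 1 + of_nat m * y + of_nat (Suc m choose 2) * y\<^sup>2 + y ^ 3 * R"
    using power_expansion by blast
  define c :: "'k fps" where "c = of_nat (Suc m choose 2)"
  have H0 [simp]: "fps_nth H 0 = 0" by (simp add: H)
  have y0: "fps_nth y 0 = 0" using i by (simp add: y' fps_X_power_mult_nth)
  have E0 [simp]: "fps_nth E 0 = 1" by (subst E) (simp add: y0)
  have H1 [simp]: "fps_nth H (Suc 0) = 1" by (simp add: H)
  have HX: "H - fps_X = fps_X ^ (i + 1) * (y' * E)"
  proof -
    have "H - fps_X = fps_X * (E - 1)" by (simp add: H algebra_simps)
    also have "E - 1 = y * E" using E by (metis add_diff_cancel_left')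
    finally show ?thesis by (simp add: y' algebra_simps)
  qed
  \<comment> \<open>Two coefficients of \<psi> are split off; beyond the factor X^i, the tail
    contributes to (\<psi> oo H) - \<psi> only from X^2 on.\<close>
  define \<rho> where "\<rho> = fps_shift 2 \<psi>"
  define c0 c1 where "c0 = fps_nth \<psi> 0" and "c1 = fps_nth \<psi> 1"
  have \<rho>: "\<psi> = fps_const c0 + fps_const c1 * fps_X + fps_X\<^sup>2 * \<rho>"
    by (auto simp: fps_eq_iff \<rho>_def c0_def c1_def fps_X_power_mult_nth less_2_cases_iff
          intro!: arg_cong[of _ _ "fps_nth \<psi>"])
  have "fps_X ^ (i + 1) dvd (\<rho> oo H) - (\<rho> oo fps_X)"
    by (rule fps_compose_cong_mod) (simp add: HX)
  then obtain A where A: "\<rho> oo H = \<rho> + fps_X ^ (i + 1) * A"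
    by (auto elim!: dvdE simp: algebra_simps)
  have psiH: "(\<psi> oo H) = \<psi> + fps_const c1 * (H - fps_X) + (H\<^sup>2 - fps_X\<^sup>2) * \<rho> + H\<^sup>2 * (fps_X ^ (i + 1) * A)"
  proof -
    have "\<psi> oo H = fps_const c0 + fps_const c1 * H + H\<^sup>2 * (\<rho> oo H)"
      by (subst \<rho>) (simp add: fps_compose_add_distrib fps_compose_mult_distrib fps_X_power_compose)
    then show ?thesis by (subst (2) \<rho>) (simp add: A algebra_simps)
  qed
  have sq: "H\<^sup>2 - fps_X\<^sup>2 = fps_X ^ i * (fps_X\<^sup>2 * (y' * E * (E + 1)))"
  proof -
    have "H\<^sup>2 - fps_X\<^sup>2 = (H - fps_X) * (H + fps_X)" by (simp add: algebra_simps power2_eq_square)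
    also have "\<dots> = fps_X ^ (i + 1) * (y' * E) * (fps_X * E + fps_X)" by (simp only: HX) (simp only: H)
    finally show ?thesis by (simp add: algebra_simps power2_eq_square)
  qed
  have cub: "H\<^sup>2 * (fps_X ^ (i + 1) * A) = fps_X ^ i * (fps_X\<^sup>2 * (fps_X * E\<^sup>2 * A))"
    by (simp add: H algebra_simps power2_eq_square)
  define B where "B = y' * E * (E + 1) * \<rho> + fps_X * E\<^sup>2 * A"
  have B: "(\<psi> oo H) - \<psi> = fps_X ^ i * (fps_const c1 * (fps_X * (y' * E)) + fps_X\<^sup>2 * B)"
  proof -
    have "(\<psi> oo H) - \<psi> = fps_const c1 * (H - fps_X) + (H\<^sup>2 - fps_X\<^sup>2) * \<rho> + H\<^sup>2 * (fps_X ^ (i + 1) * A)"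
      by (simp add: psiH)
    then show ?thesis unfolding sq cub HX by (simp add: B_def algebra_simps)
  qed
  define \<chi> where "\<chi> = (of_nat m * y' + c * (fps_X ^ i * y'\<^sup>2) + fps_X ^ i * (fps_X ^ i * (y' ^ 3 * R))) * (\<psi> oo H)
      + (fps_const c1 * (fps_X * (y' * E)) + fps_X\<^sup>2 * B)"
  have "(\<phi> oo H) - \<phi> = fps_X ^ m * ((E ^ m - 1) * (\<psi> oo H) + ((\<psi> oo H) - \<psi>))"
    by (simp add: \<psi> fps_compose_mult_distrib fps_X_power_compose H power_mult_distrib algebra_simps)
  also have "\<dots> = fps_X ^ m * (fps_X ^ i * \<chi>)"
    unfolding B R by (simp add: \<chi>_def y' c_def power_mult_distrib algebra_simps power2_eq_square power3_eq_cube)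
  finally have main: "(\<phi> oo H) - \<phi> = fps_X ^ (m + i) * \<chi>" by (simp add: power_add algebra_simps)
  then show "fps_X ^ (m + i) dvd (\<phi> oo H) - \<phi>" by simp
  have y'0: "fps_nth y' 0 = fps_nth y i" and y'1: "fps_nth y' (Suc 0) = fps_nth y (Suc i)"
    by (simp_all add: y' fps_X_power_mult_nth)
  have \<psi>0: "fps_nth \<psi> 0 = fps_nth \<phi> m" and \<psi>1: "fps_nth \<psi> (Suc 0) = fps_nth \<phi> (Suc m)"
    by (simp_all add: \<psi> fps_X_power_mult_nth)
  have Xi: "fps_nth (fps_X ^ i * u) 0 = 0" and X2i: "fps_nth (fps_X ^ i * (fps_X ^ i * u)) 0 = 0"
    "fps_nth (fps_X ^ i * (fps_X ^ i * u)) (Suc 0) = 0" for u :: "'k fps"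
    using i by (simp_all add: fps_X_power_mult_nth)
  have nth_of_nat: "fps_nth (of_nat k :: 'k fps) 0 = of_nat k" "fps_nth (of_nat k :: 'k fps) (Suc 0) = 0" for k
    by (simp_all add: fps_nth_of_nat)
  have psiH1: "fps_nth (\<psi> oo H) (Suc 0) = fps_nth \<psi> (Suc 0)"
    by (simp add: fps_compose_nth)
  have X2: "fps_nth (fps_X\<^sup>2 * u) 0 = 0" "fps_nth (fps_X\<^sup>2 * u) (Suc 0) = 0" for u :: "'k fps"
    by (simp_all add: fps_X_power_mult_nth)
  show "fps_nth ((\<phi> oo H) - \<phi>) (m + i) = of_nat m * fps_nth y i * fps_nth \<phi> m"
    unfolding main fps_X_power_mult_nth
    using i by (simp add: \<chi>_def Xi X2i X2 nth_of_nat \<psi>0 y'0)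
  assume "of_nat (Suc m choose 2) = (0::'k)"
  then have "c = 0" unfolding c_def by (simp add: fps_eq_iff fps_nth_of_nat)
  then show "fps_nth ((\<phi> oo H) - \<phi>) (m + i + 1) =
         of_nat m * fps_nth y (i + 1) * fps_nth \<phi> m + of_nat (Suc m) * fps_nth y i * fps_nth \<phi> (m + 1)"
    unfolding main fps_X_power_mult_nth
    using i by (simp add: \<chi>_def Xi X2i X2 nth_of_nat \<psi>0 \<psi>1 y'0 y'1 c1_def psiH1 algebra_simps)
qed

end

text \<open>The series w below is 1/X - 1/H. With H(j) the j-th iterate of H, the sum of the w oo H(j) over j < p
  telescopes to 1/X - 1/H(p), and in characteristic p it equals the (p-1)-st power of the operator
  mapping \<phi> to (\<phi> oo H) - \<phi>, applied to w.\<close>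

lemma recip_diff_factor:
  fixes H w :: "'k::idom fps"
  assumes "w * (fps_X * H) = H - fps_X"
  shows "H = fps_X * (1 + w * H)" and "1 + w * H = 1 + (fps_X * w) * (1 + w * H)"
proof -
  show *: "H = fps_X * (1 + w * H)" using assms by (simp add: algebra_simps)
  show "1 + w * H = 1 + (fps_X * w) * (1 + w * H)"
    by (subst (1) *) (simp add: algebra_simps)
qed

lemma recip_diff_nth_1:
  fixes H w :: "'k::idom fps"
  assumes "w * (fps_X * H) = H - fps_X"
  shows "fps_nth H 0 = 0" and "fps_nth H (Suc 0) = 1"
  by (subst recip_diff_factor[OF assms], simp)+

lemma recip_diff_sum:
  fixes H w :: "'k::idom fps"
  assumes w: "w * (fps_X * H) = H - fps_X"
  shows "(\<Sum>j<m. w oo fps_iter H j) * (fps_X * fps_iter H m) = fps_iter H m - fps_X"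
proof (induction m)
  case (Suc m)
  note H0 = recip_diff_nth_1(1)[OF w] and H1 = recip_diff_nth_1(2)[OF w]
  let ?K = "fps_iter H m" and ?K' = "fps_iter H (Suc m)"
  have nz: "?K \<noteq> 0"
    using fps_iter_nth_1[OF H0, of m] H1 by auto
  \<comment> \<open>With denominators cleared, this is w oo K = 1/K - 1/K', the telescoping
    step.\<close>
  have "(w oo ?K) * (?K * ?K') = (w * (fps_X * H)) oo ?K"
    by (simp add: fps_compose_mult_distrib fps_iter_Suc2[OF H0])
  also have "\<dots> = ?K' - ?K"
    by (simp add: w fps_compose_sub_distrib fps_iter_Suc2[OF H0])
  finally have step: "(w oo ?K) * (?K * ?K') = ?K' - ?K" .
  have "((\<Sum>j<Suc m. w oo fps_iter H j) * (fps_X * ?K')) * ?K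
      = ((\<Sum>j<m. w oo fps_iter H j) * (fps_X * ?K)) * ?K' + fps_X * ((w oo ?K) * (?K * ?K'))"
    by (simp add: algebra_simps)
  also have "\<dots> = (?K' - fps_X) * ?K"
    unfolding Suc.IH step by (simp add: algebra_simps)
  finally show ?case using nz by (metis mult_right_cancel)
qed simp

text \<open>H - X has order at least i + 1 and X H has order 2, so 1/X - 1/H is a power series of
  order at least i - 1.\<close>

lemma recip_diff_exists:
  fixes H :: "'k::field fps"
  assumes "1 \<le> i" "fps_X ^ (i + 1) dvd H - fps_X"
  obtains w where "w * (fps_X * H) = H - fps_X" "fps_X ^ (i - 1) dvd w"
proof -
  obtain V where V: "H - fps_X = fps_X ^ (i + 1) * V" using assms(2) by (elim dvdE)
  define E where "E = 1 + fps_X ^ i * V"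
  have H: "H = fps_X * E" using V by (simp add: E_def algebra_simps)
  have "fps_nth E 0 = 1" using assms(1) by (simp add: E_def fps_X_power_mult_nth)
  then have inv: "inverse E * E = 1" by (intro inverse_mult_eq_1) simp
  have "(fps_X ^ (i - 1) * V * inverse E) * (fps_X * H) = fps_X ^ (i - 1) * V * fps_X\<^sup>2 * (inverse E * E)"
    by (simp add: H power2_eq_square algebra_simps)
  also have "\<dots> = fps_X ^ (i - 1 + 2) * V"
    by (simp only: inv power_add mult_1_right) (simp add: algebra_simps)
  also have "\<dots> = H - fps_X" using assms(1) by (simp add: V)
  finally show ?thesis by (rule that) simp
qed

text \<open>H - X = w X H = w X^2 (1 + w H), where the last factor has constant term 1: the orders
  differ by 2 and the leading coefficients agree.\<close>

lemma recip_diff_leading: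
  fixes H w :: "'k::idom fps"
  assumes w: "w * (fps_X * H) = H - fps_X" and s: "fps_X ^ s dvd w"
  shows "fps_X ^ (s + 2) dvd H - fps_X" "fps_nth (H - fps_X) (s + 2) = fps_nth w s"
proof -
  obtain v where v: "w = fps_X ^ s * v" using s by (elim dvdE)
  have "H - fps_X = fps_X ^ (s + 2) * (v * (1 + w * H))"
    unfolding w[symmetric] by (subst recip_diff_factor(1)[OF w]) (simp add: v power_add power2_eq_square algebra_simps)
  then show "fps_X ^ (s + 2) dvd H - fps_X" "fps_nth (H - fps_X) (s + 2) = fps_nth w s"
    using recip_diff_nth_1(1)[OF w] by (simp_all only: dvd_triv_left fps_X_power_mult_nth) (simp add: v fps_X_power_mult_nth)
qed

lemma not_dvd_of_nat:
  assumes p: "prime p" "\<not> p dvd n" "of_nat p = (0::'k::comm_ring_1)"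
  shows "of_nat n \<noteq> (0::'k)"
proof
  assume n: "of_nat n = (0::'k)"
  have "coprime n p" using p(1,2) by (metis coprime_commute prime_imp_coprime)
  then obtain x y where xy: "n * x = p * y + 1"
    using p(1) coprime_bezout_strong[of n p] by (metis not_prime_1)
  have "(0::'k) = of_nat (n * x)" using n by simp
  also have "\<dots> = 1" unfolding xy using p(3) by simp
  finally show False by simp
qed

section \<open>From a series to its p-th iterate\<close>

context
  fixes p :: nat and H w :: "'k::idom fps"
  assumes p: "prime p" "odd p" "of_nat p = (0::'k)"
    and w: "w * (fps_X * H) = H - fps_X"
begin

private abbreviation "T \<equiv> \<lambda>\<phi>. (\<phi> oo H) - \<phi>"

private lemma dvd_of_nat: "p dvd n \<Longrightarrow> of_nat n = (0::'k)"
  using p(3) by (auto elim!: dvdE)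

private lemma choose_2_zero: "p dvd m \<Longrightarrow> of_nat (Suc m choose 2) = (0::'k)" "p dvd Suc m \<Longrightarrow> of_nat (Suc m choose 2) = (0::'k)"
proof -
  have *: "p dvd (Suc m choose 2)" if "p dvd Suc m * m"
  proof -
    have "2 * (Suc m choose 2) = Suc m * m" by (simp add: choose_two)
    then have "p dvd 2 * (Suc m choose 2)" using that by simp
    moreover have "\<not> p dvd 2" using p by (metis dvd_refl primes_dvd_imp_eq two_is_prime_nat)
    ultimately show ?thesis using p(1) prime_dvd_mult_iff by blast
  qed
  show "p dvd m \<Longrightarrow> of_nat (Suc m choose 2) = (0::'k)" "p dvd Suc m \<Longrightarrow> of_nat (Suc m choose 2) = (0::'k)"
    by (rule dvd_of_nat, rule *, erule dvd_mult, rule dvd_of_nat, rule *, erule dvd_mult2)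
qed

private lemma sum_eq_funpow: "(\<Sum>j<p. w oo fps_iter H j) = (T ^^ (p - 1)) w"
proof -
  have "of_nat p = (0 :: 'k fps)" using p(3) by (simp add: fps_eq_iff fps_nth_of_nat)
  from funpow_diff_prime_minus_1[of "\<lambda>\<phi>. \<phi> oo H", OF fps_compose_add_distrib p(1) this, of w]
  show ?thesis by (simp add: compose_funpow[OF recip_diff_nth_1(1)[OF w]])
qed

text \<open>Each of the p - 1 applications of the operator raises the order by at least s + 1. With
  i = s + 1, the order of 1/X - 1/H(p) is at least p i - 1, which is the inequality between
  consecutive ramification numbers.\<close>

lemma recip_diff_sum_dvd:
  assumes "fps_X ^ s dvd w"
  shows "fps_X ^ (s + (p - 1) * (s + 1)) dvd (\<Sum>j<p. w oo fps_iter H j)"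
proof -
  have "fps_X ^ (s + n * (s + 1)) dvd (T ^^ n) w" for n
  proof (induction n)
    case (Suc n)
    have "fps_X ^ (s + n * (s + 1) + (s + 1)) dvd T ((T ^^ n) w)"
      using assms by (intro compose_diff_leading(1)[OF recip_diff_factor[OF w]] Suc) (auto intro: mult_dvd_mono)
    then show ?case by (simp add: algebra_simps)
  qed (use assms in simp)
  then show ?thesis unfolding sum_eq_funpow .
qed

text \<open>Let a and r be the coefficients of w in degrees s and s + 1. As p divides s, the first
  application of the operator kills the leading term, and a r takes its place one degree higher.
  Every further application multiplies the leading coefficient by its degree times a, which ends
  with (p - 1)! a^(p-1) r in degree p (s + 1). For the next coefficient only the last application
  matters: it starts from degree (p - 1) (s + 1), which is -1 modulo p, so the term with the unknown
  coefficient drops out.\<close>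

lemma recip_diff_sum_leading:
  assumes s: "fps_X ^ s dvd w" and ps: "p dvd s"
  defines "W \<equiv> \<Sum>j<p. w oo fps_iter H j"
  shows "fps_X ^ (p * (s + 1)) dvd W"
    and "fps_nth w (s + 1) = 0 \<Longrightarrow> fps_nth W (p * (s + 1)) = 0"
    and "fps_nth w s \<noteq> 0 \<Longrightarrow> fps_nth w (s + 1) \<noteq> 0 \<Longrightarrow>
           fps_nth W (p * (s + 1)) \<noteq> 0 \<and> fps_nth W (p * (s + 1) + 1) \<noteq> 0"
proof -
  have p3: "p \<ge> 3" using p(1,2) prime_ge_2_nat[of p] by (cases "p = 2") auto
  define a r where "a = fps_nth w s" and "r = fps_nth w (s + 1)"
  define y where "y = fps_X * w"
  have y1: "fps_nth y (s + 1) = a" "fps_nth y (s + 1 + 1) = r" by (simp_all add: y_def a_def r_def)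
  have yd: "fps_X ^ (s + 1) dvd y" using s by (simp add: y_def mult_dvd_mono)
  note lead = compose_diff_leading[OF recip_diff_factor[OF w, folded y_def] yd, simplified y1]
  have os: "of_nat s = (0::'k)" using ps by (rule dvd_of_nat)
  define \<phi> where "\<phi> n = (T ^^ n) w" for n
  have \<phi>_Suc: "\<phi> (Suc n) = T (\<phi> n)" for n by (simp add: \<phi>_def)
  have base: "fps_X ^ (2 * (s + 1)) dvd \<phi> 1" "fps_nth (\<phi> 1) (2 * (s + 1)) = a * r"
  proof -
    have "fps_X ^ (s + (s + 1)) dvd \<phi> 1" "fps_nth (\<phi> 1) (s + (s + 1)) = 0"
      using lead(1)[OF _ s] lead(2)[OF _ s] os by (simp_all add: \<phi>_def)
    then have "fps_X ^ Suc (s + (s + 1)) dvd \<phi> 1" by (simp only: fps_X_power_Suc_dvd_iff)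
    moreover have "Suc (s + (s + 1)) = 2 * (s + 1)" by simp
    ultimately show "fps_X ^ (2 * (s + 1)) dvd \<phi> 1" by (simp only:)
    show "fps_nth (\<phi> 1) (2 * (s + 1)) = a * r"
      using lead(3)[OF _ s choose_2_zero(1)[OF ps]] os by (simp add: \<phi>_def r_def mult_2)
  qed
  have step: "fps_X ^ ((n + 2) * (s + 1)) dvd \<phi> (Suc n) \<and>
      fps_nth (\<phi> (Suc n)) ((n + 2) * (s + 1)) = of_nat (fact (n + 1)) * a ^ (n + 1) * r" for n
  proof (induction n)
    case 0
    show ?case using base by (simp only: add_0 One_nat_def fact_Suc_0) simp
  next
    case (Suc n)
    then have d: "fps_X ^ ((n + 2) * (s + 1)) dvd \<phi> (Suc n)" by blast
    have eq: "(Suc n + 2) * (s + 1) = (n + 2) * (s + 1) + (s + 1)" by (simp add: algebra_simps)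
    have "fps_nth (\<phi> (Suc (Suc n))) ((n + 2) * (s + 1) + (s + 1))
        = of_nat ((n + 2) * (s + 1)) * a * fps_nth (\<phi> (Suc n)) ((n + 2) * (s + 1))"
      unfolding \<phi>_Suc[of "Suc n"] by (rule lead(2)[OF _ d]) simp
    also have "of_nat ((n + 2) * (s + 1)) = (of_nat (n + 2) :: 'k)" using os by simp
    finally have "fps_nth (\<phi> (Suc (Suc n))) ((n + 2) * (s + 1) + (s + 1))
        = of_nat (fact (Suc n + 1)) * a ^ (Suc n + 1) * r" using Suc by (simp add: algebra_simps)
    moreover have "fps_X ^ ((n + 2) * (s + 1) + (s + 1)) dvd \<phi> (Suc (Suc n))"
      unfolding \<phi>_Suc[of "Suc n"] by (rule lead(1)[OF _ d]) simp
    ultimately show ?case unfolding eq by simp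
  qed
  \<comment> \<open>The p - 1 = n + 2 applications are the first one, n ordinary ones, and the last
    one, which is examined separately.\<close>
  define n where "n = p - 3"
  have n: "p = n + 3" using p3 by (simp add: n_def)
  have W: "W = \<phi> (Suc (Suc n))" unfolding W_def sum_eq_funpow \<phi>_def by (simp add: n)
  have e1: "(Suc n + 2) * (s + 1) = p * (s + 1)" by (simp add: n algebra_simps)
  have e2: "p * (s + 1) = (n + 2) * (s + 1) + (s + 1)" by (simp add: n algebra_simps)
  note last = step[of "Suc n", unfolded e1, folded W]
  show "fps_X ^ (p * (s + 1)) dvd W" using last by blast
  show "fps_nth W (p * (s + 1)) = 0" if "fps_nth w (s + 1) = 0"
    using last that by (simp add: r_def)
  show "fps_nth W (p * (s + 1)) \<noteq> 0 \<and> fps_nth W (p * (s + 1) + 1) \<noteq> 0"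
    if "fps_nth w s \<noteq> 0" "fps_nth w (s + 1) \<noteq> 0"
  proof
    have ar: "a \<noteq> 0" "r \<noteq> 0" using that by (simp_all add: a_def r_def)
    have f: "of_nat (fact k) \<noteq> (0::'k)" if "k < p" for k
      using that p(1) by (intro not_dvd_of_nat[OF p(1) _ p(3)]) (simp add: prime_dvd_fact_iff)
    show "fps_nth W (p * (s + 1)) \<noteq> 0"
      using last f[of "Suc n + 1"] ar by (simp add: n)
    have d: "fps_X ^ ((n + 2) * (s + 1)) dvd \<phi> (Suc n)" using step[of n] by blast
    have "p dvd Suc ((n + 2) * (s + 1))"
    proof -
      have "Suc ((n + 2) * (s + 1)) + s = p * (s + 1)" by (simp add: n algebra_simps)
      then show ?thesis using ps by (metis dvd_add_left_iff dvd_triv_left)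
    qed
    note ch = choose_2_zero(2)[OF this] dvd_of_nat[OF this]
    have "fps_nth W (p * (s + 1) + 1) = of_nat ((n + 2) * (s + 1)) * r * fps_nth (\<phi> (Suc n)) ((n + 2) * (s + 1))"
      unfolding e2 W \<phi>_Suc[of "Suc n"] using lead(3)[OF _ d ch(1)] ch(2) by simp
    moreover have "of_nat ((n + 2) * (s + 1)) \<noteq> (0::'k)" using ch(2)
      by (metis add.right_neutral of_nat_Suc zero_neq_one)
    ultimately show "fps_nth W (p * (s + 1) + 1) \<noteq> 0"
      using step[of n] f[of "n + 1"] ar by (simp add: n)
  qed
qed

end

section \<open>Ramification numbers of series tangent to the identity\<close>

context
  fixes p :: nat
  assumes p: "prime p" "odd p" "of_nat p = (0::'k::field)"
begin

private lemma p3: "3 \<le> p"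
  using p(1,2) prime_ge_2_nat[of p] by (cases "p = 2") auto

lemma fps_iter_prime_power_dvd:
  fixes H :: "'k fps"
  assumes i: "1 \<le> i" and H: "fps_X ^ (i + 1) dvd H - fps_X"
  shows "fps_X ^ (p ^ k * i + 1) dvd fps_iter H (p ^ k) - fps_X"
proof (induction k)
  case 0
  have "fps_nth (H - fps_X) 0 = 0" using H unfolding fps_X_power_dvd_iff by simp
  then show ?case using H by simp
next
  case (Suc k)
  have H0: "fps_nth H 0 = 0" using H unfolding fps_X_power_dvd_iff by auto
  let ?G = "fps_iter H (p ^ k)" and ?i = "p ^ k * i"
  have i': "1 \<le> ?i" using i p3 by simp
  obtain w where w: "w * (fps_X * ?G) = ?G - fps_X" "fps_X ^ (?i - 1) dvd w"
    using recip_diff_exists[OF i' Suc] by blast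
  let ?W = "\<Sum>j<p. w oo fps_iter ?G j"
  have W: "?W * (fps_X * fps_iter ?G p) = fps_iter ?G p - fps_X" by (rule recip_diff_sum[OF w(1)])
  have "fps_X ^ (?i - 1 + (p - 1) * (?i - 1 + 1)) dvd ?W"
    by (rule recip_diff_sum_dvd[OF p w])
  from recip_diff_leading(1)[OF W this]
  have "fps_X ^ (?i - 1 + (p - 1) * (?i - 1 + 1) + 2) dvd fps_iter ?G p - fps_X" .
  moreover have "?i - 1 + (p - 1) * (?i - 1 + 1) + 2 = p ^ Suc k * i + 1"
  proof -
    obtain a b where "?i = Suc a" "p = Suc b" using i' p3
      by (metis Suc_le_D not_numeral_le_zero One_nat_def numeral_3_eq_3)
    moreover from this have "p ^ Suc k * i = Suc b * Suc a" by (metis mult.assoc power_Suc)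
    ultimately show ?thesis by simp
  qed
  ultimately show ?case by (simp only: fps_iter_mult[OF H0] power_Suc2)
qed

text \<open>The invariant is that 1/X - 1/H(p^n) has order \<open>s n\<close> = p + ... + p^n, a
  multiple of p, and that its two lowest coefficients are nonzero. At n = 0 the second of them is
  nonzero by \<open>i1\<close>: if it vanished, so would the coefficient of X^p in 1/X -
  1/H(p).\<close>

lemma fps_iter_prime_power_leading:
  fixes H :: "'k fps"
  assumes H: "fps_X\<^sup>2 dvd H - fps_X"
    and i0: "fps_nth (H - fps_X) 2 \<noteq> 0"
    and i1: "fps_nth (fps_iter H p - fps_X) (p + 2) \<noteq> 0"
  shows "fps_X ^ Suc (\<Sum>j\<le>n. p ^ j) dvd fps_iter H (p ^ n) - fps_X"
    and "fps_nth (fps_iter H (p ^ n) - fps_X) (Suc (\<Sum>j\<le>n. p ^ j)) \<noteq> 0"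
proof -
  have H0: "fps_nth H 0 = 0" using H unfolding fps_X_power_dvd_iff by auto
  define s where "s n = (\<Sum>j=1..n. p ^ j)" for n
  have s_Suc: "s (Suc n) = p * (s n + 1)" for n
  proof -
    have "s n + 1 = (\<Sum>j\<le>n. p ^ j)" for n
      by (simp add: s_def atMost_atLeast0 sum.atLeast_Suc_atMost)
    moreover have "s (Suc n) = p * (\<Sum>j\<le>n. p ^ j)"
      unfolding s_def sum_distrib_left atMost_atLeast0 One_nat_def
      by (subst sum.shift_bounds_cl_Suc_ivl) simp
    ultimately show ?thesis by simp
  qed
  have e: "(\<Sum>j\<le>n. p ^ j) = s n + 1" for n
    by (simp add: s_def atMost_atLeast0 sum.atLeast_Suc_atMost)
  have ps: "p dvd s n" for n by (cases n) (simp_all add: s_Suc, simp add: s_def)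
  have "\<exists>w. w * (fps_X * fps_iter H (p ^ n)) = fps_iter H (p ^ n) - fps_X \<and> fps_X ^ s n dvd w
      \<and> fps_nth w (s n) \<noteq> 0 \<and> fps_nth w (s n + 1) \<noteq> 0" for n
  proof (induction n)
    case 0
    obtain w where w: "w * (fps_X * H) = H - fps_X"
      using recip_diff_exists[of 1 H] H by (auto simp: numeral_2_eq_2)
    have w0: "fps_nth w 0 \<noteq> 0"
      using recip_diff_leading(2)[OF w, of 0] i0 by (simp add: numeral_2_eq_2)
    have "fps_nth w 1 \<noteq> 0"
    proof
      assume "fps_nth w 1 = 0"
      then have "fps_nth (\<Sum>j<p. w oo fps_iter H j) p = 0" "fps_X ^ p dvd (\<Sum>j<p. w oo fps_iter H j)"
        using recip_diff_sum_leading(1,2)[OF p w, of 0] by simp_all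
      then show False
        using i1 recip_diff_leading(2)[OF recip_diff_sum[OF w], of p p] by simp
    qed
    then show ?case using w w0 H0 by (intro exI[of _ w]) (simp add: s_def)
  next
    case (Suc n)
    let ?G = "fps_iter H (p ^ n)"
    obtain w where w: "w * (fps_X * ?G) = ?G - fps_X" "fps_X ^ s n dvd w"
      and nz: "fps_nth w (s n) \<noteq> 0" "fps_nth w (s n + 1) \<noteq> 0"
      using Suc by blast
    let ?W = "\<Sum>j<p. w oo fps_iter ?G j"
    have "?W * (fps_X * fps_iter ?G p) = fps_iter ?G p - fps_X" by (rule recip_diff_sum[OF w(1)])
    moreover have "fps_iter ?G p = fps_iter H (p ^ Suc n)"
      by (simp only: fps_iter_mult[OF H0] power_Suc2)
    ultimately show ?case
      using recip_diff_sum_leading(1,3)[OF p w ps] nz unfolding s_Suc by metis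
  qed
  then obtain w where w: "w * (fps_X * fps_iter H (p ^ n)) = fps_iter H (p ^ n) - fps_X" "fps_X ^ s n dvd w"
      and nz: "fps_nth w (s n) \<noteq> 0" by blast
  show "fps_X ^ Suc (\<Sum>j\<le>n. p ^ j) dvd fps_iter H (p ^ n) - fps_X"
    using recip_diff_leading(1)[OF w] by (simp add: e)
  show "fps_nth (fps_iter H (p ^ n) - fps_X) (Suc (\<Sum>j\<le>n. p ^ j)) \<noteq> 0"
    using recip_diff_leading(2)[OF w] nz by (simp add: e)
qed

text \<open>Here a = i_m, and a + p^(m+1) bounds i_(m+1) from above, so p i_m \<le> i_(m+1) gives (p
  - 1) a \<le> p^(m+1). If i_0 were at least 2, then a \<ge> 2 p^m, against 2 (p - 1) > p. If i_1
  exceeded p + 1 and m > 0, then a \<ge> p^(m-1) (p + 2), against (p - 1) (p + 2) > p^2. For m = 0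
  one gets a = 1, and the hypothesis \<open>b\<close> is itself the claim on i_1.\<close>

lemma fps_ramification_rigid:
  fixes H :: "'k fps"
  assumes H: "fps_X\<^sup>2 dvd H - fps_X"
    and a: "fps_X ^ Suc a dvd fps_iter H (p ^ m) - fps_X" "fps_nth (fps_iter H (p ^ m) - fps_X) (Suc a) \<noteq> 0"
    and b: "fps_nth (fps_iter H (p ^ Suc m) - fps_X) (Suc (a + p ^ Suc m)) \<noteq> 0"
  shows "fps_X ^ Suc (\<Sum>j\<le>n. p ^ j) dvd fps_iter H (p ^ n) - fps_X"
    and "fps_nth (fps_iter H (p ^ n) - fps_X) (Suc (\<Sum>j\<le>n. p ^ j)) \<noteq> 0"
proof -
  have H0: "fps_nth H 0 = 0" using H unfolding fps_X_power_dvd_iff by auto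
  have le_a: "p ^ k * i \<le> a" if "1 \<le> i" "fps_X ^ (i + 1) dvd fps_iter H (p ^ j) - fps_X" "j + k = m" for i j k
  proof -
    have "fps_X ^ (p ^ k * i + 1) dvd fps_iter H (p ^ m) - fps_X"
      using fps_iter_prime_power_dvd[OF that(1,2), of k]
      by (simp add: fps_iter_mult[OF H0] power_add[symmetric] that(3))
    then show ?thesis using a(2) unfolding fps_X_power_dvd_iff by (metis not_less_eq Suc_eq_plus1 not_le)
  qed
  have "p ^ m \<le> a" using le_a[of 1 0 m] H H0 by (simp add: numeral_2_eq_2)
  moreover have "1 \<le> p ^ m" using p3 by simp
  ultimately have "1 \<le> a" by linarith
  have "fps_X ^ (p * a + 1) dvd fps_iter H (p ^ Suc m) - fps_X"
    using fps_iter_prime_power_dvd[of a "fps_iter H (p ^ m)" 1] \<open>1 \<le> a\<close> a(1)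
    by (simp add: fps_iter_mult[OF H0] mult.commute)
  then have "p * a \<le> a + p ^ Suc m"
    using b unfolding fps_X_power_dvd_iff by (metis not_less_eq Suc_eq_plus1 not_le)
  moreover have "p * a = a + (p - 1) * a" using p3 by (cases p) auto
  ultimately have upper: "(p - 1) * a \<le> p ^ Suc m" by linarith
  have i0: "fps_nth (H - fps_X) 2 \<noteq> 0"
  proof
    assume "fps_nth (H - fps_X) 2 = 0"
    then have "fps_X ^ (2 + 1) dvd H - fps_X"
      using H by (simp only: fps_X_power_Suc_dvd_iff Suc_eq_plus1[symmetric])
    then have "p ^ m * 2 \<le> a" using le_a[of 2 0 m] H0 by simp
    then have "(p - 1) * (p ^ m * 2) \<le> p ^ Suc m" using upper by (meson le_trans mult_le_mono2)
    then have "p ^ m * ((p - 1) * 2) \<le> p ^ m * p" by (simp add: algebra_simps)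
    then show False using p3 by auto
  qed
  have i1: "fps_nth (fps_iter H p - fps_X) (p + 2) \<noteq> 0"
  proof
    assume z: "fps_nth (fps_iter H p - fps_X) (p + 2) = 0"
    obtain w where w: "w * (fps_X * H) = H - fps_X"
      using recip_diff_exists[of 1 H] H by (auto simp: numeral_2_eq_2)
    have "fps_X ^ p dvd (\<Sum>j<p. w oo fps_iter H j)"
      using recip_diff_sum_leading(1)[OF p w, of 0] by simp
    then have "fps_X ^ (p + 2) dvd fps_iter H p - fps_X"
      by (rule recip_diff_leading(1)[OF recip_diff_sum[OF w]])
    with z have d: "fps_X ^ (p + 2 + 1) dvd fps_iter H (p ^ 1) - fps_X"
      by (simp only: fps_X_power_Suc_dvd_iff Suc_eq_plus1[symmetric] power_one_right)
    show False
    proof (cases m)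
      case 0
      have "fps_X ^ Suc a dvd H - fps_X" using a(1) 0 H0 by simp
      then have "\<not> 2 < Suc a" using i0 unfolding fps_X_power_dvd_iff by blast
      then have "a = 1" using \<open>1 \<le> a\<close> by simp
      then show False using b z 0 by simp
    next
      case (Suc k)
      then have "p ^ k * (p + 2) \<le> a" using le_a[OF _ d, of k] by simp
      then have "(p - 1) * (p ^ k * (p + 2)) \<le> p ^ Suc m" using upper by (meson le_trans mult_le_mono2)
      then have "p ^ k * ((p - 1) * (p + 2)) \<le> p ^ k * (p * p)" by (simp add: Suc algebra_simps)
      then have "(p - 1) * (p + 2) \<le> p * p" using p3 by auto
      moreover obtain t where "p = t + 3" using p3 by (metis add.commute le_Suc_ex)
      ultimately show False by (simp add: algebra_simps)
    qed
  qed
  from fps_iter_prime_power_leading[OF H i0 i1]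
  show "fps_X ^ Suc (\<Sum>j\<le>n. p ^ j) dvd fps_iter H (p ^ n) - fps_X"
    "fps_nth (fps_iter H (p ^ n) - fps_X) (Suc (\<Sum>j\<le>n. p ^ j)) \<noteq> 0" .
qed

end

section \<open>Passage from a multiplier of order q to a series tangent to the identity\<close>

lemma subdegree_eq_iff:
  "\<phi> \<noteq> 0 \<and> subdegree \<phi> = n \<longleftrightarrow> fps_X ^ n dvd \<phi> \<and> fps_nth \<phi> n \<noteq> (0::'a::comm_ring_1)"
  unfolding fps_X_power_dvd_iff
  by (metis fps_nonzero_nth nth_less_subdegree_zero nth_subdegree_nonzero subdegreeI)

lemma subdegree_cong_mod:
  fixes \<phi> \<psi> :: "'a::comm_ring_1 fps"
  assumes "fps_X ^ N dvd \<phi> - \<psi>" "n < N"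
  shows "\<phi> \<noteq> 0 \<and> subdegree \<phi> = n \<longleftrightarrow> \<psi> \<noteq> 0 \<and> subdegree \<psi> = n"
proof -
  have "fps_nth \<phi> j = fps_nth \<psi> j" if "j \<le> n" for j
    using assms that unfolding fps_X_power_dvd_iff by auto
  then show ?thesis unfolding subdegree_eq_iff fps_X_power_dvd_iff by auto
qed

text \<open>The case in which the factor m in the leading coefficient, m being the order of \<phi>,
  does not vanish. It serves for the coordinate of order q, which is prime to p.\<close>

lemma subdegree_compose_diff:
  fixes H \<phi> :: "'k::field fps"
  assumes i: "1 \<le> i" and H: "H - fps_X \<noteq> 0" "subdegree (H - fps_X) = i + 1"
    and \<phi>: "\<phi> \<noteq> 0" "of_nat (subdegree \<phi>) \<noteq> (0::'k)"
  shows "(\<phi> oo H) - \<phi> \<noteq> 0 \<and> subdegree ((\<phi> oo H) - \<phi>) = subdegree \<phi> + i"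
proof -
  have d: "fps_X ^ (i + 1) dvd H - fps_X" and n: "fps_nth (H - fps_X) (i + 1) \<noteq> 0"
    using H subdegree_eq_iff[of "H - fps_X" "i + 1"] by auto
  obtain w where w: "w * (fps_X * H) = H - fps_X" "fps_X ^ (i - 1) dvd w"
    using recip_diff_exists[OF i d] by blast
  have y: "fps_X ^ i dvd fps_X * w"
    using w(2) i by (cases i) (auto intro: mult_dvd_mono)
  have yi: "fps_nth (fps_X * w) i = fps_nth (H - fps_X) (i + 1)"
    using recip_diff_leading(2)[OF w] i by (cases i) simp_all
  have \<phi>d: "fps_X ^ subdegree \<phi> dvd \<phi>" and \<phi>n: "fps_nth \<phi> (subdegree \<phi>) \<noteq> 0"
    using subdegree_eq_iff[of \<phi>] \<phi>(1) by auto
  show ?thesis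
    unfolding subdegree_eq_iff
    using compose_diff_leading(1,2)[OF recip_diff_factor[OF w(1)] y i \<phi>d] yi n \<phi>(2) \<phi>n by simp
qed

lemma root_of_unity_order_power_eq_1:
  assumes "root_of_unity_order \<gamma> q"
  shows "\<gamma> ^ s = 1 \<longleftrightarrow> q dvd s"
proof
  have q: "1 \<le> q" "\<gamma> ^ q = 1" "\<And>m. 1 \<le> m \<Longrightarrow> m < q \<Longrightarrow> \<gamma> ^ m \<noteq> 1"
    using assms by (auto simp: root_of_unity_order_def)
  assume "\<gamma> ^ s = 1"
  moreover have "\<gamma> ^ s = (\<gamma> ^ q) ^ (s div q) * \<gamma> ^ (s mod q)"
    by (metis mult_div_mod_eq power_add power_mult)
  ultimately have "\<gamma> ^ (s mod q) = 1" using q(2) by simp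
  with q(1) q(3)[of "s mod q"] show "q dvd s" by (auto simp: dvd_eq_mod_eq_0 Suc_le_eq intro: ccontr)
qed (use assms in \<open>auto simp: root_of_unity_order_def power_mult elim!: dvdE\<close>)

lemma ex_power_cong_1:
  fixes q p :: nat
  assumes "1 \<le> q" "coprime p q"
  shows "\<exists>k\<ge>1. [p ^ k = 1] (mod q)"
proof -
  have "range (\<lambda>k. p ^ k mod q) \<subseteq> {..<q}" using assms(1) by auto
  then have "\<not> inj (\<lambda>k. p ^ k mod q)"
    by (meson finite_imageD finite_lessThan infinite_UNIV_nat rev_finite_subset)
  then obtain i j where "i \<noteq> j" "p ^ i mod q = p ^ j mod q" unfolding inj_def by blast
  then obtain i j where ij: "i < j" "p ^ j mod q = p ^ i mod q" by (metis nat_neq_iff)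
  have "[p ^ i * p ^ (j - i) = p ^ i * 1] (mod q)"
    using ij by (simp add: cong_def flip: power_add)
  then have "[p ^ (j - i) = 1] (mod q)"
    using assms(2) by (metis cong_mult_lcancel_nat coprime_power_left_iff)
  then show ?thesis using ij(1) by (intro exI[of _ "j - i"]) simp
qed

text \<open>A high iterate G of g satisfies G^q = X modulo a large power of X, and
  averaging over the powers of G linearises G; Z below is the q-th power of the linearising coordinate.\<close>

lemma invariant_coordinate:
  fixes g :: "'k::field fps"
  assumes p: "prime p" "odd p" "of_nat p = (0::'k)" and q: "\<not> p dvd q"
    and g0: "fps_nth g 0 = 0" and g1: "root_of_unity_order (fps_nth g 1) q"
  obtains e Z where "fps_nth (fps_iter g e) 1 = fps_nth g 1"
    "Z \<noteq> 0" "subdegree Z = q" "fps_X ^ N dvd (Z oo fps_iter g e) - Z"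
proof -
  define \<gamma> where "\<gamma> = fps_nth g 1"
  have q1: "1 \<le> q" and \<gamma>q: "\<gamma> ^ q = 1" using g1 by (auto simp: root_of_unity_order_def \<gamma>_def)
  obtain k where k: "1 \<le> k" "[p ^ k = 1] (mod q)"
    using ex_power_cong_1[of q p] p(1) q q1 by (auto simp: prime_imp_coprime)
  \<comment> \<open>Being 1 modulo q, the exponent t preserves the multiplier \<gamma>; being a
    power of p and at least N, it makes G^q, the t-th iterate of g^q, agree with X modulo
    X^N.\<close>
  define t where "t = p ^ (k * N)"
  have "[t = 1 ^ N] (mod q)"
    unfolding t_def power_mult using k(2) by (rule cong_pow)
  then have "[t = 1] (mod q)" by simp
  moreover have "1 \<le> t" using prime_gt_0_nat[OF p(1)] by (simp add: t_def)
  ultimately obtain c where "t = c * q + 1" using cong_le_nat[of 1 t q] by blast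
  then have t1: "\<exists>c. t = q * c + 1" by (metis mult.commute)
  have tN: "N \<le> t"
  proof -
    have "N \<le> k * N" using k(1) by simp
    also have "\<dots> < p ^ (k * N)" using prime_ge_2_nat[OF p(1)] by (intro power_gt_expt) simp
    finally show ?thesis by (simp add: t_def)
  qed
  define G where "G = fps_iter g t"
  have G0 [simp]: "fps_nth G 0 = 0" by (simp add: G_def)
  have "fps_nth G 1 = \<gamma> ^ t" by (simp add: G_def fps_iter_nth_1[OF g0] \<gamma>_def del: One_nat_def)
  then have G1: "fps_nth G 1 = \<gamma>" using t1 \<gamma>q by (auto simp: power_add power_mult)
  have Gq: "fps_X ^ N dvd fps_iter G q - fps_X"
  proof -
    let ?h = "fps_iter g q"
    have "fps_nth ?h 1 = 1" using \<gamma>q by (simp add: fps_iter_nth_1[OF g0] \<gamma>_def del: One_nat_def)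
    then have "fps_X ^ (1 + 1) dvd ?h - fps_X"
      unfolding fps_X_power_dvd_iff by (auto simp: less_Suc_eq)
    then have "fps_X ^ (t * 1 + 1) dvd fps_iter ?h t - fps_X"
      unfolding t_def by (intro fps_iter_prime_power_dvd[OF p]) simp
    moreover have "fps_iter ?h t = fps_iter G q"
      by (simp add: G_def fps_iter_mult[OF g0] mult.commute)
    moreover have "fps_X ^ N dvd (fps_X ^ (t * 1 + 1) :: 'k fps)" using tN by (intro le_imp_power_dvd) simp
    ultimately show ?thesis by (metis dvd_trans)
  qed
  \<comment> \<open>The weights are \<gamma>^(-j), so y oo G telescopes to \<gamma> y up to a
    multiple of G^q - X. The linear coefficient of y is q, nonzero because p does not divide
    q.\<close>
  define y where "y = (\<Sum>j<q. fps_const (\<gamma> ^ (q - j)) * fps_iter G j)"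
  define u where "u j = fps_const (\<gamma> ^ (q + 1 - j)) * fps_iter G j" for j
  have "(y oo G) = (\<Sum>j<q. u (Suc j))"
    by (simp add: y_def u_def fps_compose_sum_distrib fps_compose_mult_distrib fps_iter_Suc)
  moreover have "fps_const \<gamma> * y = (\<Sum>j<q. u j)"
    unfolding y_def u_def sum_distrib_left
    by (intro sum.cong refl) (simp add: mult.assoc[symmetric] Suc_diff_le del: fps_const_mult flip: fps_const_mult)
  ultimately have "(y oo G) - fps_const \<gamma> * y = u q - u 0"
    by (simp only: sum_lessThan_telescope sum_subtractf[symmetric])
  also have "\<dots> = fps_const \<gamma> * (fps_iter G q - fps_X)"
    using \<gamma>q by (simp add: u_def algebra_simps)
  finally have yG: "fps_X ^ N dvd (y oo G) - fps_const \<gamma> * y" using Gq by simp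
  have qnz: "of_nat q \<noteq> (0::'k)" using not_dvd_of_nat[OF p(1) _ p(3)] q by simp
  have y1: "fps_nth y 1 = of_nat q"
  proof -
    have "fps_nth y 1 = (\<Sum>j<q. \<gamma> ^ (q - j) * \<gamma> ^ j)"
      by (simp add: y_def fps_sum_nth fps_iter_nth_1[OF G0] G1 del: One_nat_def)
    also have "\<dots> = (\<Sum>j<q. 1)" by (intro sum.cong refl) (simp add: power_add[symmetric] \<gamma>q)
    finally show ?thesis by simp
  qed
  have y0: "fps_nth y 0 = 0" by (simp add: y_def fps_sum_nth)
  have ysd: "y \<noteq> 0 \<and> subdegree y = 1"
    unfolding subdegree_eq_iff fps_X_power_dvd_iff using y0 y1 qnz by simp
  have "(y ^ q oo G) - y ^ q = (y oo G) ^ q - (fps_const \<gamma> * y) ^ q"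
    by (simp add: fps_compose_power power_mult_distrib fps_const_power \<gamma>q)
  then have "(y oo G) - fps_const \<gamma> * y dvd (y ^ q oo G) - y ^ q"
    by (metis dvd_triv_left power_diff_sumr2)
  with yG have "fps_X ^ N dvd (y ^ q oo G) - y ^ q" by (rule dvd_trans)
  with that[of t "y ^ q"] show ?thesis
    using ysd G1 by (simp add: G_def \<gamma>_def subdegree_power)
qed

text \<open>If the error has lowest term c X^s and \<gamma> is the multiplier of G, invariance gives
  \<gamma>^s c = c. Hence c = 0 unless q divides s, and in that case a multiple of Z^(s/q) cancels
  the term.\<close>

lemma invariant_series_approx:
  fixes G Z \<phi> :: "'k::field fps"
  assumes G: "fps_nth G 0 = 0" "root_of_unity_order (fps_nth G 1) q"
    and Z: "Z \<noteq> 0" "subdegree Z = q" "fps_X ^ N dvd (Z oo G) - Z"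
    and \<phi>: "fps_X ^ N dvd (\<phi> oo G) - \<phi>"
    and s: "s \<le> N"
  shows "\<exists>F. fps_X ^ s dvd \<phi> - (F oo Z)"
  using s
proof (induction s)
  case (Suc s)
  then obtain F where F: "fps_X ^ s dvd \<phi> - (F oo Z)" by auto
  have q1: "1 \<le> q" using G(2) by (simp add: root_of_unity_order_def)
  have Z0: "fps_nth Z 0 = 0" using Z(2) q1 by (intro nth_less_subdegree_zero) simp
  define \<psi> where "\<psi> = \<phi> - (F oo Z)"
  define c where "c = fps_nth \<psi> s"
  have "(\<psi> oo G) - \<psi> = ((\<phi> oo G) - \<phi>) - ((F oo (Z oo G)) - (F oo Z))"
    by (simp add: \<psi>_def fps_compose_sub_distrib fps_compose_assoc G Z0)
  also have "fps_X ^ N dvd \<dots>" using \<phi> fps_compose_cong_mod[OF Z(3)] by (rule dvd_diff)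
  finally have "fps_nth ((\<psi> oo G) - \<psi>) s = 0" using Suc.prems unfolding fps_X_power_dvd_iff by simp
  moreover have "fps_nth (\<psi> oo G) s = fps_nth G 1 ^ s * c"
  proof -
    obtain \<chi> where \<chi>: "\<psi> = fps_X ^ s * \<chi>" using F unfolding \<psi>_def[symmetric] by (elim dvdE)
    have "fps_X ^ 1 dvd G" using G(1) unfolding fps_X_power_dvd_iff by simp
    then obtain G' where G': "G = fps_X * G'" by (auto elim: dvdE)
    have "\<psi> oo G = fps_X ^ s * (G' ^ s * (\<chi> oo G))"
      by (simp add: \<chi> fps_compose_mult_distrib fps_X_power_compose G(1)) (simp add: G' power_mult_distrib)
    then have "fps_nth (\<psi> oo G) s = fps_nth G' 0 ^ s * fps_nth \<chi> 0"
      by (simp add: fps_X_power_mult_nth fps_power_zeroth)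
    then show ?thesis by (simp add: c_def \<chi> G' fps_X_power_mult_nth)
  qed
  ultimately have c: "fps_nth G 1 ^ s * c = c" by (simp add: c_def)
  show ?case
  proof (cases "q dvd s")
    case False
    then have "c = 0" using c root_of_unity_order_power_eq_1[OF G(2)] by (metis mult_cancel_right1)
    then show ?thesis using F unfolding c_def \<psi>_def by (metis fps_X_power_Suc_dvd_iff)
  next
    case True
    then obtain t where t: "s = q * t" by (elim dvdE)
    have "Z ^ t \<noteq> 0 \<and> subdegree (Z ^ t) = s" using Z by (simp add: t mult.commute subdegree_power)
    then have Zt: "fps_X ^ s dvd Z ^ t" "fps_nth (Z ^ t) s \<noteq> 0" unfolding subdegree_eq_iff by auto
    define d where "d = c / fps_nth (Z ^ t) s"
    have eq: "\<phi> - ((F + fps_const d * fps_X ^ t) oo Z) = \<psi> - fps_const d * Z ^ t"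
      by (simp add: \<psi>_def fps_compose_add_distrib fps_compose_mult_distrib Z0 fps_X_power_compose)
    have "fps_X ^ Suc s dvd \<psi> - fps_const d * Z ^ t"
      unfolding fps_X_power_Suc_dvd_iff using F Zt by (simp add: \<psi>_def[symmetric] d_def c_def)
    then show ?thesis using eq by metis
  qed
qed simp

text \<open>The q-th iterate h and G are both iterates of g and commute, so Z oo h is again
  invariant under G and equals hb oo Z modulo X^N for some series hb tangent to the identity.
  Computing the order of Z oo h^k - Z in both ways shows that the ramification numbers of h are q
  times those of hb.\<close>

theorem fps_minimally_ramified:
  fixes g :: "'k::field fps"
  assumes p: "prime p" "odd p" "of_nat p = (0::'k)" and q: "\<not> p dvd q"
    and g0: "fps_nth g 0 = 0" and g1: "root_of_unity_order (fps_nth g 1) q"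
    and a: "fps_iter g (q * p ^ m) - fps_X \<noteq> 0" "subdegree (fps_iter g (q * p ^ m) - fps_X) = Suc a"
    and b: "fps_iter g (q * p ^ Suc m) - fps_X \<noteq> 0" "subdegree (fps_iter g (q * p ^ Suc m) - fps_X) = Suc (a + q * p ^ Suc m)"
  shows "fps_iter g (q * p ^ n) - fps_X \<noteq> 0 \<and>
    subdegree (fps_iter g (q * p ^ n) - fps_X) = Suc (q * (\<Sum>j\<le>n. p ^ j))"
proof -
  have q1: "1 \<le> q" and gq: "fps_nth g 1 ^ q = 1" using g1 by (auto simp: root_of_unity_order_def)
  have qnz: "of_nat q \<noteq> (0::'k)" using not_dvd_of_nat[OF p(1) _ p(3)] q by simp
  define h where "h = fps_iter g q"
  have h0 [simp]: "fps_nth h 0 = 0" by (simp add: h_def)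
  have h_iter: "fps_iter h k = fps_iter g (q * k)" for k by (simp add: h_def fps_iter_mult[OF g0])
  have K2: "fps_nth (fps_iter h k) 1 = 1" for k
    unfolding h_iter by (simp add: fps_iter_nth_1[OF g0] power_mult gq del: One_nat_def)
  have hX: "h - fps_X \<noteq> 0"
  proof
    assume "h - fps_X = 0"
    then have "h = fps_X" by simp
    moreover have "fps_iter fps_X k = (fps_X :: 'k fps)" for k by (induction k) (simp_all add: fps_iter_Suc)
    ultimately have "fps_iter h (p ^ m) - fps_X = 0" by simp
    then show False using a(1) by (simp add: h_iter)
  qed
  define N where "N = subdegree (h - fps_X) + q + a + q * p ^ Suc m + q * (\<Sum>j\<le>n. p ^ j) + 1"
  obtain e Z where G1: "fps_nth (fps_iter g e) 1 = fps_nth g 1"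
    and Z: "Z \<noteq> 0" "subdegree Z = q" "fps_X ^ N dvd (Z oo fps_iter g e) - Z"
    using invariant_coordinate[OF p q g0 g1] by blast
  define G where "G = fps_iter g e"
  have Z0: "fps_nth Z 0 = 0" using Z(2) q1 by (intro nth_less_subdegree_zero) simp
  have G0: "fps_nth G 0 = 0" by (simp add: G_def)
  have "((Z oo h) oo G) - (Z oo h) = ((Z oo G) - Z) oo h"
  proof -
    have "(Z oo h) oo G = Z oo (h oo G)" by (simp add: fps_compose_assoc G0)
    also have "h oo G = G oo h" unfolding h_def G_def by (rule fps_iter_commute[OF g0])
    finally show ?thesis by (simp add: fps_compose_assoc fps_compose_sub_distrib G0)
  qed
  also have "fps_X ^ N dvd \<dots>" using Z(3) unfolding G_def by (rule fps_X_power_dvd_compose) simp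
  finally obtain hb where hb: "fps_X ^ N dvd (Z oo h) - (hb oo Z)"
    using invariant_series_approx[OF G0 _ Z(1,2) Z(3)[folded G_def] _ order_refl] g1 G1 unfolding G_def by metis
  have hb0: "fps_nth hb 0 = 0"
    using hb Z0 unfolding fps_X_power_dvd_iff by (auto simp: N_def dest: spec[of _ 0])
  have semiconj: "fps_X ^ N dvd (Z oo fps_iter h k) - (fps_iter hb k oo Z)" for k
  proof (induction k)
    case (Suc k)
    have "(Z oo fps_iter h (Suc k)) - (fps_iter hb (Suc k) oo Z) =
       (((Z oo fps_iter h k) - (fps_iter hb k oo Z)) oo h) + ((fps_iter hb k oo (Z oo h)) - (fps_iter hb k oo (hb oo Z)))"
      by (simp add: fps_iter_Suc fps_compose_assoc fps_compose_sub_distrib hb0 Z0)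
    also have "fps_X ^ N dvd \<dots>"
      by (intro dvd_add fps_X_power_dvd_compose Suc fps_compose_cong_mod hb) simp
    finally show ?case .
  qed (simp add: Z0)
  have transfer: "(fps_iter h k - fps_X \<noteq> 0 \<and> subdegree (fps_iter h k - fps_X) + q = Suc j) \<longleftrightarrow>
      (fps_iter hb k - fps_X \<noteq> 0 \<and> subdegree (fps_iter hb k - fps_X) * q = j)" if "j < N" for j k
  proof -
    let ?K = "fps_iter h k" and ?B = "fps_iter hb k"
    have K: "2 \<le> subdegree (?K - fps_X)" if "?K - fps_X \<noteq> 0"
      using that K2[of k] by (intro subdegree_geI) (auto simp: less_2_cases_iff)
    have "(Z oo ?K) - Z \<noteq> 0 \<and> subdegree ((Z oo ?K) - Z) = j \<longleftrightarrow> (?B - fps_X) oo Z \<noteq> 0 \<and> subdegree ((?B - fps_X) oo Z) = j"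
      using semiconj[of k] that by (intro subdegree_cong_mod) (simp_all add: fps_compose_sub_distrib Z0)
    moreover have "(?B - fps_X) oo Z \<noteq> 0 \<longleftrightarrow> ?B - fps_X \<noteq> 0"
      using Z(1) Z0 by (simp add: fps_compose_eq_0_iff)
    moreover have "subdegree ((?B - fps_X) oo Z) = subdegree (?B - fps_X) * q"
      using Z Z0 by simp
    moreover have "(Z oo ?K) - Z \<noteq> 0 \<and> subdegree ((Z oo ?K) - Z) = j \<longleftrightarrow>
        ?K - fps_X \<noteq> 0 \<and> subdegree (?K - fps_X) + q = Suc j"
    proof (cases "?K - fps_X = 0")
      case False
      have "(Z oo ?K) - Z \<noteq> 0 \<and> subdegree ((Z oo ?K) - Z) = q + (subdegree (?K - fps_X) - 1)"
        using subdegree_compose_diff[of "subdegree (?K - fps_X) - 1" ?K Z] K[OF False] False Z qnz by simp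
      then show ?thesis using K[OF False] False by auto
    qed simp
    ultimately show ?thesis by metis
  qed
  have sd1: "fps_iter hb (p ^ m) - fps_X \<noteq> 0 \<and> subdegree (fps_iter hb (p ^ m) - fps_X) * q = a + q"
    using a transfer[of "a + q" "p ^ m"] by (simp add: h_iter N_def)
  then obtain a' where a': "subdegree (fps_iter hb (p ^ m) - fps_X) = Suc a'" "a = a' * q"
    by (cases "subdegree (fps_iter hb (p ^ m) - fps_X)") (use q1 in auto)
  have sd2: "fps_iter hb (p ^ Suc m) - fps_X \<noteq> 0 \<and> subdegree (fps_iter hb (p ^ Suc m) - fps_X) * q = a + q * p ^ Suc m + q"
    using b transfer[of "a + q * p ^ Suc m + q" "p ^ Suc m"] by (simp add: h_iter N_def)
  then have "subdegree (fps_iter hb (p ^ Suc m) - fps_X) * q = Suc (a' + p ^ Suc m) * q"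
    by (simp add: a'(2) algebra_simps)
  then have b': "subdegree (fps_iter hb (p ^ Suc m) - fps_X) = Suc (a' + p ^ Suc m)"
    using q1 by (metis mult_right_cancel not_one_le_zero)
  have "2 \<le> subdegree (h - fps_X)"
    using hX K2[of 1] by (intro subdegree_geI) (auto simp: less_2_cases_iff)
  then have sd0: "hb - fps_X \<noteq> 0 \<and> subdegree (hb - fps_X) * q = subdegree (h - fps_X) + q - 1"
    using transfer[of "subdegree (h - fps_X) + q - 1" 1] hX hb0 q1 by (auto simp: N_def)
  \<comment> \<open>q times this order is the order of h - X plus q - 1, which exceeds q.\<close>
  have "2 \<le> subdegree (hb - fps_X)"
  proof (rule ccontr)
    assume "\<not> 2 \<le> subdegree (hb - fps_X)"
    then have "subdegree (hb - fps_X) * q \<le> 1 * q" by (intro mult_le_mono1) simp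
    then show False using sd0 \<open>2 \<le> subdegree (h - fps_X)\<close> by linarith
  qed
  then have hb2: "fps_X\<^sup>2 dvd hb - fps_X"
    unfolding fps_X_power_dvd_iff by (metis less_le_trans nth_less_subdegree_zero)
  have am: "fps_X ^ Suc a' dvd fps_iter hb (p ^ m) - fps_X \<and> fps_nth (fps_iter hb (p ^ m) - fps_X) (Suc a') \<noteq> 0"
    using sd1 a'(1) subdegree_eq_iff by blast
  have bm: "fps_nth (fps_iter hb (p ^ Suc m) - fps_X) (Suc (a' + p ^ Suc m)) \<noteq> 0"
    using sd2 b' subdegree_eq_iff by blast
  have "fps_iter hb (p ^ n) - fps_X \<noteq> 0 \<and> subdegree (fps_iter hb (p ^ n) - fps_X) = Suc (\<Sum>j\<le>n. p ^ j)"
    unfolding subdegree_eq_iff using fps_ramification_rigid[OF p hb2 _ _ bm, of n] am by blast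
  then have "fps_iter h (p ^ n) - fps_X \<noteq> 0 \<and> subdegree (fps_iter h (p ^ n) - fps_X) + q = Suc (q * (\<Sum>j\<le>n. p ^ j) + q)"
    using transfer[of "q * (\<Sum>j\<le>n. p ^ j) + q" "p ^ n"] by (simp add: N_def algebra_simps)
  then show ?thesis by (simp add: h_iter)
qed

section \<open>Iterates of polynomials and their reductions\<close>

lemma poly_iter_0 [simp]: "poly_iter h 0 = [:0, 1:]"
  by (simp add: poly_iter_def)

lemma poly_iter_add: "poly_iter h (m + n) = pcompose (poly_iter h m) (poly_iter (h :: 'a::comm_ring_1 poly) n)"
  by (induction m) (simp_all add: poly_iter_Suc pcompose_pCons pcompose_assoc)

lemma poly_iter_mult: "poly_iter (poly_iter h m) n = poly_iter (h :: 'a::comm_ring_1 poly) (m * n)"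
  by (induction n) (simp_all add: poly_iter_Suc poly_iter_add)

lemma poly_poly_iter: "poly (poly_iter h m) z = (poly h ^^ m) z"
  by (induction m) (simp_all add: poly_iter_Suc poly_pcompose)

lemma coeff_0_poly_iter: "coeff h 0 = 0 \<Longrightarrow> coeff (poly_iter h m) 0 = (0::'a::comm_ring_1)"
  by (simp add: poly_0_coeff_0[symmetric] poly_poly_iter, induction m) simp_all

lemma poly_pderiv_poly_iter:
  "poly h z = z \<Longrightarrow> poly (pderiv (poly_iter h m)) z = poly (pderiv h) z ^ m" for h :: "'a::idom poly"
proof (induction m)
  case (Suc m)
  have "(poly h ^^ m) z = z" using Suc.prems by (induction m) simp_all
  then show ?case using Suc by (simp add: poly_iter_Suc pderiv_pcompose poly_pcompose poly_poly_iter)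
qed (simp add: pderiv_pCons)

lemma coeff_1_poly_iter: "coeff h 0 = 0 \<Longrightarrow> coeff (poly_iter h m) 1 = coeff h 1 ^ m" for h :: "'a::idom poly"
  using poly_pderiv_poly_iter[of h 0 m] by (simp add: poly_0_coeff_0 coeff_pderiv)

lemma fps_of_poly_poly_iter:
  "coeff h 0 = 0 \<Longrightarrow> fps_of_poly (poly_iter h m) = fps_iter (fps_of_poly h) m" for h :: "'a::idom poly"
proof (induction m)
  case 0
  show ?case by (simp add: fps_of_poly_pCons)
next
  case (Suc m)
  then show ?case by (simp add: poly_iter_Suc fps_of_poly_pcompose coeff_0_poly_iter fps_iter_Suc2)
qed

lemma ord_poly_eq_enat: "ord_poly f = enat m \<longleftrightarrow> coeff f m \<noteq> 0 \<and> (\<forall>i<m. coeff f i = 0)"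
proof (cases "f = 0")
  case False
  then obtain k where "coeff f k \<noteq> 0" by (metis leading_coeff_0_iff)
  then have "coeff f (LEAST i. coeff f i \<noteq> 0) \<noteq> 0" by (rule LeastI)
  then show ?thesis
    using False by (auto simp: ord_poly_def dest: not_less_Least intro!: Least_equality leI)
qed (simp add: ord_poly_def)

lemma poly_order_0_eq_iff:
  fixes F :: "'k::idom poly"
  shows "F \<noteq> 0 \<and> Polynomial.order 0 F = m \<longleftrightarrow> coeff F m \<noteq> 0 \<and> (\<forall>i<m. coeff F i = 0)"
proof (cases "F = 0")
  case False
  have "Polynomial.order 0 F = m \<longleftrightarrow> m \<le> Polynomial.order 0 F \<and> \<not> Suc m \<le> Polynomial.order 0 F" by auto
  also have "\<dots> \<longleftrightarrow> (\<forall>i<m. coeff F i = 0) \<and> \<not> (\<forall>i<Suc m. coeff F i = 0)"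
    unfolding monom_1_dvd_iff[OF False, symmetric] monom_1_dvd_iff' ..
  finally show ?thesis using False by (auto simp: less_Suc_eq)
qed simp

text \<open>The iterate minus X has constant term 0, so dividing by X is exact and lowers the order
  by one.\<close>

lemma i_index_eq_enat:
  fixes g :: "'k::field poly"
  assumes "coeff g 0 = 0"
  shows "i_index p (poly_iter g q) n = enat m \<longleftrightarrow>
    poly_iter g (q * p ^ n) - [:0, 1:] \<noteq> 0 \<and> Polynomial.order 0 (poly_iter g (q * p ^ n) - [:0, 1:]) = Suc m"
proof -
  let ?F = "poly_iter g (q * p ^ n) - [:0, 1:]"
  have "coeff ?F 0 = 0" by (simp add: coeff_0_poly_iter assms)
  then obtain E where E: "?F = pCons 0 E" by (metis coeff_pCons_0 pCons_cases)
  have "?F div [:0, 1:] = E"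
    unfolding E using nonzero_mult_div_cancel_left[of "[:0, 1:]" E] by simp
  then show ?thesis
    unfolding i_index_def poly_iter_mult ord_poly_eq_enat poly_order_0_eq_iff E
    by (auto simp: less_Suc_eq_0_disj)
qed

section \<open>Integral polynomials and their reductions\<close>

locale valued_field =
  fixes absv :: "'a::field \<Rightarrow> real" and red :: "'a \<Rightarrow> 'k::field"
  assumes abs: "ultrametric_abs absv"
    and closed: "alg_closed_field TYPE('a)"
    and res: "residue_map absv red"
begin

lemma abs_nonneg [simp]: "0 \<le> absv x"
  and abs_eq_0 [simp]: "absv x = 0 \<longleftrightarrow> x = 0"
  and abs_mult: "absv (x * y) = absv x * absv y"
  and abs_add: "absv (x + y) \<le> max (absv x) (absv y)"
  using abs by (auto simp: ultrametric_abs_def)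

lemma abs_0 [simp]: "absv 0 = 0" by simp

lemma abs_1 [simp]: "absv 1 = 1"
  using abs_mult[of 1 1] by simp

lemma abs_minus [simp]: "absv (- x) = absv x"
proof -
  have "absv (- 1) * absv (- 1) = 1" by (simp flip: abs_mult)
  then have "absv (- 1) = 1" using abs_nonneg[of "-1"] by (metis abs_of_nonneg real_sqrt_abs2 real_sqrt_one)
  then show ?thesis using abs_mult[of "-1" x] by simp
qed

lemma abs_diff: "absv (x - y) \<le> max (absv x) (absv y)"
  using abs_add[of x "- y"] by simp

lemma abs_power: "absv (x ^ n) = absv x ^ n"
  by (induction n) (simp_all add: abs_mult)

lemma abs_add_le_1: "absv x \<le> 1 \<Longrightarrow> absv y \<le> 1 \<Longrightarrow> absv (x + y) \<le> 1"
  using abs_add[of x y] by linarith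

lemma abs_mult_le_1: "absv x \<le> 1 \<Longrightarrow> absv y \<le> 1 \<Longrightarrow> absv (x * y) \<le> 1"
  by (simp add: abs_mult mult_le_one)

lemma abs_mult_less_1: "absv x < 1 \<Longrightarrow> absv y \<le> 1 \<Longrightarrow> absv (x * y) < 1"
  by (metis abs_mult abs_nonneg le_less_trans mult_left_le)

lemma abs_sum_le_1: "(\<And>i. i \<in> A \<Longrightarrow> absv (f i) \<le> 1) \<Longrightarrow> absv (\<Sum>i\<in>A. f i) \<le> 1"
  by (induction A rule: infinite_finite_induct) (auto intro!: abs_add_le_1)

lemma abs_eqI: "absv (x - y) < absv y \<Longrightarrow> absv x = absv y"
  using abs_add[of "x - y" y] abs_diff[of x "x - y"] by auto

lemma red_0 [simp]: "red 0 = 0" and red_1 [simp]: "red 1 = 1"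
  and red_add: "absv x \<le> 1 \<Longrightarrow> absv y \<le> 1 \<Longrightarrow> red (x + y) = red x + red y"
  and red_mult: "absv x \<le> 1 \<Longrightarrow> absv y \<le> 1 \<Longrightarrow> red (x * y) = red x * red y"
  and red_eq_0_iff: "absv x \<le> 1 \<Longrightarrow> red x = 0 \<longleftrightarrow> absv x < 1"
  using res by (auto simp: residue_map_def)

lemma red_minus: "absv x \<le> 1 \<Longrightarrow> red (- x) = - red x"
  using red_add[of x "- x"] by (simp add: eq_neg_iff_add_eq_0 add.commute)

lemma red_diff: "absv x \<le> 1 \<Longrightarrow> absv y \<le> 1 \<Longrightarrow> red (x - y) = red x - red y"
  using red_add[of x "- y"] by (simp add: red_minus)

lemma red_sum: "(\<And>i. i \<in> A \<Longrightarrow> absv (f i) \<le> 1) \<Longrightarrow> red (\<Sum>i\<in>A. f i) = (\<Sum>i\<in>A. red (f i))"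
  by (induction A rule: infinite_finite_induct) (auto simp: red_add abs_sum_le_1)

lemma red_power: "absv x \<le> 1 \<Longrightarrow> red (x ^ n) = red x ^ n"
  by (induction n) (simp_all add: red_mult abs_power power_le_one)

definition integral :: "'a poly \<Rightarrow> bool" where
  "integral P \<longleftrightarrow> (\<forall>i. absv (coeff P i) \<le> 1)"

lemma integral_coeff: "integral P \<Longrightarrow> absv (coeff P i) \<le> 1"
  by (simp add: integral_def)

lemma integral_pCons [simp]: "integral (pCons a P) \<longleftrightarrow> absv a \<le> 1 \<and> integral P"
  unfolding integral_def by (auto simp: coeff_pCons split: nat.splits dest: spec[of _ "Suc _"] spec[of _ 0])

lemma integral_0 [simp]: "integral 0" and integral_1 [simp]: "integral 1"
  by (simp_all add: integral_def)

lemma integral_add: "integral P \<Longrightarrow> integral Q \<Longrightarrow> integral (P + Q)"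
  by (simp add: integral_def abs_add_le_1)

lemma integral_diff: "integral P \<Longrightarrow> integral Q \<Longrightarrow> integral (P - Q)"
  unfolding integral_def by (metis abs_diff coeff_diff max.bounded_iff max_def order_trans)

lemma integral_mult: "integral P \<Longrightarrow> integral Q \<Longrightarrow> integral (P * Q)"
  by (simp add: integral_def coeff_mult abs_sum_le_1 abs_mult_le_1)

lemma integral_pcompose: "integral P \<Longrightarrow> integral Q \<Longrightarrow> integral (pcompose P Q)"
  by (induction P) (auto simp: pcompose_pCons intro!: integral_add integral_mult)

lemma integral_poly_iter: "integral P \<Longrightarrow> integral (poly_iter P m)"
  by (induction m) (simp_all add: poly_iter_Suc integral_pcompose)

lemma integral_poly: "integral P \<Longrightarrow> absv z \<le> 1 \<Longrightarrow> absv (poly P z) \<le> 1"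
  by (induction P) (auto intro!: abs_add_le_1 abs_mult_le_1)

lemma integral_poly_diff_0:
  assumes "integral P" "absv z < 1"
  shows "absv (poly P z - coeff P 0) < 1"
  using assms by (cases P) (simp add: abs_mult_less_1 integral_poly)

lemma integral_synthetic_div: "integral P \<Longrightarrow> absv r \<le> 1 \<Longrightarrow> integral (synthetic_div P r)"
  by (induction P) (auto simp: integral_poly)

abbreviation Red :: "'a poly \<Rightarrow> 'k poly" where "Red \<equiv> map_poly red"

lemma coeff_Red [simp]: "coeff (Red P) i = red (coeff P i)"
  by (simp add: coeff_map_poly)

lemma Red_pCons [simp]: "Red (pCons a P) = pCons (red a) (Red P)"
  by (simp add: poly_eq_iff coeff_pCons split: nat.splits)

lemma Red_1 [simp]: "Red 1 = 1"
  unfolding one_pCons by (simp only: Red_pCons red_1 map_poly_0)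

lemma Red_add: "integral P \<Longrightarrow> integral Q \<Longrightarrow> Red (P + Q) = Red P + Red Q"
  by (simp add: poly_eq_iff integral_def red_add)

lemma Red_diff: "integral P \<Longrightarrow> integral Q \<Longrightarrow> Red (P - Q) = Red P - Red Q"
  by (simp add: poly_eq_iff integral_def red_diff)

lemma Red_mult: "integral P \<Longrightarrow> integral Q \<Longrightarrow> Red (P * Q) = Red P * Red Q"
  by (simp add: poly_eq_iff integral_def coeff_mult red_sum red_mult abs_mult_le_1)

lemma Red_pcompose: "integral P \<Longrightarrow> integral Q \<Longrightarrow> Red (pcompose P Q) = pcompose (Red P) (Red Q)"
  by (induction P) (simp_all add: pcompose_pCons Red_add Red_mult integral_mult integral_pcompose)

lemma Red_poly_iter: "integral P \<Longrightarrow> Red (poly_iter P m) = poly_iter (Red P) m"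
  by (induction m) (simp_all add: poly_iter_Suc Red_pcompose integral_poly_iter)

section \<open>Zeros in the open unit disc\<close>

text \<open>If no zero lies in the open disc, all zeros r have absolute value at least 1, and
  multiplication by X - r preserves the property that the constant term dominates all coefficients.
  A constant term below 1 would then force every coefficient below 1 and the reduction to be
  0.\<close>

lemma ex_small_root:
  assumes F: "integral F" "Red F \<noteq> 0" and F0: "absv (coeff F 0) < 1"
  shows "\<exists>r. absv r < 1 \<and> poly F r = 0"
proof (rule ccontr)
  assume "\<not> ?thesis"
  then have nr: "absv r < 1 \<Longrightarrow> poly F r \<noteq> 0" for r by blast
  have "absv (coeff G i) \<le> absv (coeff G 0)" if "\<And>r. absv r < 1 \<Longrightarrow> poly G r \<noteq> 0" for G i
    using that
  proof (induction "degree G" arbitrary: G i)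
    case 0
    then obtain c where "G = [:c:]" by (metis degree_eq_zeroE)
    then show ?case by (simp add: coeff_pCons split: nat.splits)
  next
    case (Suc n)
    then obtain r where r: "poly G r = 0" using closed by (metis alg_closed_field_def zero_less_Suc)
    then have r1: "1 \<le> absv r" using Suc.prems by (meson not_less)
    define E where "E = synthetic_div G r"
    have G: "G = [:- r, 1:] * E" using synthetic_div_correct'[of r G] r by (simp add: E_def)
    have "absv (coeff E j) \<le> absv (coeff E 0)" for j
    proof (rule Suc.hyps(1))
      show "n = degree E" using Suc.hyps(2) by (simp add: E_def degree_synthetic_div)
      show "poly E s \<noteq> 0" if "absv s < 1" for s using Suc.prems[OF that] G by auto
    qed
    note E = this
    have "absv (r * coeff E i) \<le> absv r * absv (coeff E 0)"
      unfolding abs_mult using E by (intro mult_left_mono) auto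
    moreover have "absv (coeff (pCons 0 E) i) \<le> absv r * absv (coeff E 0)"
    proof -
      have "absv (coeff (pCons 0 E) i) \<le> absv (coeff E 0)"
        using E by (auto simp: coeff_pCons split: nat.splits)
      also have "\<dots> \<le> absv r * absv (coeff E 0)" using mult_right_mono[OF r1 abs_nonneg] by simp
      finally show ?thesis .
    qed
    moreover have "coeff G i = coeff (pCons 0 E) i - r * coeff E i" by (simp add: G)
    ultimately have "absv (coeff G i) \<le> absv r * absv (coeff E 0)"
      using abs_diff[of "coeff (pCons 0 E) i" "r * coeff E i"] by simp
    also have "\<dots> = absv (coeff G 0)" by (simp add: G abs_mult)
    finally show ?case .
  qed
  from this[OF nr] F0 have "absv (coeff F i) < 1" for i by (meson le_less_trans)
  then have "Red F = 0" using F(1) by (simp add: poly_eq_iff integral_def red_eq_0_iff)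
  with F(2) show False by simp
qed

text \<open>Zeros in the open disc are split off one at a time. The degree drops, while integrality
  and a nonzero reduction pass to the cofactor; the process stops when the constant term has
  absolute value 1.\<close>

lemma weierstrass_factorization:
  assumes "integral F" "Red F \<noteq> 0"
  obtains rs G where "F = (\<Prod>r\<leftarrow>rs. [:- r, 1:]) * G" "\<And>r. r \<in> set rs \<Longrightarrow> absv r < 1"
    "integral G" "absv (coeff G 0) = 1"
proof -
  have "\<exists>rs G. F = (\<Prod>r\<leftarrow>rs. [:- r, 1:]) * G \<and> (\<forall>r\<in>set rs. absv r < 1) \<and> integral G \<and> absv (coeff G 0) = 1"
    using assms
  proof (induction "degree F" arbitrary: F rule: less_induct)
    case less
    show ?case
    proof (cases "absv (coeff F 0) = 1")
      case True
      then show ?thesis using less.prems by (intro exI[of _ "[]"] exI[of _ F]) simp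
    next
      case False
      then have "absv (coeff F 0) < 1" using integral_coeff[OF less.prems(1), of 0] by linarith
      then obtain r where r: "absv r < 1" "poly F r = 0" using ex_small_root less.prems by blast
      define E where "E = synthetic_div F r"
      have FE: "F = [:- r, 1:] * E" using synthetic_div_correct'[of r F] r by (simp add: E_def)
      have E: "integral E" using less.prems r by (simp add: E_def integral_synthetic_div)
      have "Red F = Red [:- r, 1:] * Red E" unfolding FE using E r by (intro Red_mult) simp_all
      then have RE: "Red E \<noteq> 0" using less.prems by auto
      have "degree F \<noteq> 0"
      proof
        assume "degree F = 0"
        then obtain c where "F = [:c:]" by (rule degree_eq_zeroE)
        then show False using r(2) less.prems(2) by simp
      qed
      then have "degree E < degree F" by (simp add: E_def degree_synthetic_div)
      from less.hyps[OF this E RE] obtain rs G where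
        "E = (\<Prod>r\<leftarrow>rs. [:- r, 1:]) * G" "\<forall>r\<in>set rs. absv r < 1" "integral G" "absv (coeff G 0) = 1" by blast
      then show ?thesis
        using FE r(1) by (intro exI[of _ "r # rs"] exI[of _ G]) (simp only: list.simps prod_list.Cons mult.assoc, simp)
    qed
  qed
  then show ?thesis using that by blast
qed

lemma abs_coeff_0_factors: "absv (coeff ((\<Prod>r\<leftarrow>rs. [:- r, 1:]) * G) 0) = (\<Prod>r\<leftarrow>rs. absv r) * absv (coeff G 0)"
proof -
  have "absv (coeff (\<Prod>r\<leftarrow>rs. [:- r, 1:]) 0) = (\<Prod>r\<leftarrow>rs. absv r)"
    by (induction rs) (simp_all add: coeff_mult abs_mult)
  then show ?thesis by (simp add: coeff_mult abs_mult)
qed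

lemma Red_factors:
  assumes "\<And>r. r \<in> set rs \<Longrightarrow> absv r < 1" "integral G"
  shows "Red ((\<Prod>r\<leftarrow>rs. [:- r, 1:]) * G) = monom 1 (length rs) * Red G"
  using assms(1)
proof (induction rs)
  case (Cons r rs)
  have int: "integral ((\<Prod>r\<leftarrow>rs. [:- r, 1:]) * G)" if "\<And>r. r \<in> set rs \<Longrightarrow> absv r < 1" for rs
    using that by (induction rs)
      (auto intro!: integral_mult less_imp_le assms(2) simp: mult.assoc simp del: mult_pCons_left)
  have "Red ((\<Prod>r\<leftarrow>r # rs. [:- r, 1:]) * G) = Red [:- r, 1:] * Red ((\<Prod>r\<leftarrow>rs. [:- r, 1:]) * G)"
    using Cons.prems
    by (simp only: list.simps prod_list.Cons mult.assoc) (intro Red_mult int, simp_all add: less_imp_le)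
  also have "red (- r) = 0" using Cons.prems[of r] by (simp add: red_eq_0_iff)
  then have "Red [:- r, 1:] = [:0, 1:]" by simp
  finally show ?case using Cons by (simp add: monom_Suc)
qed (simp add: monom_0)

text \<open>Each factor X - r reduces to X while G keeps a nonzero constant term, so the length of
  rs, which counts zeros with multiplicity, is the order of the reduction. On the open disc G has
  absolute value 1 and hence no zeros.\<close>

lemma weierstrass_factors:
  assumes F: "F = (\<Prod>r\<leftarrow>rs. [:- r, 1:]) * G" and rs: "\<And>r. r \<in> set rs \<Longrightarrow> absv r < 1"
    and G: "integral G" "absv (coeff G 0) = 1"
  shows "Red F \<noteq> 0 \<and> Polynomial.order 0 (Red F) = length rs"
    and "absv (coeff F 0) = (\<Prod>r\<leftarrow>rs. absv r)"
    and "absv z < 1 \<Longrightarrow> poly F z = 0 \<longleftrightarrow> z \<in> set rs"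
proof -
  have G0: "red (coeff G 0) \<noteq> 0" using G by (simp add: red_eq_0_iff)
  have RF: "Red F = monom 1 (length rs) * Red G" unfolding F using rs G(1) by (rule Red_factors)
  show "Red F \<noteq> 0 \<and> Polynomial.order 0 (Red F) = length rs"
    unfolding poly_order_0_eq_iff RF using G0 by (simp add: coeff_monom_mult)
  show "absv (coeff F 0) = (\<Prod>r\<leftarrow>rs. absv r)"
    by (simp add: F abs_coeff_0_factors G)
  assume z: "absv z < 1"
  have "absv (poly G z) = 1" using abs_eqI[of "poly G z" "coeff G 0"] integral_poly_diff_0[OF G(1) z] G(2) by simp
  then have "poly G z \<noteq> 0" by auto
  moreover have "poly (\<Prod>r\<leftarrow>rs. [:- r, 1:]) z = 0 \<longleftrightarrow> z \<in> set rs"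
    by (induction rs) auto
  ultimately show "poly F z = 0 \<longleftrightarrow> z \<in> set rs" by (simp add: F)
qed

text \<open>Recognises a complete list of zeros by counting: once their number reaches the order of
  the reduction, the constant term of the cofactor is a unit.\<close>

lemma order_Red_eq_length_imp_unit:
  assumes F: "F = (\<Prod>r\<leftarrow>rs. [:- r, 1:]) * G" and rs: "\<And>r. r \<in> set rs \<Longrightarrow> absv r < 1"
    and G: "integral G" and ord: "Red F \<noteq> 0" "Polynomial.order 0 (Red F) = length rs"
  shows "absv (coeff G 0) = 1"
proof -
  have "coeff (Red F) (length rs) \<noteq> 0" using ord poly_order_0_eq_iff by blast
  moreover have "Red F = monom 1 (length rs) * Red G" unfolding F using rs G(1) by (rule Red_factors)
  ultimately have "red (coeff G 0) \<noteq> 0" by (simp add: coeff_monom_mult)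
  then show ?thesis using integral_coeff[OF G, of 0] red_eq_0_iff[of "coeff G 0"] by linarith
qed

lemma simple_root:
  assumes F: "F = (\<Prod>r\<leftarrow>rs. [:- r, 1:]) * G" and rs: "\<And>r. r \<in> set rs \<Longrightarrow> absv r < 1"
    and G: "integral G" "absv (coeff G 0) = 1" and r: "distinct rs" "r \<in> set rs"
  shows "poly (pderiv F) r \<noteq> 0"
proof -
  obtain ys zs where yz: "rs = ys @ r # zs" using r(2) by (auto simp: in_set_conv_decomp)
  let ?E = "(\<Prod>r\<leftarrow>ys @ zs. [:- r, 1:]) * G"
  have "poly ?E r \<noteq> 0"
    using weierstrass_factors(3)[OF refl _ G, of "ys @ zs" r] rs r yz by auto
  moreover have "F = [:- r, 1:] * ?E" unfolding F yz by (simp only: map_append list.simps prod_list.append prod_list.Cons mult_ac)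
  ultimately show ?thesis by (simp only: pderiv_mult poly_add poly_mult) (simp add: pderiv_pCons)
qed

lemma divide_distinct_roots:
  assumes "finite S" "integral F" "\<And>r. r \<in> S \<Longrightarrow> absv r < 1 \<and> poly F r = 0"
  obtains rs G where "set rs = S" "distinct rs" "F = (\<Prod>r\<leftarrow>rs. [:- r, 1:]) * G" "integral G"
proof -
  have "\<exists>rs G. set rs = S \<and> distinct rs \<and> F = (\<Prod>r\<leftarrow>rs. [:- r, 1:]) * G \<and> integral G"
    using assms
  proof (induction S)
    case empty
    then show ?case by (intro exI[of _ "[]"] exI[of _ F]) simp
  next
    case (insert s S)
    then obtain rs G where IH: "set rs = S" "distinct rs" "F = (\<Prod>r\<leftarrow>rs. [:- r, 1:]) * G" "integral G" by blast
    have "poly (\<Prod>r\<leftarrow>rs. [:- r, 1:]) s \<noteq> 0"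
    proof -
      have "poly (\<Prod>r\<leftarrow>rs. [:- r, 1:]) s = 0 \<longleftrightarrow> s \<in> set rs" by (induction rs) auto
      then show ?thesis using insert IH by simp
    qed
    then have "poly G s = 0" using insert.prems(2)[of s] IH(3) by simp
    then have "G = [:- s, 1:] * synthetic_div G s" using synthetic_div_correct'[of s G] by simp
    then have "F = (\<Prod>r\<leftarrow>s # rs. [:- r, 1:]) * synthetic_div G s"
      by (subst IH(3)) (metis (no_types, lifting) list.simps(9) mult.assoc mult.left_commute prod_list.Cons)
    moreover have "integral (synthetic_div G s)" using IH insert.prems by (simp add: integral_synthetic_div less_imp_le)
    ultimately show ?case using IH insert by (intro exI[of _ "s # rs"]) auto
  qed
  then show ?thesis using that by blast
qed

section \<open>Difference quotients of iterates\<close>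

text \<open>Q is built along Horner's rule for h, which keeps it integral and covers A = B, where
  the factorisation alone says nothing. Where A and B take the same value, Q is the derivative of h
  there; likewise for the reductions when they coincide.\<close>

lemma compose_diff_quotient:
  assumes "integral h" "integral A" "integral B"
  shows "\<exists>Q. integral Q \<and> pcompose h A - pcompose h B = (A - B) * Q \<and>
    (\<forall>z. poly A z = poly B z \<longrightarrow> poly Q z = poly (pderiv h) (poly B z)) \<and>
    (Red A = Red B \<longrightarrow> Red Q = pcompose (pderiv (Red h)) (Red B))"
  using assms(1)
proof (induction h)
  case (pCons a h)
  then obtain Q where Q: "integral Q" "pcompose h A - pcompose h B = (A - B) * Q"
    "\<And>z. poly A z = poly B z \<Longrightarrow> poly Q z = poly (pderiv h) (poly B z)"
    "Red A = Red B \<Longrightarrow> Red Q = pcompose (pderiv (Red h)) (Red B)" by auto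
  have h: "integral h" using pCons.prems by simp
  have i: "integral (pcompose h A + B * Q)"
    using assms Q h by (intro integral_add integral_mult integral_pcompose)
  have e: "pcompose (pCons a h) A - pcompose (pCons a h) B = (A - B) * (pcompose h A + B * Q)"
  proof -
    have "pcompose (pCons a h) A - pcompose (pCons a h) B = (A - B) * pcompose h A + B * (pcompose h A - pcompose h B)"
      by (simp add: pcompose_pCons algebra_simps)
    then show ?thesis unfolding Q(2) by (simp add: algebra_simps)
  qed
  have r: "Red (pcompose h A + B * Q) = pcompose (pderiv (Red (pCons a h))) (Red B)" if "Red A = Red B"
    using Q(1,4) that assms h
    by (simp add: Red_add Red_mult Red_pcompose integral_mult integral_pcompose pderiv_pCons pcompose_add pcompose_pCons)
  show ?case
    by (rule exI[of _ "pcompose h A + B * Q"]) (use i e r Q(3) in \<open>auto simp: pderiv_pCons poly_pcompose\<close>)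
qed (auto intro: exI[of _ 0])

text \<open>The recursion D_(m+1) = D_m Q + 1 yields the geometric sum in the multiplier at a fixed
  point of h. If h reduces to X, the factorisation does not determine the reduction of D; the
  recursion shows that it is the constant m.\<close>

lemma poly_iter_quotient:
  assumes h: "integral h"
  obtains D where "integral D" "poly_iter h m - [:0, 1:] = (h - [:0, 1:]) * D"
    "\<And>z. poly h z = z \<Longrightarrow> poly D z = (\<Sum>j<m. poly (pderiv h) z ^ j)"
    "Red h = [:0, 1:] \<Longrightarrow> Red D = of_nat m"
proof -
  have "\<exists>D. integral D \<and> poly_iter h m - [:0, 1:] = (h - [:0, 1:]) * D \<and>
    (\<forall>z. poly h z = z \<longrightarrow> poly D z = (\<Sum>j<m. poly (pderiv h) z ^ j)) \<and> (Red h = [:0, 1:] \<longrightarrow> Red D = of_nat m)"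
  proof (induction m)
    case (Suc m)
    then obtain D where D: "integral D" "poly_iter h m - [:0, 1:] = (h - [:0, 1:]) * D"
      "\<And>z. poly h z = z \<Longrightarrow> poly D z = (\<Sum>j<m. poly (pderiv h) z ^ j)"
      "Red h = [:0, 1:] \<Longrightarrow> Red D = of_nat m" by blast
    obtain Q where Q: "integral Q" "pcompose h (poly_iter h m) - pcompose h [:0, 1:] = (poly_iter h m - [:0, 1:]) * Q"
      "\<And>z. poly (poly_iter h m) z = z \<Longrightarrow> poly Q z = poly (pderiv h) z"
      "Red (poly_iter h m) = [:0, 1:] \<Longrightarrow> Red Q = pderiv (Red h)"
      using compose_diff_quotient[OF h integral_poly_iter[OF h], of "[:0, 1:]" m] by auto
    have fixz: "poly (poly_iter h m) z = z" if "poly h z = z" for z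
      using that by (induction m) (simp_all add: poly_poly_iter)
    have fixR: "Red (poly_iter h m) = [:0, 1:]" if "Red h = [:0, 1:]"
      unfolding Red_poly_iter[OF h] that by (induction m) (simp_all add: poly_iter_Suc)
    have "poly_iter h (Suc m) - [:0, 1:] = (pcompose h (poly_iter h m) - pcompose h [:0, 1:]) + (h - [:0, 1:])"
      by (simp add: poly_iter_Suc)
    also have "\<dots> = (h - [:0, 1:]) * (D * Q + 1)" unfolding Q(2) D(2)
      by (simp only: distrib_left mult.assoc mult_1_right)
    finally have e: "poly_iter h (Suc m) - [:0, 1:] = (h - [:0, 1:]) * (D * Q + 1)" .
    have v: "poly (D * Q + 1) z = (\<Sum>j<Suc m. poly (pderiv h) z ^ j)" if "poly h z = z" for z
      using that D(3) Q(3)[OF fixz] by (simp only: sum.lessThan_Suc_shift) (simp add: sum_distrib_left mult.commute)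
    have r: "Red (D * Q + 1) = of_nat (Suc m)" if "Red h = [:0, 1:]"
      using that D Q fixR by (simp add: Red_add Red_mult integral_mult pderiv_pCons)
    show ?case using e v r D Q by (intro exI[of _ "D * Q + 1"]) (simp add: integral_add integral_mult)
  qed (auto intro: exI[of _ 0])
  then show ?thesis using that by blast
qed

end

section \<open>Cycles near an indifferent fixed point\<close>

lemma funpow_fixed: "(f ^^ m) z = z \<Longrightarrow> (f ^^ (m * k)) z = z"
  by (induction k) (simp_all add: funpow_add)

lemma periodic_min_inj_on:
  assumes "periodic_min absv f l z"
  shows "inj_on (\<lambda>j. (f ^^ j) z) {..<l}"
proof -
  have False if "i < j" "j < l" "(f ^^ i) z = (f ^^ j) z" for i j
  proof -
    have "(f ^^ (l - j + i)) z = (f ^^ (l - j + j)) z" using that(3) by (simp only: funpow_add o_apply)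
    then have "(f ^^ (l - j + i)) z = z" using assms that by (simp add: periodic_min_def)
    then show False using assms that by (auto simp: periodic_min_def dest: spec[of _ "l - j + i"])
  qed
  then show ?thesis by (auto simp: inj_on_def) (metis linorder_neqE_nat)
qed

lemma ex_periodic_min:
  assumes "absv z < 1" "1 \<le> m" "(f ^^ m) z = z"
  shows "\<exists>l. l dvd m \<and> periodic_min absv f l z"
proof -
  define l where "l = (LEAST l. 1 \<le> l \<and> (f ^^ l) z = z)"
  have l: "1 \<le> l" "(f ^^ l) z = z" using LeastI[of "\<lambda>l. 1 \<le> l \<and> (f ^^ l) z = z" m] assms by (auto simp: l_def)
  have least: "(f ^^ k) z \<noteq> z" if "1 \<le> k" "k < l" for k
    using that not_less_Least[of k "\<lambda>l. 1 \<le> l \<and> (f ^^ l) z = z"] by (auto simp: l_def)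
  have "(f ^^ (m mod l)) z = z" using funpow_mod_eq[OF l(2)] assms(3) by simp
  then have "m mod l = 0" using least[of "m mod l"] l(1) by (cases "m mod l = 0") auto
  then show ?thesis using l least assms(1) by (auto simp: periodic_min_def)
qed

lemma powr_inverse_power: "0 < c \<Longrightarrow> 1 \<le> n \<Longrightarrow> (c powr (1 / real n)) ^ n = c"
  by (simp add: powr_power)

lemma powr_power_inverse: "0 < c \<Longrightarrow> 1 \<le> n \<Longrightarrow> c = (c ^ n) powr (1 / real n)"
  by (simp add: powr_powr flip: powr_realpow)

lemma sum_prime_powers: "2 \<le> p \<Longrightarrow> (\<Sum>j\<le>n. p ^ j) = (p ^ (n + 1) - 1) div (p - 1)" for p :: nat
proof -
  assume p: "2 \<le> p"
  then obtain r where r: "p = Suc r" by (cases p) auto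
  have "(p - 1) * (\<Sum>j\<le>n. p ^ j) + 1 = p ^ (n + 1)"
    by (induction n) (simp_all add: r algebra_simps)
  then have "p ^ (n + 1) - 1 = (p - 1) * (\<Sum>j\<le>n. p ^ j)" by simp
  then show ?thesis using p by simp
qed

lemma minimally_ramified_iff:
  fixes g :: "'k::field poly"
  assumes "coeff g 0 = 0" "2 \<le> p"
  shows "minimally_ramified p q g \<longleftrightarrow> (\<forall>n. poly_iter g (q * p ^ n) - [:0, 1:] \<noteq> 0 \<and>
    Polynomial.order 0 (poly_iter g (q * p ^ n) - [:0, 1:]) = Suc (q * (\<Sum>j\<le>n. p ^ j)))"
  unfolding minimally_ramified_def i_index_eq_enat[OF assms(1)] sum_prime_powers[OF assms(2)] ..

lemma minimally_ramifiedI: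
  fixes g :: "'k::field poly"
  assumes p: "prime p" "odd p" "of_nat p = (0::'k)" and q: "\<not> p dvd q"
    and g0: "coeff g 0 = 0" and g1: "root_of_unity_order (coeff g 1) q"
    and a: "poly_iter g (q * p ^ m) - [:0, 1:] \<noteq> 0"
    and b: "poly_iter g (q * p ^ Suc m) - [:0, 1:] \<noteq> 0"
      "Polynomial.order 0 (poly_iter g (q * p ^ Suc m) - [:0, 1:]) =
       Polynomial.order 0 (poly_iter g (q * p ^ m) - [:0, 1:]) + q * p ^ Suc m"
  shows "minimally_ramified p q g"
proof -
  have conv: "fps_iter (fps_of_poly g) k - fps_X = fps_of_poly (poly_iter g k - [:0, 1:])" for k
    by (simp add: fps_of_poly_poly_iter g0 fps_of_poly_diff fps_of_poly_pCons)
  have nz: "F \<noteq> 0 \<longleftrightarrow> fps_of_poly F \<noteq> 0" for F :: "'k poly" by (metis fps_of_poly_0 fps_of_poly_eq_iff)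
  have sub: "subdegree (fps_of_poly F) = Polynomial.order 0 F" if "F \<noteq> 0" for F :: "'k poly"
    using that by (rule subdegree_fps_of_poly)
  have "poly (poly_iter g (q * p ^ m) - [:0, 1:]) 0 = 0"
    by (simp add: poly_0_coeff_0 coeff_0_poly_iter g0)
  then have "Polynomial.order 0 (poly_iter g (q * p ^ m) - [:0, 1:]) \<noteq> 0"
    using a order_root by blast
  then obtain i where i: "Polynomial.order 0 (poly_iter g (q * p ^ m) - [:0, 1:]) = Suc i"
    by (cases "Polynomial.order 0 (poly_iter g (q * p ^ m) - [:0, 1:])") auto
  have "poly_iter g (q * p ^ n) - [:0, 1:] \<noteq> 0 \<and>
      Polynomial.order 0 (poly_iter g (q * p ^ n) - [:0, 1:]) = Suc (q * (\<Sum>j\<le>n. p ^ j))" for n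
    using fps_minimally_ramified[OF p q, of "fps_of_poly g" m i n] g0 g1 a b i
    unfolding conv by (metis (no_types, lifting) nz sub add_Suc fps_of_poly_nth)
  then show ?thesis
    using minimally_ramified_iff[OF g0] prime_ge_2_nat[OF p(1)] by blast
qed

locale indifferent_poly = valued_field absv red for absv :: "'a::field \<Rightarrow> real" and red :: "'a \<Rightarrow> 'k::field" +
  fixes p q :: nat and lam :: 'a and P :: "'a poly"
  assumes prime_p: "prime p" and odd_p: "odd p" and char_p: "of_nat p = (0::'k)"
    and q_ndvd: "\<not> p dvd q"
    and lam: "absv lam = 1" "root_of_unity_order (red lam) q"
    and P: "integral P" "coeff P 0 = 0" "coeff P 1 = lam"
begin

lemma q_pos: "1 \<le> q"
  using lam(2) by (simp add: root_of_unity_order_def)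

lemma poly_iter_split:
  obtains C where "integral C" "poly_iter P m = [:0, lam ^ m:] + [:0, 0, 1:] * C"
proof -
  obtain b D where b: "poly_iter P m = pCons b D" by (cases "poly_iter P m")
  obtain c C where c: "D = pCons c C" by (cases D)
  have "b = 0" "c = lam ^ m"
    using coeff_0_poly_iter[OF P(2), of m] coeff_1_poly_iter[OF P(2), of m] P(3) by (simp_all add: b c)
  moreover have "integral C" using integral_poly_iter[OF P(1), of m] by (simp add: b c)
  ultimately show ?thesis by (intro that[of C]) (simp_all add: b c)
qed

lemma poly_iter_nth_0: "coeff (poly_iter P m) 0 = 0"
  by (rule coeff_0_poly_iter[OF P(2)])

text \<open>The m-th iterate of z is z (lam^m + z C(z)) with C integral, and the bracket has
  absolute value 1.\<close>

lemma abs_funpow: "absv z < 1 \<Longrightarrow> absv ((poly P ^^ m) z) = absv z"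
proof -
  assume z: "absv z < 1"
  obtain C where C: "integral C" "poly_iter P m = [:0, lam ^ m:] + [:0, 0, 1:] * C" by (rule poly_iter_split)
  have "(poly P ^^ m) z = z * (lam ^ m + z * poly C z)"
    unfolding poly_poly_iter[symmetric] C(2) by (simp add: algebra_simps)
  moreover have "absv (lam ^ m + z * poly C z) = 1"
    using abs_eqI[of "lam ^ m + z * poly C z" "lam ^ m"] abs_mult_less_1[OF z integral_poly[OF C(1)]] z
    by (simp add: abs_power lam)
  ultimately show ?thesis by (simp add: abs_mult)
qed

text \<open>For nonzero z fixed by the m-th iterate, lam^m + z C(z) = 1. Hence lam^m reduces to
  1.\<close>

lemma q_dvd_period:
  assumes z: "absv z < 1" "z \<noteq> 0" and m: "(poly P ^^ m) z = z"
  shows "q dvd m"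
proof -
  obtain C where C: "integral C" "poly_iter P m = [:0, lam ^ m:] + [:0, 0, 1:] * C" by (rule poly_iter_split)
  have "(poly P ^^ m) z = z * (lam ^ m + z * poly C z)"
    unfolding poly_poly_iter[symmetric] C(2) by (simp add: algebra_simps)
  with m z(2) have "lam ^ m + z * poly C z = 1" by simp
  then have eq: "lam ^ m - 1 = - (z * poly C z)" by (simp add: eq_neg_iff_add_eq_0 algebra_simps)
  have "absv (lam ^ m - 1) < 1"
    unfolding eq using abs_mult_less_1[OF z(1) integral_poly[OF C(1)]] z(1) by simp
  then have "red (lam ^ m - 1) = 0" by (simp add: red_eq_0_iff)
  then have "red lam ^ m = 1" by (simp add: red_diff red_power abs_power lam)
  then show ?thesis using root_of_unity_order_power_eq_1[OF lam(2)] by blast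
qed

lemma ex_period:
  assumes z: "absv z < 1" "z \<noteq> 0" and m: "(poly P ^^ (q * p ^ n)) z = z"
  obtains j where "j \<le> n" "periodic_min absv (poly P) (q * p ^ j) z"
proof -
  have "1 \<le> q * p ^ n" using q_pos prime_gt_0_nat[OF prime_p] by simp
  then obtain l where l: "l dvd q * p ^ n" "periodic_min absv (poly P) l z"
    using ex_periodic_min[of absv z "q * p ^ n" "poly P"] z m by blast
  have "(poly P ^^ l) z = z" using l(2) unfolding periodic_min_def by blast
  then have "q dvd l" by (rule q_dvd_period[OF z])
  then obtain c where c: "l = q * c" by (elim dvdE)
  then have "c dvd p ^ n" using l(1) q_pos by simp
  then obtain j where "j \<le> n" "c = p ^ j" using divides_primepow_nat[OF prime_p] by auto
  then show ?thesis using that l(2) c by blast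
qed

lemma ex_period':
  assumes z: "absv z < 1" "(poly P ^^ (q * p ^ Suc n)) z = z" "(poly P ^^ (q * p ^ n)) z \<noteq> z"
  shows "periodic_min absv (poly P) (q * p ^ Suc n) z"
proof -
  have fz: "(poly P ^^ m) 0 = 0" for m by (induction m) (simp_all add: poly_0_coeff_0 P)
  have "z \<noteq> 0" using z(3) fz by metis
  then obtain j where j: "j \<le> Suc n" "periodic_min absv (poly P) (q * p ^ j) z"
    using ex_period[OF z(1) _ z(2)] by blast
  have "\<not> j \<le> n"
  proof
    assume "j \<le> n"
    then have e: "q * p ^ n = q * p ^ j * p ^ (n - j)" by (simp flip: power_add)
    then have "(poly P ^^ (q * p ^ n)) z = z"
      using funpow_fixed[of "q * p ^ j" "poly P" z "p ^ (n - j)"] j(2) unfolding e periodic_min_def by blast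
    with z(3) show False by simp
  qed
  with j show ?thesis by (metis le_antisym not_less_eq_eq)
qed

section \<open>The quotient belonging to a period\<close>

text \<open>\<open>quot n\<close> belongs to the period q p^(n+1). It is chosen together with its
  values at fixed points and its reduction, because the factorisation alone does not determine them
  when the divisor or its reduction is 0. The reduction in the last clause is the constant p, which
  is 0 in the residue field.\<close>

definition quot :: "nat \<Rightarrow> 'a poly" where
  "quot n = (SOME D. integral D \<and>
     poly_iter P (q * p ^ Suc n) - [:0, 1:] = (poly_iter P (q * p ^ n) - [:0, 1:]) * D \<and>
     (\<forall>z. poly (poly_iter P (q * p ^ n)) z = z \<longrightarrow>
       poly D z = (\<Sum>j<p. poly (pderiv (poly_iter P (q * p ^ n))) z ^ j)) \<and>
     (Red (poly_iter P (q * p ^ n)) = [:0, 1:] \<longrightarrow> Red D = 0))"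

lemma quot:
  shows integral_quot: "integral (quot n)"
    and quot_mult: "poly_iter P (q * p ^ Suc n) - [:0, 1:] = (poly_iter P (q * p ^ n) - [:0, 1:]) * quot n"
    and poly_quot: "(poly P ^^ (q * p ^ n)) z = z \<Longrightarrow>
      poly (quot n) z = (\<Sum>j<p. poly (pderiv (poly_iter P (q * p ^ n))) z ^ j)"
    and Red_quot: "Red (poly_iter P (q * p ^ n)) = [:0, 1:] \<Longrightarrow> Red (quot n) = 0"
proof -
  have "of_nat p = (0 :: 'k poly)" using char_p by (simp add: of_nat_poly)
  moreover have "poly_iter (poly_iter P (q * p ^ n)) p = poly_iter P (q * p ^ Suc n)"
    by (simp add: poly_iter_mult mult_ac)
  ultimately have "\<exists>D. integral D \<and>
     poly_iter P (q * p ^ Suc n) - [:0, 1:] = (poly_iter P (q * p ^ n) - [:0, 1:]) * D \<and>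
     (\<forall>z. poly (poly_iter P (q * p ^ n)) z = z \<longrightarrow>
       poly D z = (\<Sum>j<p. poly (pderiv (poly_iter P (q * p ^ n))) z ^ j)) \<and>
     (Red (poly_iter P (q * p ^ n)) = [:0, 1:] \<longrightarrow> Red D = 0)"
    using poly_iter_quotient[OF integral_poly_iter[OF P(1)], of "q * p ^ n" p] by metis
  from someI_ex[OF this, folded quot_def]
  show "integral (quot n)"
    "poly_iter P (q * p ^ Suc n) - [:0, 1:] = (poly_iter P (q * p ^ n) - [:0, 1:]) * quot n"
    "(poly P ^^ (q * p ^ n)) z = z \<Longrightarrow>
      poly (quot n) z = (\<Sum>j<p. poly (pderiv (poly_iter P (q * p ^ n))) z ^ j)"
    "Red (poly_iter P (q * p ^ n)) = [:0, 1:] \<Longrightarrow> Red (quot n) = 0"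
    by (auto simp: poly_poly_iter)
qed

lemma Red_quot_mult:
  "poly_iter (Red P) (q * p ^ Suc n) - [:0, 1:] = (poly_iter (Red P) (q * p ^ n) - [:0, 1:]) * Red (quot n)"
proof -
  have "Red (poly_iter P (q * p ^ Suc n) - [:0, 1:]) = Red ((poly_iter P (q * p ^ n) - [:0, 1:]) * quot n)"
    by (simp only: quot_mult)
  moreover have "integral [:0, 1:]" by simp
  ultimately show ?thesis using integral_poly_iter[OF P(1)] integral_quot
    by (simp only: Red_mult Red_diff integral_diff Red_poly_iter[OF P(1)]) simp
qed

text \<open>Comparison of the coefficients of X in the factorisation. It identifies the constant
  term of \<open>quot n\<close> with the quotient in the definition of an optimal cycle of period q
  p^(n+1).\<close>

lemma coeff_0_quot:
  "coeff (quot n) 0 * (lam ^ (q * p ^ n) - 1) = lam ^ (q * p ^ Suc n) - 1"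
proof -
  have "coeff (poly_iter P (q * p ^ Suc n) - [:0, 1:]) 1 = coeff ((poly_iter P (q * p ^ n) - [:0, 1:]) * quot n) 1"
    by (simp only: quot_mult)
  moreover have "coeff (A * B) 1 = coeff A 0 * coeff B 1 + coeff A 1 * coeff B 0" for A B :: "'a poly"
    by (simp add: coeff_mult)
  ultimately have "coeff (poly_iter P (q * p ^ Suc n)) 1 - 1 = (coeff (poly_iter P (q * p ^ n)) 1 - 1) * coeff (quot n) 0"
    by (simp add: poly_iter_nth_0 coeff_pCons del: power_Suc)
  then show ?thesis unfolding coeff_1_poly_iter[OF P(2)] P(3) by (simp add: mult.commute)
qed

lemma quot_root:
  assumes "periodic_min absv (poly P) (q * p ^ Suc n) z"
  shows "poly (quot n) z = 0"
proof -
  have lt: "1 \<le> q * p ^ n" "q * p ^ n < q * p ^ Suc n"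
    using q_pos prime_ge_2_nat[OF prime_p] by auto
  then have "(poly P ^^ (q * p ^ n)) z \<noteq> z" "(poly P ^^ (q * p ^ Suc n)) z = z"
    using assms by (auto simp: periodic_min_def)
  then show ?thesis using arg_cong[OF quot_mult, of "\<lambda>F. poly F z" n]
    by (simp add: poly_poly_iter del: power_Suc)
qed

lemma periodic_min_funpow:
  assumes "periodic_min absv (poly P) l z"
  shows "periodic_min absv (poly P) l ((poly P ^^ j) z)"
proof -
  let ?f = "poly P"
  have l: "1 \<le> l" "(?f ^^ l) z = z" "absv z < 1" using assms by (auto simp: periodic_min_def)
  have comm: "(?f ^^ m) ((?f ^^ j) z) = (?f ^^ j) ((?f ^^ m) z)" for m
    by (metis add.commute funpow_add o_apply)
  have "(?f ^^ m) ((?f ^^ j) z) \<noteq> (?f ^^ j) z" if m: "1 \<le> m" "m < l" for m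
  proof
    assume a: "(?f ^^ m) ((?f ^^ j) z) = (?f ^^ j) z"
    \<comment> \<open>On the orbit of z the i-th iterate undoes the j-th, because i + j is a
      multiple of l.\<close>
    define i where "i = l * j - j"
    have "i + j = l * j" using l(1) by (simp add: i_def)
    then have b: "(?f ^^ i) ((?f ^^ j) z) = z" using funpow_fixed[OF l(2), of j] by (metis funpow_add o_apply)
    have "(?f ^^ m) ((?f ^^ i) ((?f ^^ j) z)) = (?f ^^ i) ((?f ^^ m) ((?f ^^ j) z))"
      by (metis add.commute funpow_add o_apply)
    then have "(?f ^^ m) z = z" by (simp only: a b)
    then show False using assms m by (simp add: periodic_min_def)
  qed
  then show ?thesis using l by (auto simp: periodic_min_def abs_funpow comm)
qed

text \<open>The l points of the orbit are distinct and have the same absolute value as z, so they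
  give l linear factors whose constant terms multiply to absolute value |z|^l.\<close>

lemma orbit_factors:
  assumes z: "periodic_min absv (poly P) l z" and F: "integral F" "\<And>j. poly F ((poly P ^^ j) z) = 0"
  obtains rs G where "set rs = (\<lambda>j. (poly P ^^ j) z) ` {..<l}" "distinct rs"
    "length rs = l" "F = (\<Prod>r\<leftarrow>rs. [:- r, 1:]) * G" "integral G"
    "(\<Prod>r\<leftarrow>rs. absv r) = absv z ^ l" "\<And>r. r \<in> set rs \<Longrightarrow> absv r < 1"
proof -
  let ?O = "(\<lambda>j. (poly P ^^ j) z) ` {..<l}"
  have z1: "absv z < 1" using z by (simp add: periodic_min_def)
  have O: "absv r = absv z \<and> poly F r = 0" if "r \<in> ?O" for r
    using that abs_funpow[OF z1] F(2) by auto
  have fin: "finite ?O" by simp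
  have roots: "absv r < 1 \<and> poly F r = 0" if "r \<in> ?O" for r using O[OF that] z1 by simp
  obtain rs G where rs: "set rs = ?O" "distinct rs" "F = (\<Prod>r\<leftarrow>rs. [:- r, 1:]) * G" "integral G"
    by (rule divide_distinct_roots[OF fin F(1) roots])
  have len: "length rs = l"
    using distinct_card[OF rs(2)] card_image[OF periodic_min_inj_on[OF z]] rs(1) by simp
  have "map absv rs = replicate (length rs) (absv z)"
    unfolding map_replicate_const[symmetric] map_eq_conv rs(1) using O by blast
  then have "(\<Prod>r\<leftarrow>rs. absv r) = absv z ^ l" by (simp add: len)
  then show ?thesis using that[OF rs(1,2) len rs(3,4)] roots rs(1) by blast
qed

lemma funpow_orbit:
  assumes l: "1 \<le> l" "(f ^^ l) z = z" and "j < l"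
  shows "\<exists>i. (f ^^ i) ((f ^^ j) z) = (z::'b)"
  using assms by (intro exI[of _ "l - j"]) (simp flip: funpow_add[THEN fun_cong, unfolded o_apply])

theorem optimal_cycle_unique:
  assumes n: "1 \<le> n" and opt: "has_optimal_cycle absv lam q p n (poly P)"
  shows "(\<forall>z w. periodic_min absv (poly P) (q * p ^ n) z \<longrightarrow> periodic_min absv (poly P) (q * p ^ n) w \<longrightarrow>
       (\<exists>j. w = (poly P ^^ j) z))" (is ?unique)
    and "minimally_ramified p q (Red P)"
proof -
  obtain m where m: "n = Suc m" using n by (cases n) auto
  let ?N = "q * p ^ Suc m"
  obtain z where z: "periodic_min absv (poly P) ?N z"
    and zabs: "absv z = absv ((lam ^ ?N - 1) / (lam ^ (q * p ^ m) - 1)) powr (1 / real ?N)"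
    and lamN: "lam ^ ?N \<noteq> 1"
    using opt by (auto simp: has_optimal_cycle_def optimal_point_def m simp del: power_Suc)
  have N: "1 \<le> ?N" using q_pos prime_gt_0_nat[OF prime_p] by simp
  have "lam ^ ?N = (lam ^ (q * p ^ m)) ^ p" by (simp add: mult.commute mult.left_commute flip: power_mult)
  then have lamM: "lam ^ (q * p ^ m) \<noteq> 1" using lamN by auto
  have c0: "coeff (quot m) 0 = (lam ^ ?N - 1) / (lam ^ (q * p ^ m) - 1)"
    using coeff_0_quot[of m] lamM by (simp add: eq_divide_eq del: power_Suc)
  then have "coeff (quot m) 0 \<noteq> 0" using lamN lamM by simp
  then have c0pos: "0 < absv (coeff (quot m) 0)" using abs_nonneg by (metis abs_eq_0 order_le_less)
  obtain rs G where rs: "set rs = (\<lambda>j. (poly P ^^ j) z) ` {..<?N}" "distinct rs"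
    "length rs = ?N" "quot m = (\<Prod>r\<leftarrow>rs. [:- r, 1:]) * G" "integral G"
    "(\<Prod>r\<leftarrow>rs. absv r) = absv z ^ ?N" "\<And>r. r \<in> set rs \<Longrightarrow> absv r < 1"
    using orbit_factors[OF z integral_quot quot_root[OF periodic_min_funpow[OF z]]] by metis
  \<comment> \<open>Optimality says that the orbit alone accounts for the size of the constant term,
    so the cofactor has absolute value 1 at 0 and no zeros in the open disc.\<close>
  have "absv z ^ ?N = absv (coeff (quot m) 0)"
    unfolding zabs c0[symmetric] by (rule powr_inverse_power[OF c0pos N])
  moreover have "absv (coeff (quot m) 0) = absv z ^ ?N * absv (coeff G 0)"
    unfolding rs(4) rs(6)[symmetric] by (rule abs_coeff_0_factors)
  ultimately have "absv (coeff (quot m) 0) * absv (coeff G 0) = absv (coeff (quot m) 0)" by metis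
  then have G0: "absv (coeff G 0) = 1" using c0pos by auto
  note W = weierstrass_factors[OF rs(4,7,5) G0]
  have orbit: "\<exists>j<?N. w = (poly P ^^ j) z" if "periodic_min absv (poly P) ?N w" for w
    using W(3)[of w] quot_root[OF that] that rs(1) by (auto simp: periodic_min_def)
  show ?unique unfolding m
  proof (intro allI impI)
    fix u w assume "periodic_min absv (poly P) ?N u" "periodic_min absv (poly P) ?N w"
    then obtain i j where ij: "i < ?N" "u = (poly P ^^ i) z" "w = (poly P ^^ j) z" using orbit by blast
    have "(poly P ^^ ?N) z = z" using z unfolding periodic_min_def by blast
    from funpow_orbit[OF N this ij(1)] obtain k where k: "(poly P ^^ k) u = z" unfolding ij(2) ..
    show "\<exists>j. w = (poly P ^^ j) u"
      by (rule exI[of _ "j + k"]) (simp only: funpow_add o_apply k ij(3))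
  qed
  show "minimally_ramified p q (Red P)"
  proof (rule minimally_ramifiedI[OF prime_p odd_p char_p q_ndvd, of _ m])
    show "coeff (Red P) 0 = 0" "root_of_unity_order (coeff (Red P) 1) q" using P lam by simp_all
    \<comment> \<open>If the reduction of this iterate were X, the quotient would reduce to 0,
      against the factorisation just found.\<close>
    have nz: "poly_iter (Red P) (q * p ^ m) - [:0, 1:] \<noteq> 0"
      using W(1) Red_quot[of m] Red_poly_iter[OF P(1)] by auto
    note mult = Red_quot_mult
    show "poly_iter (Red P) (q * p ^ m) - [:0, 1:] \<noteq> 0" by (rule nz)
    show "poly_iter (Red P) ?N - [:0, 1:] \<noteq> 0" unfolding mult using nz W(1) by simp
    then show "Polynomial.order 0 (poly_iter (Red P) ?N - [:0, 1:]) =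
        Polynomial.order 0 (poly_iter (Red P) (q * p ^ m) - [:0, 1:]) + ?N"
      unfolding mult using W(1) rs(3) by (simp add: order_mult)
  qed
qed

end

section \<open>Existence of optimal cycles\<close>

text \<open>The operator identity for the (p-1)-st power of a difference, applied to multiplication
  by \<mu>.\<close>

lemma sum_powers_char_p:
  fixes \<mu> :: "'a::field"
  assumes "prime p" "of_nat p = (0::'a)"
  shows "(\<Sum>j<p. \<mu> ^ j) = (\<mu> - 1) ^ (p - 1)"
proof -
  have "((\<lambda>x. \<mu> * x - x) ^^ k) 1 = (\<mu> - 1) ^ k" "((\<lambda>x. \<mu> * x) ^^ k) 1 = \<mu> ^ k" for k
    by (induction k) (simp_all add: algebra_simps)
  then show ?thesis
    using funpow_diff_prime_minus_1[of "\<lambda>x. \<mu> * x" p 1] assms by (simp add: distrib_left)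
qed

text \<open>Frobenius is injective: \<nu>^p - 1 = (\<nu> - 1)^p.\<close>

lemma power_prime_power_eq_1_char_p:
  fixes \<nu> :: "'a::field"
  assumes p: "prime p" "of_nat p = (0::'a)" and "\<nu> ^ (p ^ k) = 1"
  shows "\<nu> = 1"
  using assms(3)
proof (induction k arbitrary: \<nu>)
  case (Suc k)
  then have "(\<nu> ^ p) ^ (p ^ k) = 1" by (simp add: power_mult)
  then have "\<nu> ^ p = 1" by (rule Suc.IH)
  moreover have "\<nu> ^ p - 1 = (\<nu> - 1) * (\<Sum>j<p. \<nu> ^ j)" by (rule power_diff_1_eq)
  ultimately show ?case by (auto simp: sum_powers_char_p[OF p])
qed simp

context indifferent_poly
begin

context
  assumes ram: "minimally_ramified p q (Red P)"
    and lam_not_root_of_unity: "\<And>m. 1 \<le> m \<Longrightarrow> lam ^ m \<noteq> 1"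
    and multipliers: "\<And>m z. of_nat p \<noteq> (0::'a) \<Longrightarrow> 1 \<le> m \<Longrightarrow> (poly P ^^ m) z = z \<Longrightarrow>
      (\<Sum>j<p. poly (pderiv (poly_iter P m)) z ^ j) \<noteq> 0"
begin

private lemma order_Red_iter:
  "poly_iter (Red P) (q * p ^ n) - [:0, 1:] \<noteq> 0"
  "Polynomial.order 0 (poly_iter (Red P) (q * p ^ n) - [:0, 1:]) = Suc (q * (\<Sum>j\<le>n. p ^ j))"
  using ram minimally_ramified_iff[of "Red P" p q] prime_ge_2_nat[OF prime_p] P by auto

private lemma order_Red_quot:
  "Red (quot n) \<noteq> 0" "Polynomial.order 0 (Red (quot n)) = q * p ^ Suc n"
proof -
  show nz: "Red (quot n) \<noteq> 0"
    using order_Red_iter(1)[of "Suc n"] Red_quot_mult[of n] by auto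
  then have "Polynomial.order 0 (poly_iter (Red P) (q * p ^ Suc n) - [:0, 1:]) =
      Polynomial.order 0 (poly_iter (Red P) (q * p ^ n) - [:0, 1:]) + Polynomial.order 0 (Red (quot n))"
    using order_Red_iter(1)[of n] by (simp only: Red_quot_mult) (simp add: order_mult)
  then show "Polynomial.order 0 (Red (quot n)) = q * p ^ Suc n"
    unfolding order_Red_iter(2) by (simp add: algebra_simps)
qed

text \<open>A single cycle already supplies q p^(n+1) distinct zeros, as many as the order of the
  reduction allows, so nothing is left for the cofactor.\<close>

private lemma orbit_quot_factors:
  assumes z: "periodic_min absv (poly P) (q * p ^ Suc n) z"
  obtains rs G where "set rs = (\<lambda>j. (poly P ^^ j) z) ` {..<q * p ^ Suc n}" "distinct rs"
    "quot n = (\<Prod>r\<leftarrow>rs. [:- r, 1:]) * G" "integral G" "absv (coeff G 0) = 1"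
    "(\<Prod>r\<leftarrow>rs. absv r) = absv z ^ (q * p ^ Suc n)" "\<And>r. r \<in> set rs \<Longrightarrow> absv r < 1"
proof -
  obtain rs G where rs: "set rs = (\<lambda>j. (poly P ^^ j) z) ` {..<q * p ^ Suc n}" "distinct rs"
    "length rs = q * p ^ Suc n" "quot n = (\<Prod>r\<leftarrow>rs. [:- r, 1:]) * G" "integral G"
    "(\<Prod>r\<leftarrow>rs. absv r) = absv z ^ (q * p ^ Suc n)" "\<And>r. r \<in> set rs \<Longrightarrow> absv r < 1"
    using orbit_factors[OF z integral_quot quot_root[OF periodic_min_funpow[OF z]]] by metis
  have "absv (coeff G 0) = 1"
    using order_Red_eq_length_imp_unit[OF rs(4,7,5)] order_Red_quot[of n] rs(3) by simp
  with rs show ?thesis using that by metis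
qed

text \<open>For period q there is no earlier quotient, and B = (P^q - X) / X takes its place: its
  reduction has order q, and the q nonzero points of the orbit are simple zeros of B. The multiplier
  minus 1 is then z B'(z). At z = 0 the multiplier is lam^q, which is not 1.\<close>

private lemma multiplier_neq_1_first:
  assumes z: "periodic_min absv (poly P) q z"
  shows "poly (pderiv (poly_iter P q)) z \<noteq> 1"
proof (cases "z = 0")
  case True
  have "poly (pderiv (poly_iter P q)) 0 = lam ^ q"
    using coeff_1_poly_iter[OF P(2), of q] P(3) by (simp add: poly_0_coeff_0 coeff_pderiv)
  then show ?thesis using lam_not_root_of_unity[OF q_pos] True by simp
next
  case False
  have z1: "absv z < 1" and zq: "(poly P ^^ q) z = z" using z by (auto simp: periodic_min_def)
  obtain b B where bB: "poly_iter P q - [:0, 1:] = pCons b B" by (cases "poly_iter P q - [:0, 1:]")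
  have "coeff (poly_iter P q - [:0, 1:]) 0 = 0" by (simp add: poly_iter_nth_0)
  then have "b = 0" unfolding bB by simp
  then have B: "poly_iter P q - [:0, 1:] = pCons 0 B" using bB by simp
  have intB: "integral B"
  proof -
    have "integral (poly_iter P q - [:0, 1:])" by (intro integral_diff integral_poly_iter P) simp
    then show ?thesis by (simp add: B)
  qed
  have RB: "poly_iter (Red P) q - [:0, 1:] = pCons 0 (Red B)"
  proof -
    have "Red (poly_iter P q - [:0, 1:]) = pCons 0 (Red B)" by (simp add: B)
    moreover have "integral [:0, 1:]" by simp
    ultimately show ?thesis using integral_poly_iter[OF P(1), of q]
      by (simp only: Red_diff Red_poly_iter[OF P(1)]) simp
  qed
  have ordB: "Red B \<noteq> 0" "Polynomial.order 0 (Red B) = q"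
  proof -
    have "coeff (pCons 0 (Red B)) (Suc q) \<noteq> 0 \<and> (\<forall>i<Suc q. coeff (pCons 0 (Red B)) i = 0)"
      using order_Red_iter[of 0] unfolding poly_order_0_eq_iff[symmetric] by (simp add: RB)
    then have "coeff (Red B) q \<noteq> 0 \<and> (\<forall>i<q. coeff (Red B) i = 0)"
      by (metis Suc_less_eq coeff_pCons_Suc)
    then show "Red B \<noteq> 0" "Polynomial.order 0 (Red B) = q"
      unfolding poly_order_0_eq_iff[symmetric] by auto
  qed
  have "poly B ((poly P ^^ j) z) = 0" for j
  proof -
    let ?w = "(poly P ^^ j) z"
    have "absv ?w = absv z" by (rule abs_funpow[OF z1])
    then have "?w \<noteq> 0" using False by auto
    moreover have "(poly P ^^ q) ?w = ?w" using periodic_min_funpow[OF z, of j] unfolding periodic_min_def by blast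
    ultimately show ?thesis using arg_cong[OF B, of "\<lambda>F. poly F ?w"] by (simp add: poly_poly_iter)
  qed
  then obtain rs G where rs: "set rs = (\<lambda>j. (poly P ^^ j) z) ` {..<q}" "distinct rs"
    "length rs = q" "B = (\<Prod>r\<leftarrow>rs. [:- r, 1:]) * G" "integral G" "\<And>r. r \<in> set rs \<Longrightarrow> absv r < 1"
    using orbit_factors[OF z intB] by metis
  have "absv (coeff G 0) = 1"
    using order_Red_eq_length_imp_unit[OF rs(4,6,5)] ordB rs(3) by simp
  moreover have "z \<in> set rs" unfolding rs(1) using q_pos by (intro image_eqI[of _ _ 0]) auto
  ultimately have "poly (pderiv B) z \<noteq> 0" using simple_root[OF rs(4,6,5) _ rs(2)] by blast
  moreover have "poly B z = 0"
    using arg_cong[OF B, of "\<lambda>F. poly F z"] zq False by (simp add: poly_poly_iter)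
  moreover have "poly (pderiv (poly_iter P q)) z - 1 = poly B z + z * poly (pderiv B) z"
    using arg_cong[OF B, of "\<lambda>F. poly (pderiv F) z"] by (simp add: pderiv_diff pderiv_pCons)
  ultimately show ?thesis using False by auto
qed

text \<open>For n = m + 1, put M = q p^m. Differentiating the factorisation at z gives multiplier
  minus 1 equal to (P^M(z) - z) times the derivative of \<open>quot m\<close>; the first factor is
  nonzero by minimality of the period, the second because the zero is simple.\<close>

private lemma multiplier_neq_1:
  assumes z: "periodic_min absv (poly P) (q * p ^ n) z"
  shows "poly (pderiv (poly_iter P (q * p ^ n))) z \<noteq> 1"
proof (cases n)
  case 0
  then show ?thesis using multiplier_neq_1_first z by simp
next
  case (Suc m)
  note z' = z[unfolded Suc]
  obtain rs G where rs: "set rs = (\<lambda>j. (poly P ^^ j) z) ` {..<q * p ^ Suc m}" "distinct rs"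
    "quot m = (\<Prod>r\<leftarrow>rs. [:- r, 1:]) * G" "integral G" "absv (coeff G 0) = 1"
    "\<And>r. r \<in> set rs \<Longrightarrow> absv r < 1"
    using orbit_quot_factors[OF z'] by metis
  have "0 < q * p ^ Suc m" using q_pos prime_gt_0_nat[OF prime_p] by simp
  then have "z \<in> set rs" unfolding rs(1) by (intro image_eqI[of _ _ 0]) auto
  then have s: "poly (pderiv (quot m)) z \<noteq> 0" using simple_root[OF rs(3,6,4,5,2)] by blast
  have nf: "(poly P ^^ (q * p ^ m)) z \<noteq> z"
    using z' q_pos prime_ge_2_nat[OF prime_p] by (auto simp: periodic_min_def)
  have "poly (pderiv (poly_iter P (q * p ^ Suc m))) z - 1 =
      poly (pderiv ((poly_iter P (q * p ^ m) - [:0, 1:]) * quot m)) z"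
    using arg_cong[OF quot_mult, of "\<lambda>F. poly (pderiv F) z" m] by (simp add: pderiv_diff pderiv_pCons del: power_Suc)
  also have "\<dots> = ((poly P ^^ (q * p ^ m)) z - z) * poly (pderiv (quot m)) z"
    using quot_root[OF z'] by (simp add: pderiv_mult poly_poly_iter)
  finally show ?thesis using s nf unfolding Suc by auto
qed

text \<open>For a zero of smaller period the powers of the multiplier sum to 0.
  \<open>multipliers\<close> leaves only characteristic p, where the multiplier is 1. It is a
  p-power of the multiplier at the true period q p^j, which therefore is 1 too, against
  \<open>multiplier_neq_1\<close>.\<close>

private lemma quot_root_period:
  assumes r: "absv r < 1" "poly (quot n) r = 0"
  shows "periodic_min absv (poly P) (q * p ^ Suc n) r"
proof (rule ex_period'[OF r(1)])
  show "(poly P ^^ (q * p ^ Suc n)) r = r"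
    using arg_cong[OF quot_mult, of "\<lambda>F. poly F r" n] r(2) by (simp add: poly_poly_iter del: power_Suc)
  show "(poly P ^^ (q * p ^ n)) r \<noteq> r"
  proof
    assume fixed: "(poly P ^^ (q * p ^ n)) r = r"
    let ?\<mu> = "poly (pderiv (poly_iter P (q * p ^ n))) r"
    have \<mu>: "(\<Sum>j<p. ?\<mu> ^ j) = 0" using poly_quot[OF fixed] r(2) by simp
    have N: "1 \<le> q * p ^ n" using q_pos prime_gt_0_nat[OF prime_p] by simp
    have c: "of_nat p = (0::'a)" using multipliers[OF _ N fixed] \<mu> by blast
    have "?\<mu> = 1" using \<mu> unfolding sum_powers_char_p[OF prime_p c] by simp
    \<comment> \<open>This separates r from the fixed point 0, so that its minimal period has the
      form q p^j.\<close>
    have "coeff (quot n) 0 \<noteq> 0"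
      using coeff_0_quot[of n] lam_not_root_of_unity[of "q * p ^ Suc n"] q_pos prime_gt_0_nat[OF prime_p]
      by auto
    then have "r \<noteq> 0" using r(2) by (auto simp: poly_0_coeff_0)
    then obtain j where j: "j \<le> n" "periodic_min absv (poly P) (q * p ^ j) r"
      using ex_period[OF r(1) _ fixed] by blast
    have fixj: "poly (poly_iter P (q * p ^ j)) r = r" using j(2) unfolding periodic_min_def poly_poly_iter by blast
    have e: "q * p ^ n = q * p ^ j * p ^ (n - j)" using j(1) by (simp flip: power_add)
    have "poly_iter P (q * p ^ n) = poly_iter (poly_iter P (q * p ^ j)) (p ^ (n - j))"
      by (simp only: e poly_iter_mult)
    then have "?\<mu> = poly (pderiv (poly_iter P (q * p ^ j))) r ^ (p ^ (n - j))"
      using poly_pderiv_poly_iter[OF fixj] by metis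
    then have "poly (pderiv (poly_iter P (q * p ^ j))) r = 1"
      using \<open>?\<mu> = 1\<close> power_prime_power_eq_1_char_p[OF prime_p c] by metis
    with multiplier_neq_1[OF j(2)] show False by simp
  qed
qed

text \<open>The reduction of the quotient has positive order, so there is a zero in the open disc.
  Its cycle accounts for the whole constant term of the quotient, which fixes its absolute value at
  the optimal one.\<close>

theorem has_optimal_cycle_generic:
  assumes "1 \<le> n"
  shows "has_optimal_cycle absv lam q p n (poly P)"
proof -
  obtain m where m: "n = Suc m" using assms by (cases n) auto
  let ?N = "q * p ^ Suc m"
  have N: "1 \<le> ?N" and M: "1 \<le> q * p ^ m" using q_pos prime_gt_0_nat[OF prime_p] by simp_all
  obtain rs G where rs: "quot m = (\<Prod>r\<leftarrow>rs. [:- r, 1:]) * G" "\<And>r. r \<in> set rs \<Longrightarrow> absv r < 1"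
    "integral G" "absv (coeff G 0) = 1"
    using weierstrass_factorization[OF integral_quot order_Red_quot(1)] by metis
  have "length rs = ?N" using weierstrass_factors(1)[OF rs] order_Red_quot(2)[of m] by simp
  then obtain r where r: "r \<in> set rs" using N by (cases rs) auto
  have "poly (quot m) r = 0" using weierstrass_factors(3)[OF rs rs(2)[OF r]] r by blast
  then have per: "periodic_min absv (poly P) ?N r" using quot_root_period rs(2)[OF r] by blast
  obtain rs' G' where rs': "quot m = (\<Prod>r\<leftarrow>rs'. [:- r, 1:]) * G'" "absv (coeff G' 0) = 1"
    "(\<Prod>r\<leftarrow>rs'. absv r) = absv r ^ ?N"
    using orbit_quot_factors[OF per] by metis
  have c: "absv (coeff (quot m) 0) = absv r ^ ?N"
    unfolding rs'(1) abs_coeff_0_factors rs'(2,3) by simp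
  have lamN: "lam ^ ?N \<noteq> 1" "lam ^ (q * p ^ m) \<noteq> 1"
    using lam_not_root_of_unity N M by blast+
  then have c0: "coeff (quot m) 0 = (lam ^ ?N - 1) / (lam ^ (q * p ^ m) - 1)"
    using coeff_0_quot[of m] by (simp add: eq_divide_eq del: power_Suc)
  have "absv r ^ ?N \<noteq> 0" unfolding c[symmetric] c0 using lamN by simp
  then have "0 < absv r" using N abs_nonneg[of r] by (metis less_eq_real_def power_eq_0_iff not_one_le_zero gr0I)
  then have "absv r = absv (coeff (quot m) 0) powr (1 / real ?N)"
    unfolding c using powr_power_inverse N by metis
  then show ?thesis
    unfolding has_optimal_cycle_def optimal_point_def m using lamN per by (auto simp: c0 simp del: power_Suc)
qed

end

end

context valued_field
begin

lemma abs_of_nat_le_1: "absv (of_nat n) \<le> 1"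
  by (induction n) (simp_all add: abs_add_le_1)

lemma red_of_nat: "red (of_nat n) = of_nat n"
  by (induction n) (simp_all add: red_add abs_of_nat_le_1)

text \<open>A natural number that vanishes in the field also vanishes after reduction, so it is a
  multiple of p; when p is nonzero in the field it can be cancelled, and descent finishes.\<close>

lemma of_nat_neq_0:
  assumes p: "prime p" "of_nat p = (0::'k)" "of_nat p \<noteq> (0::'a)" and "0 < n"
  shows "of_nat n \<noteq> (0::'a)"
  using assms(4)
proof (induction n rule: less_induct)
  case (less n)
  show ?case
  proof
    assume n0: "of_nat n = (0::'a)"
    then have "of_nat n = (0::'k)" using red_of_nat[of n] by simp
    then have "p dvd n" using not_dvd_of_nat[OF p(1) _ p(2)] by blast
    then obtain k where k: "n = p * k" by (elim dvdE)
    then have "k < n" "0 < k" using less.prems prime_ge_2_nat[OF p(1)] by auto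
    then show False using less.IH[of k] n0 p(3) k by simp
  qed
qed

end

theorem theoremB:
  fixes absv :: "'a::field \<Rightarrow> real" and red :: "'a \<Rightarrow> 'k::field"
    and p q :: nat
  assumes abs: "ultrametric_abs absv"
    and closed: "alg_closed_field TYPE('a)"
    and res: "residue_map absv red"
    and prime_p: "prime p" and odd_p: "odd p"
    and char_p: "of_nat p = (0::'k)"
    and q_pos: "1 \<le> q" and q_ndvd: "\<not> p dvd q"
  shows
   "(\<forall>(lam::'a) (n::nat) (P::'a poly).
       absv lam = 1 \<longrightarrow> root_of_unity_order (red lam) q \<longrightarrow> 1 \<le> n \<longrightarrow>
       (\<forall>i. absv (coeff P i) \<le> 1) \<longrightarrow> coeff P 0 = 0 \<longrightarrow> coeff P 1 = lam \<longrightarrow>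
       has_optimal_cycle absv lam q p n (poly P) \<longrightarrow>
       ((\<forall>z w. periodic_min absv (poly P) (q * p ^ n) z \<longrightarrow>
               periodic_min absv (poly P) (q * p ^ n) w \<longrightarrow>
               (\<exists>j. w = (poly P ^^ j) z)) \<and>
        minimally_ramified p q (map_poly red P)))
    \<and>
    (\<forall>(\<gamma>::'k) (g::'k poly) (d::nat) (a::nat \<Rightarrow> 'a).
       root_of_unity_order \<gamma> q \<longrightarrow> coeff g 0 = 0 \<longrightarrow> coeff g 1 = \<gamma> \<longrightarrow>
       minimally_ramified p q g \<longrightarrow>
       max (degree g) p \<le> d \<longrightarrow>
       (\<forall>i\<in>{1..d}. absv (a i) \<le> 1) \<longrightarrow> alg_indep_prime d a \<longrightarrow>
       map_poly red (\<Sum>i=1..d. monom (a i) i) = g \<longrightarrow>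
       (\<forall>n::nat. 1 \<le> n \<longrightarrow>
          has_optimal_cycle absv (a 1) q p n (poly (\<Sum>i=1..d. monom (a i) i)) \<and>
          (\<forall>z w. periodic_min absv (poly (\<Sum>i=1..d. monom (a i) i)) (q * p ^ n) z \<longrightarrow>
                 periodic_min absv (poly (\<Sum>i=1..d. monom (a i) i)) (q * p ^ n) w \<longrightarrow>
                 (\<exists>j. w = (poly (\<Sum>i=1..d. monom (a i) i) ^^ j) z))))"
proof -
  interpret valued_field absv red by unfold_locales (fact abs closed res)+
  have part1: "(\<forall>z w. periodic_min absv (poly P) (q * p ^ n) z \<longrightarrow> periodic_min absv (poly P) (q * p ^ n) w \<longrightarrow>
        (\<exists>j. w = (poly P ^^ j) z)) \<and> minimally_ramified p q (map_poly red P)"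
    if "absv lam = 1" "root_of_unity_order (red lam) q" "1 \<le> n" "\<forall>i. absv (coeff P i) \<le> 1"
      "coeff P 0 = 0" "coeff P 1 = lam" "has_optimal_cycle absv lam q p n (poly P)" for lam n P
  proof -
    interpret indifferent_poly absv red p q lam P
      by unfold_locales (use that prime_p odd_p char_p q_ndvd in \<open>simp_all add: integral_def\<close>)
    show ?thesis using optimal_cycle_unique[OF that(3,7)] by blast
  qed
  have part2: "has_optimal_cycle absv (a 1) q p n (poly P) \<and>
        (\<forall>z w. periodic_min absv (poly P) (q * p ^ n) z \<longrightarrow> periodic_min absv (poly P) (q * p ^ n) w \<longrightarrow>
          (\<exists>j. w = (poly P ^^ j) z))"
    if \<gamma>: "root_of_unity_order \<gamma> q" and g: "coeff g 1 = \<gamma>" "minimally_ramified p q g"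
      and d: "max (degree g) p \<le> d" and a: "\<forall>i\<in>{1..d}. absv (a i) \<le> 1" "alg_indep_prime d a"
      and P_eq: "P = (\<Sum>i=1..d. monom (a i) i)" "map_poly red P = g" and n: "1 \<le> n" for \<gamma> g d a P n
  proof -
    have d2: "2 \<le> d" using d prime_ge_2_nat[OF prime_p] by simp
    have cP: "coeff P i = (if 1 \<le> i \<and> i \<le> d then a i else 0)" for i
      unfolding P_eq(1) by (rule coeff_sum_monom)
    have intP: "\<forall>i. absv (coeff P i) \<le> 1" using a(1) by (simp add: cP)
    have a1: "coeff P 1 = a 1" using d2 by (simp add: cP)
    then have red_a1: "red (a 1) = \<gamma>" using g(1) P_eq(2) coeff_Red[of P 1] by simp
    have "\<gamma> \<noteq> 0" using \<gamma> by (auto simp: root_of_unity_order_def power_0_left)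
    then have abs_a1: "absv (a 1) = 1"
      using red_eq_0_iff[of "a 1"] intP[rule_format, of 1] red_a1 unfolding a1 by force
    interpret indifferent_poly absv red p q "a 1" P
      by unfold_locales
        (use abs_a1 red_a1 \<gamma> intP a1 prime_p odd_p char_p q_ndvd in \<open>simp_all add: integral_def cP\<close>)
    \<comment> \<open>Sending all coefficients to 0 would turn the relation a 1 ^ m = 1 into 0 =
      1.\<close>
    have nr: "a 1 ^ m \<noteq> 1" if m: "1 \<le> m" for m
    proof
      assume "a 1 ^ m = 1"
      moreover have "specializes d a (\<lambda>_. 0 :: 'a) (a 1 ^ m - 1) (0 ^ m - 1)"
        using d2 by (intro specializes_diff specializes_power specializes_var specializes_1) simp
      ultimately have "specializes d a (\<lambda>_. 0 :: 'a) 0 (0 ^ m - 1)" by simp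
      then have "(0::'a) ^ m - 1 = 0" by (rule alg_indep_specializes_eq_0[OF a(2), rotated])
      then show False using m by (simp add: power_0_left)
    qed
    have mult: "(\<Sum>j<p. poly (pderiv (poly_iter P m)) z ^ j) \<noteq> 0"
      if "of_nat p \<noteq> (0::'a)" "1 \<le> m" "(poly P ^^ m) z = z" for m z
      unfolding P_eq(1)
    proof (rule alg_indep_multiplier[OF a(2) _ d2 that(2) prime_ge_2_nat[OF prime_p]])
      show "of_nat n \<noteq> (0::'a)" if "0 < n" for n
        using of_nat_neq_0[OF prime_p char_p] \<open>of_nat p \<noteq> 0\<close> that by blast
      show "poly (poly_iter (\<Sum>i=1..d. monom (a i) i) m) z = z"
        using that(3) unfolding P_eq(1) poly_poly_iter .
    qed
    have "has_optimal_cycle absv (a 1) q p n (poly P)"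
      using has_optimal_cycle_generic[OF _ nr mult n] g(2) P_eq(2) by blast
    with optimal_cycle_unique(1)[OF n this] show ?thesis by blast
  qed
  show ?thesis
  proof ((rule conjI; (rule allI impI)+), goal_cases)
    case (1 lam n P)
    then show ?case by (rule part1)
  next
    case (2 \<gamma> g d a n)
    show ?case by (rule part2[OF 2(1,3-7) refl 2(8,9)])
  qed
qed

end
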